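(* There is a universal constant $\alpha>0$ such that for every $k,m,t\in\mathbb{N}$ there is an explicit $(\delta_1^*(t),c_1(t))$-FGPR from $m$-restricted constraint graphs with alphabet $\mathbb{F}_2^k$ to $O(mt)$-restricted constraint graphs with alphabet $\mathbb{F}_2^{s(k,t)}$ (for some function $s$), with $\delta_1^*(t)\ge\alpha t$. Furthermore, every constraint of the produced constraint graph is a conjunction of $O(t)$ constraints of the input graph and equality constraints, and the set of constraints (i.e. which such conjunctions are formed) depends only on the factor graph of the input. In particular, two close $m$-restricted constraint graphs are transformed into two close $O(mt)$-restricted constraint graphs.
   Context: A CSP is $P=(V,\Sigma,C)$ with constraints $c=\langle U,f\rangle$, $U\subseteq V$, $f:\Sigma^U\to\{0,1\}$; $\mathrm{UNSAT}(P)$ is the minimum over assignments $V\to\Sigma$ of the fraction of unsatisfied constraints, and $|P|=|V|+|C|$. A constraint graph is a CSP in which every constraint involves exactly two variables (an edge); its factor graph is the bipartite variable–constraint incidence graph. For $\Sigma=\mathbb{F}_2^k$, a constraint is $m$-restricted if it is equivalent to the simultaneous vanishing of a set $\{P_i^e\}$ of at most $m$ polynomials of degree at most two over $\mathbb{F}_2$ in the bits of its variables' values (it is associated with $\{P_i^e\}$); an $m$-restricted constraint graph has only $m$-restricted constraints. Two $m$-restricted constraint graphs are close if they share factor graph and alphabet and for every edge $e$, if one's constraint on $e$ is associated with $\{P_i^e\}$ then the other's is associated with $\{P_i^e+b_i^e\}$, $b_i^e\in\{0,1\}$. A $(\delta,d)$-FGPR is a transformation between classes of CSP instances such that equal factor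 graphs map to equal factor graphs; for some constant $\xi>0$, $\mathrm{UNSAT}(A)=0\Rightarrow\mathrm{UNSAT}(A')=0$ and $\mathrm{UNSAT}(A)\ge\epsilon\Rightarrow \mathrm{UNSAT}(A')\ge\delta\min\{\epsilon,\xi\}$; and $|A'|\le d|A|$. *)

theory Defs
  imports Complex_Main "HOL-Library.FuncSet" "HOL-Library.Z2" "HOL-Library.Poly_Mapping"
begin

section \<open>Constraint satisfaction problems\<close>

text \<open>
  The variables of an instance are \<open>0, \<dots>, num_vars P - 1\<close>. The constraints form an indexed
  family, so that several constraints may live on the same set of variables.
  In a constraint \<open>\<langle>U, f\<rangle>\<close> the predicate \<open>f\<close> is only meaningful on the (extensional) functions
  \<open>U \<rightarrow>\<^sub>E \<Sigma>\<close>; well-formedness makes it false elsewhere, so that it is determined by its values there.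
\<close>

type_synonym var = nat

record 'a constraint =
  scope :: "var set"
  pred :: "(var \<Rightarrow> 'a) \<Rightarrow> bool"

record 'a csp =
  num_vars :: nat
  alphabet :: "'a set"
  constraints :: "'a constraint list"

definition vars :: "'a csp \<Rightarrow> var set" where
  "vars P = {..<num_vars P}"

definition wf_csp :: "'a csp \<Rightarrow> bool" where
  "wf_csp P \<longleftrightarrow> finite (alphabet P) \<and> alphabet P \<noteq> {} \<and>
     (\<forall>c\<in>set (constraints P). scope c \<subseteq> vars P \<and>
        (\<forall>a. pred c a \<longrightarrow> a \<in> scope c \<rightarrow>\<^sub>E alphabet P))"

text \<open>For an instance without constraints the fraction below is \<open>0 / 0 = 0\<close>.\<close>

definition unsat_fraction :: "'a csp \<Rightarrow> (var \<Rightarrow> 'a) \<Rightarrow> real" where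
  "unsat_fraction P a =
     real (card {j. j < length (constraints P) \<and>
                    \<not> pred (constraints P ! j) (restrict a (scope (constraints P ! j)))})
     / real (length (constraints P))"

definition UNSAT :: "'a csp \<Rightarrow> real" where
  "UNSAT P = Min (unsat_fraction P ` (vars P \<rightarrow>\<^sub>E alphabet P))"

definition csp_size :: "'a csp \<Rightarrow> nat" where
  "csp_size P = card (vars P) + length (constraints P)"

definition constraint_graph :: "'a csp \<Rightarrow> bool" where
  "constraint_graph P \<longleftrightarrow> wf_csp P \<and> (\<forall>c\<in>set (constraints P). card (scope c) = 2)"

text \<open>
  The labelled bipartite incidence graph: number of variable nodes, number of constraint nodes,
  and the incidences \<open>(variable, constraint)\<close>.
\<close>

type_synonym factor_graph = "nat \<times> nat \<times> (var \<times> nat) set"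

definition factor_graph :: "'a csp \<Rightarrow> factor_graph" where
  "factor_graph P =
     (num_vars P, length (constraints P),
      {(v, j). j < length (constraints P) \<and> v \<in> scope (constraints P ! j)})"


section \<open>Fixed-graph reductions\<close>

definition fgpr :: "real \<Rightarrow> real \<Rightarrow> 'a csp set \<Rightarrow> 'b csp set \<Rightarrow> ('a csp \<Rightarrow> 'b csp) \<Rightarrow> bool" where
  "fgpr \<delta> d \<A> \<B> T \<longleftrightarrow>
     (\<forall>A\<in>\<A>. T A \<in> \<B>) \<and>
     (\<forall>A\<in>\<A>. \<forall>B\<in>\<A>. factor_graph A = factor_graph B \<longrightarrow> factor_graph (T A) = factor_graph (T B)) \<and>
     (\<exists>\<xi>>0. \<forall>A\<in>\<A>. (UNSAT A = 0 \<longrightarrow> UNSAT (T A) = 0) \<and>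
        (\<forall>\<epsilon>. UNSAT A \<ge> \<epsilon> \<longrightarrow> UNSAT (T A) \<ge> \<delta> * min \<epsilon> \<xi>)) \<and>
     (\<forall>A\<in>\<A>. real (csp_size (T A)) \<le> d * real (csp_size A))"


section \<open>Restricted constraint graphs\<close>

definition words :: "nat \<Rightarrow> bit list set" where
  "words k = {w. length w = k}"

text \<open>
  Polynomials over the two-element field; the indeterminate \<open>(v, i)\<close> stands for bit \<open>i\<close> of
  the value of variable \<open>v\<close>.
\<close>

type_synonym bit_poly = "((var \<times> nat) \<Rightarrow>\<^sub>0 nat) \<Rightarrow>\<^sub>0 bit"

definition eval_poly :: "bit_poly \<Rightarrow> (var \<Rightarrow> bit list) \<Rightarrow> bit" where
  "eval_poly p a =
     (\<Sum>mon\<in>Poly_Mapping.keys p. Poly_Mapping.lookup p mon *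
        (\<Prod>(v, i)\<in>Poly_Mapping.keys mon. (a v ! i) ^ Poly_Mapping.lookup mon (v, i)))"

definition degree_le :: "nat \<Rightarrow> bit_poly \<Rightarrow> bool" where
  "degree_le d p \<longleftrightarrow>
     (\<forall>mon\<in>Poly_Mapping.keys p. (\<Sum>x\<in>Poly_Mapping.keys mon. Poly_Mapping.lookup mon x) \<le> d)"

definition indets :: "bit_poly \<Rightarrow> (var \<times> nat) set" where
  "indets p = (\<Union>mon\<in>Poly_Mapping.keys p. Poly_Mapping.keys mon)"

definition const_poly :: "bit \<Rightarrow> bit_poly" where
  "const_poly b = Poly_Mapping.single 0 b"

definition associated :: "nat \<Rightarrow> bit list constraint \<Rightarrow> bit_poly list \<Rightarrow> bool" where
  "associated k c ps \<longleftrightarrow>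
     (\<forall>p\<in>set ps. degree_le 2 p \<and> indets p \<subseteq> scope c \<times> {..<k}) \<and>
     (\<forall>a\<in>scope c \<rightarrow>\<^sub>E words k. pred c a \<longleftrightarrow> (\<forall>p\<in>set ps. eval_poly p a = 0))"

definition restricted :: "nat \<Rightarrow> nat \<Rightarrow> bit list constraint \<Rightarrow> bool" where
  "restricted m k c \<longleftrightarrow> (\<exists>ps. length ps \<le> m \<and> associated k c ps)"

definition restricted_graphs :: "nat \<Rightarrow> nat \<Rightarrow> bit list csp set" where
  "restricted_graphs m k =
     {A. constraint_graph A \<and> alphabet A = words k \<and> (\<forall>c\<in>set (constraints A). restricted m k c)}"

text \<open>
  A constraint is associated with many families of polynomials. Closeness asks for some family
  associated with the constraint of \<open>A\<close> on each edge, of at most \<open>m\<close> polynomials, a shift of which by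
  constants is associated with the constraint of \<open>B\<close>. Families are lists rather than sets: a
  polynomial that occurs twice may be shifted by different constants.
\<close>

definition close :: "nat \<Rightarrow> nat \<Rightarrow> bit list csp \<Rightarrow> bit list csp \<Rightarrow> bool" where
  "close m k A B \<longleftrightarrow>
     A \<in> restricted_graphs m k \<and> B \<in> restricted_graphs m k \<and> factor_graph A = factor_graph B \<and>
     (\<forall>j<length (constraints A). \<exists>ps bs. length ps \<le> m \<and> length bs = length ps \<and>
        associated k (constraints A ! j) ps \<and>
        associated k (constraints B ! j) (map2 (\<lambda>p b. p + const_poly b) ps bs))"


section \<open>Conjunctions of input constraints and equality constraints\<close>

text \<open>
  A value of an output variable is a word of \<open>s\<close> bits. The slot \<open>(w, i)\<close> designates the \<open>k\<close>
  consecutive bits of the value of \<open>w\<close> starting at position \<open>i\<close>, read as a value of the input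
  alphabet. A conjunct is either the input constraint with a given index, each variable of which
  is read from a slot, or the equality of the contents of two slots.
\<close>

type_synonym slot = "var \<times> nat"

datatype conjunct = Input nat "var \<Rightarrow> slot" | Equal slot slot

fun slot_value :: "nat \<Rightarrow> (var \<Rightarrow> bit list) \<Rightarrow> slot \<Rightarrow> bit list" where
  "slot_value k a (w, i) = take k (drop i (a w))"

definition slots :: "nat \<Rightarrow> nat \<Rightarrow> var set \<Rightarrow> slot set" where
  "slots k s U = {(w, i). w \<in> U \<and> i + k \<le> s}"

fun valid_conjunct :: "nat \<Rightarrow> nat \<Rightarrow> bit list csp \<Rightarrow> var set \<Rightarrow> conjunct \<Rightarrow> bool" where
  "valid_conjunct k s A U (Input j \<pi>) \<longleftrightarrow>
     j < length (constraints A) \<and> \<pi> ` scope (constraints A ! j) \<subseteq> slots k s U"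
| "valid_conjunct k s A U (Equal p q) \<longleftrightarrow> {p, q} \<subseteq> slots k s U"

fun holds :: "nat \<Rightarrow> bit list csp \<Rightarrow> (var \<Rightarrow> bit list) \<Rightarrow> conjunct \<Rightarrow> bool" where
  "holds k A a (Input j \<pi>) \<longleftrightarrow>
     pred (constraints A ! j) (\<lambda>v\<in>scope (constraints A ! j). slot_value k a (\<pi> v))"
| "holds k A a (Equal p q) \<longleftrightarrow> slot_value k a p = slot_value k a q"

definition conjunction_of ::
  "nat \<Rightarrow> nat \<Rightarrow> bit list csp \<Rightarrow> bit list constraint \<Rightarrow> conjunct list \<Rightarrow> bool" where
  "conjunction_of k s A c xs \<longleftrightarrow>
     (\<forall>x\<in>set xs. valid_conjunct k s A (scope c) x) \<and>
     (\<forall>a\<in>scope c \<rightarrow>\<^sub>E words s. pred c a \<longleftrightarrow> (\<forall>x\<in>set xs. holds k A a x))"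

text \<open>
  Every constraint of \<open>T A\<close> is a conjunction of at most \<open>l\<close> conjuncts, and the list of these
  conjunctions is a function \<open>\<Gamma>\<close> of the factor graph of \<open>A\<close> alone.
\<close>

definition forms_conjunctions ::
  "nat \<Rightarrow> nat \<Rightarrow> nat \<Rightarrow> bit list csp set \<Rightarrow> (bit list csp \<Rightarrow> bit list csp) \<Rightarrow> bool" where
  "forms_conjunctions l k s \<A> T \<longleftrightarrow>
     (\<exists>\<Gamma> :: factor_graph \<Rightarrow> conjunct list list. \<forall>A\<in>\<A>.
        length (\<Gamma> (factor_graph A)) = length (constraints (T A)) \<and>
        (\<forall>j<length (constraints (T A)).
           length (\<Gamma> (factor_graph A) ! j) \<le> l \<and>
           conjunction_of k s A (constraints (T A) ! j) (\<Gamma> (factor_graph A) ! j)))"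


section \<open>Explicit transformations\<close>

text \<open>
  A transformation is explicit if it is computable in polynomial time. As a machine model we
  use a small programming language on binary trees, in which a program maps its input tree to an
  output tree. Every step is charged with the size of the tree it works on, so that the cost is
  polynomially related to the running time of a Turing machine (sharing of subtrees is not exploited).
\<close>

datatype tree = Leaf | Node tree tree

primrec tree_size :: "tree \<Rightarrow> nat" where
  "tree_size Leaf = 1"
| "tree_size (Node x y) = tree_size x + tree_size y + 1"

primrec left :: "tree \<Rightarrow> tree" where
  "left Leaf = Leaf"
| "left (Node x y) = x"

primrec right :: "tree \<Rightarrow> tree" where
  "right Leaf = Leaf"
| "right (Node x y) = y"

datatype prog =
    Ident
  | Empty
  | Left
  | Right
  | Pair prog prog
  | Seq prog prog
  | Cond prog prog
  | While prog

text \<open>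
  \<open>run p x n y\<close>: on input \<open>x\<close> the program \<open>p\<close> halts with output \<open>y\<close> at cost \<open>n\<close>.
  Branches and loops test whether the left subtree of the current tree is a leaf.
\<close>

inductive run :: "prog \<Rightarrow> tree \<Rightarrow> nat \<Rightarrow> tree \<Rightarrow> bool" where
  "run Ident x (tree_size x) x"
| "run Empty x (tree_size x) Leaf"
| "run Left x (tree_size x) (left x)"
| "run Right x (tree_size x) (right x)"
| "run p x m y \<Longrightarrow> run q x n z \<Longrightarrow> run (Pair p q) x (m + n + tree_size x) (Node y z)"
| "run p x m y \<Longrightarrow> run q y n z \<Longrightarrow> run (Seq p q) x (m + n + tree_size x) z"
| "left x \<noteq> Leaf \<Longrightarrow> run p x m y \<Longrightarrow> run (Cond p q) x (m + tree_size x) y"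
| "left x = Leaf \<Longrightarrow> run q x m y \<Longrightarrow> run (Cond p q) x (m + tree_size x) y"
| "left x \<noteq> Leaf \<Longrightarrow> run p x m y \<Longrightarrow> run (While p) y n z \<Longrightarrow>
     run (While p) x (m + n + tree_size x) z"
| "left x = Leaf \<Longrightarrow> run (While p) x (tree_size x) x"

definition polytime_computable :: "('a \<Rightarrow> tree) \<Rightarrow> ('b \<Rightarrow> tree) \<Rightarrow> 'a set \<Rightarrow> ('a \<Rightarrow> 'b) \<Rightarrow> bool" where
  "polytime_computable enc_in enc_out \<A> T \<longleftrightarrow>
     (\<exists>p c e. \<forall>A\<in>\<A>. \<exists>n \<le> c * tree_size (enc_in A) ^ e. run p (enc_in A) n (enc_out (T A)))"

primrec encode_list :: "('a \<Rightarrow> tree) \<Rightarrow> 'a list \<Rightarrow> tree" where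
  "encode_list enc [] = Leaf"
| "encode_list enc (x # xs) = Node (enc x) (encode_list enc xs)"

text \<open>
  Numbers are encoded in unary. They are indices of variables, so this is polynomial in the size
  of the instance.
\<close>

definition encode_nat :: "nat \<Rightarrow> tree" where
  "encode_nat n = encode_list (\<lambda>_. Leaf) (replicate n ())"

definition encode_bool :: "bool \<Rightarrow> tree" where
  "encode_bool b = (if b then Node Leaf Leaf else Leaf)"

text \<open>
  The truth table of a constraint over the alphabet \<open>words k\<close>: its variables are taken in
  increasing order, and the tuples of their values in the order of \<^const>\<open>List.n_lists\<close>.
\<close>

definition truth_table :: "nat \<Rightarrow> bit list constraint \<Rightarrow> bool list" where
  "truth_table k c =
     (let vs = sorted_list_of_set (scope c) in
      map (\<lambda>ws. pred c (\<lambda>v\<in>scope c. the (map_of (zip vs ws) v)))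
        (List.n_lists (length vs) (List.n_lists k [0, 1])))"

definition encode_constraint :: "nat \<Rightarrow> bit list constraint \<Rightarrow> tree" where
  "encode_constraint k c =
     Node (encode_list encode_nat (sorted_list_of_set (scope c)))
          (encode_list encode_bool (truth_table k c))"

definition encode_csp :: "nat \<Rightarrow> bit list csp \<Rightarrow> tree" where
  "encode_csp k A =
     Node (encode_nat (num_vars A)) (encode_list (encode_constraint k) (constraints A))"

definition explicit :: "nat \<Rightarrow> nat \<Rightarrow> bit list csp set \<Rightarrow> (bit list csp \<Rightarrow> bit list csp) \<Rightarrow> bool" where
  "explicit k s \<A> T \<longleftrightarrow> polytime_computable (encode_csp k) (encode_csp s) \<A> T"

end

theory Submission
  imports Defs "HOL-Analysis.L2_Norm" "HOL-Analysis.Convex"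
begin

text \<open>
  Each vertex of the input is replaced by a torus carrying the Gabber-Galil expander, with one point
  per incident edge and some padding; a further such expander, without constraints, joins all points.
  Along a random walk of this graph, whose transition operator has a constant spectral gap, the two end
  points hold opinions on every point they pass. The constraint of a walk of length \<open>O(t)\<close> compares these
  opinions and checks every edge of the walk on them.

  Let \<open>F\<close> be the edges violated by the plurality opinions, where the distance to the holder of the
  opinion is uniform below \<open>t\<close>. If a walk crosses an edge of \<open>F\<close> with independent uniform distances to
  its two ends, then it rejects with probability at least \<open>1/4\<close>: an unpopular plurality fails
  the comparison, and two popular ones violate the edge. By the second moment method a walk meets \<open>F\<close>
  with probability of order \<open>min (t \<epsilon>) 1\<close>, and edge expansion of the tori bounds the density \<open>\<epsilon>\<close> of \<open>F\<close> below by a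
  constant multiple of the unsatisfiability of the input. No constant depends on the alphabet.
\<close>

section \<open>The Gabber-Galil expander\<close>

text \<open>An opinion is indexed by a word of labels, not by the point to which the word leads.
  Hence the new alphabet depends only on \<open>k\<close> and \<open>t\<close>, and the opinions
  about \<open>u\<close> are found by walking a word from \<open>u\<close> and reading the reversed
  word at the holder. Independent uniform distances on both sides of a crossed edge require walks of
  varying length: the constraints are all prefixes, with multiplicity, of the walks of
  \<open>2 * t - 1\<close> steps, which contain every pair of distances below \<open>t\<close>. The
  explicit expander exists only on a square number of points; this forces the padding, once for each
  vertex and once for all points together. The input may be disconnected, so the tori of the
  vertices alone give no gap for walks. The global torus supplies it, and as its edges carry no test
  it costs only a constant factor in the density of \<open>F\<close>. The final constant collects
  \<open>7 / 20\<close> from the edge expansion of a torus, 32 points per input edge, 17 labels, and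
  \<open>128 * (3 + 340 / 7)\<close> from the second moment, where
  \<open>340 / 7 = 2 / (1 - 163 / 170)\<close>.\<close>

lemma sum_shift_mod:
  fixes g :: "int \<Rightarrow> 'b::comm_monoid_add" and r c :: int
  assumes "r > 0"
  shows "(\<Sum>x\<in>{0..<r}. g ((x + c) mod r)) = (\<Sum>x\<in>{0..<r}. g x)"
proof (rule sum.reindex_bij_witness[of _ "\<lambda>y. (y - c) mod r" "\<lambda>x. (x + c) mod r"])
qed (use assms in \<open>auto simp: mod_simps\<close>)

section \<open>Additive characters and the Fourier transform on pairs of residues\<close>

definition char_mod :: "int \<Rightarrow> int \<Rightarrow> complex" where
  "char_mod r k = cis (2 * pi * of_int k / of_int r)"

lemma char_mod_add: "char_mod r (a + b) = char_mod r a * char_mod r b"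
  by (simp add: char_mod_def cis_mult add_divide_distrib ring_distribs)

lemma char_mod_0 [simp]: "char_mod r 0 = 1"
  by (simp add: char_mod_def)

lemma cnj_char_mod: "cnj (char_mod r a) = char_mod r (- a)"
  by (simp add: char_mod_def cis_cnj)

lemma char_mod_eq_1_iff:
  assumes "r > 0"
  shows "char_mod r k = 1 \<longleftrightarrow> r dvd k"
proof
  assume "char_mod r k = 1"
  hence "cos (2 * pi * of_int k / of_int r) = 1"
    unfolding char_mod_def by (metis cis.simps(1) one_complex.simps(1))
  then obtain n :: int where "2 * pi * of_int k / of_int r = of_int n * 2 * pi"
    using cos_one_2pi_int by blast
  hence "real_of_int k = of_int n * of_int r"
    using assms by (auto simp: field_simps)
  hence "k = n * r" by (metis of_int_eq_iff of_int_mult)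
  thus "r dvd k" by simp
next
  assume "r dvd k"
  then obtain n where "k = r * n" by blast
  hence "2 * pi * of_int k / of_int r = 2 * pi * of_int n"
    using assms by (simp add: field_simps)
  thus "char_mod r k = 1"
    unfolding char_mod_def by (simp add: cis_multiple_2pi)
qed

lemma char_mod_cong:
  assumes "r > 0" "a mod r = b mod r"
  shows "char_mod r a = char_mod r b"
proof -
  have "r dvd a - b" using assms(2) by (simp add: mod_eq_dvd_iff)
  hence "char_mod r (a - b) = 1" using char_mod_eq_1_iff[OF assms(1)] by simp
  thus ?thesis using char_mod_add[of r "a - b" b] by simp
qed

text \<open>Shifting the index by one multiplies the sum by \<open>char_mod r k\<close>, so the sum
  vanishes unless that factor is 1.\<close>

lemma sum_char_mod:
  assumes "r > 0"
  shows "(\<Sum>b\<in>{0..<r}. char_mod r (b * k)) = (if r dvd k then of_int r else 0)"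
proof (cases "r dvd k")
  case True
  hence "char_mod r (b * k) = 1" for b
    using char_mod_eq_1_iff[OF assms] by (metis dvd_mult)
  thus ?thesis using True assms by simp
next
  case False
  let ?S = "\<Sum>b\<in>{0..<r}. char_mod r (b * k)"
  have "?S = (\<Sum>b\<in>{0..<r}. char_mod r (((b + 1) mod r) * k))"
    using sum_shift_mod[OF assms, of "\<lambda>b. char_mod r (b * k)" 1] by simp
  also have "\<dots> = (\<Sum>b\<in>{0..<r}. char_mod r (b * k) * char_mod r k)"
    unfolding char_mod_add[symmetric]
    by (intro sum.cong refl char_mod_cong[OF assms]) (simp add: mod_simps ring_distribs)
  finally have "?S = ?S * char_mod r k"
    unfolding sum_distrib_right .
  hence "?S * (1 - char_mod r k) = 0" by algebra
  moreover have "char_mod r k \<noteq> 1" using False char_mod_eq_1_iff[OF assms] by simp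
  ultimately show ?thesis using False by simp
qed

text \<open>Factoring out the half angle leaves a real cosine. The sum
  \<open>1 + char_mod r k\<close> arises from two shears that differ by a translation by 1, and its
  norm is the damping they provide at a frequency.\<close>

lemma norm_one_plus_char_mod:
  assumes "r > 0"
  shows "norm (1 + char_mod r k) = 2 * \<bar>cos (pi * of_int k / of_int r)\<bar>"
proof -
  define t where "t = pi * of_int k / of_int r"
  have e: "2 * pi * of_int k / of_int r = t + t" by (simp add: t_def)
  have "1 + char_mod r k = cis t * (cis (-t) + cis t)"
    unfolding char_mod_def e by (simp add: distrib_left cis_mult)
  also have "cis (-t) + cis t = complex_of_real (2 * cos t)"
    by (simp add: complex_eq_iff)
  finally show ?thesis by (simp add: norm_mult t_def)
qed

definition dft :: "int \<Rightarrow> (int \<Rightarrow> int \<Rightarrow> complex) \<Rightarrow> int \<Rightarrow> int \<Rightarrow> complex" where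
  "dft r f a b = (\<Sum>x\<in>{0..<r}. \<Sum>y\<in>{0..<r}. f x y * char_mod r (a * x + b * y))"

lemma dft_cong:
  assumes "r > 0" "a mod r = a' mod r" "b mod r = b' mod r"
  shows "dft r f a b = dft r f a' b'"
  unfolding dft_def
proof (intro sum.cong refl arg_cong2[where f = "(*)"] char_mod_cong[OF assms(1)])
  fix x y
  show "(a * x + b * y) mod r = (a' * x + b' * y) mod r"
    using assms(2,3) by (intro mod_add_cong mod_mult_cong) auto
qed

lemma sum_swap_pairs:
  "(\<Sum>a\<in>A. \<Sum>b\<in>B. \<Sum>x\<in>C. \<Sum>y\<in>D. f a b x y) = (\<Sum>x\<in>C. \<Sum>y\<in>D. \<Sum>a\<in>A. \<Sum>b\<in>B. f a b x y)"
proof -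
  have "(\<Sum>a\<in>A. \<Sum>b\<in>B. \<Sum>x\<in>C. \<Sum>y\<in>D. f a b x y) = (\<Sum>a\<in>A. \<Sum>x\<in>C. \<Sum>b\<in>B. \<Sum>y\<in>D. f a b x y)"
    by (intro sum.cong refl sum.swap)
  also have "\<dots> = (\<Sum>x\<in>C. \<Sum>a\<in>A. \<Sum>b\<in>B. \<Sum>y\<in>D. f a b x y)"
    by (rule sum.swap)
  also have "\<dots> = (\<Sum>x\<in>C. \<Sum>a\<in>A. \<Sum>y\<in>D. \<Sum>b\<in>B. f a b x y)"
    by (intro sum.cong refl sum.swap)
  also have "\<dots> = (\<Sum>x\<in>C. \<Sum>y\<in>D. \<Sum>a\<in>A. \<Sum>b\<in>B. f a b x y)"
    by (intro sum.cong refl sum.swap)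
  finally show ?thesis .
qed

lemma sum_product_pairs:
  fixes f g :: "_ \<Rightarrow> _ \<Rightarrow> 'b::comm_semiring_0"
  shows "(\<Sum>a\<in>A. \<Sum>b\<in>B. f a b) * (\<Sum>x\<in>C. \<Sum>y\<in>D. g x y) = (\<Sum>a\<in>A. \<Sum>b\<in>B. \<Sum>x\<in>C. \<Sum>y\<in>D. f a b * g x y)"
  by (simp only: sum_distrib_right) (simp only: sum_distrib_left)

text \<open>Stated for two functions, because the quadratic form pairs a function with the sum of
  its shears. It is orthogonality of characters in both coordinates after exchanging the
  sums.\<close>

lemma dft_parseval:
  assumes r: "r > 0"
  shows "(\<Sum>a\<in>{0..<r}. \<Sum>b\<in>{0..<r}. cnj (dft r f a b) * dft r g a b)
    = of_int r ^ 2 * (\<Sum>x\<in>{0..<r}. \<Sum>y\<in>{0..<r}. cnj (f x y) * g x y)"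
proof -
  let ?I = "{0..<r}"
  have inner: "(\<Sum>a\<in>?I. \<Sum>b\<in>?I. char_mod r (- (a * x + b * y)) * char_mod r (a * x' + b * y'))
      = (if x = x' \<and> y = y' then of_int r ^ 2 else 0)"
    if "x \<in> ?I" "x' \<in> ?I" "y \<in> ?I" "y' \<in> ?I" for x x' y y'
  proof -
    have "(\<Sum>a\<in>?I. \<Sum>b\<in>?I. char_mod r (- (a * x + b * y)) * char_mod r (a * x' + b * y'))
      = (\<Sum>a\<in>?I. \<Sum>b\<in>?I. char_mod r (a * (x' - x)) * char_mod r (b * (y' - y)))"
      unfolding char_mod_add[symmetric] by (simp add: algebra_simps)
    also have "\<dots> = (\<Sum>a\<in>?I. char_mod r (a * (x' - x))) * (\<Sum>b\<in>?I. char_mod r (b * (y' - y)))"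
      by (simp add: sum_product)
    also have "\<dots> = (if x = x' \<and> y = y' then of_int r ^ 2 else 0)"
    proof -
      have dv: "r dvd u' - u \<longleftrightarrow> u = u'" if "u \<in> ?I" "u' \<in> ?I" for u u'
        using that by (metis (no_types) atLeastLessThan_iff mod_eq_dvd_iff mod_pos_pos_trivial)
      show ?thesis using that by (simp add: sum_char_mod[OF r] dv power2_eq_square)
    qed
    finally show ?thesis .
  qed
  have expand: "cnj (dft r f a b) * dft r g a b
    = (\<Sum>x\<in>?I. \<Sum>y\<in>?I. \<Sum>x'\<in>?I. \<Sum>y'\<in>?I. (cnj (f x y) * g x' y') *
        (char_mod r (- (a * x + b * y)) * char_mod r (a * x' + b * y')))" for a b
  proof -
    have "cnj (dft r f a b) = (\<Sum>x\<in>?I. \<Sum>y\<in>?I. cnj (f x y) * char_mod r (- (a * x + b * y)))"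
      unfolding dft_def cnj_sum complex_cnj_mult cnj_char_mod ..
    thus ?thesis
      unfolding dft_def by (simp only: sum_product_pairs) (simp only: mult_ac)
  qed
  have "(\<Sum>a\<in>?I. \<Sum>b\<in>?I. cnj (dft r f a b) * dft r g a b)
    = (\<Sum>a\<in>?I. \<Sum>b\<in>?I. \<Sum>x\<in>?I. \<Sum>y\<in>?I. \<Sum>x'\<in>?I. \<Sum>y'\<in>?I. (cnj (f x y) * g x' y') *
        (char_mod r (- (a * x + b * y)) * char_mod r (a * x' + b * y')))"
    by (intro sum.cong refl expand)
  also have "\<dots> = (\<Sum>x\<in>?I. \<Sum>y\<in>?I. \<Sum>x'\<in>?I. \<Sum>y'\<in>?I. \<Sum>a\<in>?I. \<Sum>b\<in>?I. (cnj (f x y) * g x' y') *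
        (char_mod r (- (a * x + b * y)) * char_mod r (a * x' + b * y')))"
    by (rule trans[OF sum_swap_pairs], intro sum.cong refl sum_swap_pairs)
  also have "\<dots> = (\<Sum>x\<in>?I. \<Sum>y\<in>?I. \<Sum>x'\<in>?I. \<Sum>y'\<in>?I. (cnj (f x y) * g x' y') *
       (if x = x' \<and> y = y' then of_int r ^ 2 else 0))"
    by (intro sum.cong refl) (simp only: sum_distrib_left[symmetric] inner)
  also have "\<dots> = (\<Sum>x\<in>?I. \<Sum>y\<in>?I. \<Sum>x'\<in>?I. if x = x' then cnj (f x y) * g x' y * of_int r ^ 2 else 0)"
  proof (intro sum.cong refl)
    fix x y x' assume "y \<in> ?I"
    thus "(\<Sum>y'\<in>?I. (cnj (f x y) * g x' y') * (if x = x' \<and> y = y' then of_int r ^ 2 else 0))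
      = (if x = x' then cnj (f x y) * g x' y * of_int r ^ 2 else 0)"
      by (cases "x = x'") (auto simp: if_distrib sum.delta cong: if_cong)
  qed
  also have "\<dots> = (\<Sum>x\<in>?I. \<Sum>y\<in>?I. cnj (f x y) * g x y * of_int r ^ 2)"
    by (intro sum.cong refl) (simp add: sum.delta)
  finally show ?thesis by (simp add: sum_distrib_left mult_ac)
qed

text \<open>Substituting \<open>x + 2 * y + c\<close> for \<open>x\<close> moves the shear from the
  point to the frequency, where it acts by the inverse transpose; the translation \<open>c\<close>
  survives only as a phase.\<close>

lemma dft_shear1:
  assumes r: "r > 0"
  shows "dft r (\<lambda>x y. f ((x + 2 * y + c) mod r) y) a b
    = char_mod r (- (a * c)) * dft r f a (b - 2 * a)"
proof -
  let ?I = "{0..<r}"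
  have "dft r (\<lambda>x y. f ((x + 2 * y + c) mod r) y) a b
    = (\<Sum>y\<in>?I. \<Sum>x\<in>?I. f ((x + (2 * y + c)) mod r) y
        * char_mod r (a * ((x + (2 * y + c)) mod r) - a * (2 * y + c) + b * y))"
    unfolding dft_def
  proof (subst sum.swap, intro sum.cong refl)
    fix x y
    have "(a * x + b * y) mod r = (a * ((x + (2 * y + c)) mod r) - a * (2 * y + c) + b * y) mod r"
    proof -
      have "(a * ((x + (2 * y + c)) mod r) - a * (2 * y + c) + b * y) mod r
        = (a * (x + (2 * y + c)) - a * (2 * y + c) + b * y) mod r"
        by (intro mod_add_cong mod_diff_cong mod_mult_cong) auto
      thus ?thesis by (simp add: algebra_simps)
    qed
    from char_mod_cong[OF r this]
    show "f ((x + 2 * y + c) mod r) y * char_mod r (a * x + b * y)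
      = f ((x + (2 * y + c)) mod r) y
        * char_mod r (a * ((x + (2 * y + c)) mod r) - a * (2 * y + c) + b * y)"
      by (simp only: add.assoc)
  qed
  also have "\<dots> = (\<Sum>y\<in>?I. \<Sum>x\<in>?I. f x y * char_mod r (a * x - a * (2 * y + c) + b * y))"
    by (rule sum.cong[OF refl],
        rule sum_shift_mod[OF r, where g = "\<lambda>x. f x y * char_mod r (a * x - a * (2 * y + c) + b * y)" for y])
  also have "\<dots> = (\<Sum>y\<in>?I. \<Sum>x\<in>?I. char_mod r (- (a * c)) * (f x y * char_mod r (a * x + (b - 2 * a) * y)))"
  proof (intro sum.cong refl)
    fix x y
    have "a * x - a * (2 * y + c) + b * y = - (a * c) + (a * x + (b - 2 * a) * y)"
      by (simp add: algebra_simps)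
    thus "f x y * char_mod r (a * x - a * (2 * y + c) + b * y)
      = char_mod r (- (a * c)) * (f x y * char_mod r (a * x + (b - 2 * a) * y))"
      by (simp only: char_mod_add) (simp add: mult_ac)
  qed
  also have "\<dots> = char_mod r (- (a * c)) * dft r f a (b - 2 * a)"
    unfolding dft_def by (subst sum.swap) (simp add: sum_distrib_left)
  finally show ?thesis .
qed

lemma dft_transpose: "dft r (\<lambda>x y. f y x) a b = dft r f b a"
  unfolding dft_def by (subst sum.swap) (simp add: add.commute)

lemma dft_shear2:
  assumes r: "r > 0"
  shows "dft r (\<lambda>x y. f x ((y + 2 * x + c) mod r)) a b
    = char_mod r (- (b * c)) * dft r f (a - 2 * b) b"
proof -
  have "dft r (\<lambda>x y. f x ((y + 2 * x + c) mod r)) a b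
      = dft r (\<lambda>x y. (\<lambda>x y. f y x) ((x + 2 * y + c) mod r) y) b a"
    by (subst dft_transpose[symmetric]) simp
  also have "\<dots> = char_mod r (- (b * c)) * dft r (\<lambda>x y. f y x) b (a - 2 * b)"
    by (rule dft_shear1[OF r])
  also have "dft r (\<lambda>x y. f y x) b (a - 2 * b) = dft r f (a - 2 * b) b"
    by (rule dft_transpose)
  finally show ?thesis .
qed

lemma dft_add: "dft r (\<lambda>x y. f x y + g x y) a b = dft r f a b + dft r g a b"
  unfolding dft_def by (simp add: sum.distrib ring_distribs)


section \<open>Weights of frequencies, measured by the distance to the nearest multiple of the
  modulus\<close>

definition mod_abs :: "int \<Rightarrow> int \<Rightarrow> int" where
  "mod_abs r x = min (x mod r) (- x mod r)"

lemma mod_abs_eq_abs: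
  assumes "r > 0" "2 * \<bar>x\<bar> \<le> r"
  shows "mod_abs r x = \<bar>x\<bar>"
proof (cases "2 * \<bar>x\<bar> = r \<or> x = 0")
  case True
  consider "x = 0" | "x > 0" "2 * x = r" | "x < 0" "2 * (- x) = r"
    using True by fastforce
  thus ?thesis
  proof cases
    case 2
    hence "x mod r = x" "- x mod r = x"
      by (auto simp: zmod_zminus1_eq_if)
    thus ?thesis using 2 by (simp add: mod_abs_def)
  next
    case 3
    hence "- x mod r = - x" "x mod r = - x"
      using zmod_zminus1_eq_if[of "- x" r] by (auto simp: mod_pos_pos_trivial)
    thus ?thesis using 3 by (simp add: mod_abs_def)
  qed (auto simp: mod_abs_def)
next
  case False
  consider "x > 0" "2 * x < r" | "x < 0" "2 * (- x) < r"
    using False assms by fastforce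
  thus ?thesis
  proof cases
    case 1
    hence "x mod r = x" "- x mod r = r - x"
      by (auto simp: zmod_zminus1_eq_if)
    thus ?thesis using 1 by (simp add: mod_abs_def)
  next
    case 2
    hence "- x mod r = - x" "x mod r = r + x"
      using zmod_zminus1_eq_if[of "- x" r] by (auto simp: mod_pos_pos_trivial)
    thus ?thesis using 2 by (simp add: mod_abs_def)
  qed
qed

lemma mod_abs_cong: "x mod r = y mod r \<Longrightarrow> mod_abs r x = mod_abs r y"
  unfolding mod_abs_def by (metis mod_minus_cong)

lemma mod_abs_add_self [simp]: "mod_abs r (x + r) = mod_abs r x"
  by (rule mod_abs_cong) simp

lemma mod_abs_diff_self [simp]: "mod_abs r (x - r) = mod_abs r x"
  by (rule mod_abs_cong) simp

lemma mod_abs_eq_diff_abs: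
  assumes "r > 0" "r \<le> 2 * \<bar>x\<bar>" "\<bar>x\<bar> \<le> r"
  shows "mod_abs r x = r - \<bar>x\<bar>"
proof (cases "x \<ge> 0")
  case True
  hence "mod_abs r (x - r) = \<bar>x - r\<bar>" using assms by (intro mod_abs_eq_abs) auto
  thus ?thesis using True assms by simp
next
  case False
  hence "mod_abs r (x + r) = \<bar>x + r\<bar>" using assms by (intro mod_abs_eq_abs) auto
  thus ?thesis using False assms by simp
qed

lemma balanced_residue_exists:
  assumes "(r::int) > 0"
  obtains x' where "2 * \<bar>x'\<bar> \<le> r" "x' mod r = x mod r"
proof (cases "2 * (x mod r) \<le> r")
  case True
  thus ?thesis using that[of "x mod r"] assms by simp
next
  case False
  have "0 \<le> x mod r" "x mod r < r" using assms by auto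
  hence "2 * \<bar>x mod r - r\<bar> \<le> r" using False by (simp add: abs_if)
  thus ?thesis using that[of "x mod r - r"] by simp
qed

text \<open>The weight with which the move of one frequency coordinate from \<open>a\<close> to \<open>b\<close> enters the
  weighted AM-GM inequality: it favours moves away from the origin. Of the four moves near the origin at most
  one approaches it, which gives the total weight \<open>3 * (4 / 5) + 5 / 4 = 365 / 100 < 4\<close>.\<close>

definition amgm_weight :: "int \<Rightarrow> int \<Rightarrow> int \<Rightarrow> real" where
  "amgm_weight r a b = (if mod_abs r a < mod_abs r b then 4 / 5
     else if mod_abs r b < mod_abs r a then 5 / 4 else 1)"

text \<open>The weights of a move and of its reverse are reciprocal, so this is
  \<open>2 u v \<le> c u^2 + v^2 / c\<close> with \<open>c\<close> one of \<open>4 / 5\<close>,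
  \<open>1\<close>, \<open>5 / 4\<close>.\<close>

lemma amgm_weighted:
  "2 * u * v \<le> amgm_weight r a b * u\<^sup>2 + amgm_weight r b a * v\<^sup>2"
proof -
  have "0 \<le> (4 * u - 5 * v)\<^sup>2" "0 \<le> (5 * u - 4 * v)\<^sup>2" "0 \<le> (u - v)\<^sup>2" by auto
  thus ?thesis unfolding amgm_weight_def
    by (auto simp: power2_eq_square algebra_simps)
qed

lemma amgm_weight_cong:
  "a mod r = a' mod r \<Longrightarrow> b mod r = b' mod r \<Longrightarrow> amgm_weight r a b = amgm_weight r a' b'"
  unfolding amgm_weight_def by (simp only: mod_abs_cong[of a r a'] mod_abs_cong[of b r b'])

lemma amgm_weight_le: "amgm_weight r a b \<le> 5 / 4" "amgm_weight r a b \<ge> 0"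
  by (auto simp: amgm_weight_def)

text \<open>Inside the diamond wrapping around only moves further away:
  \<open>r - \<bar>u + 2 * v\<bar>\<close> is at least
  \<open>r - \<bar>u\<bar> - 2 * \<bar>v\<bar>\<close>, which exceeds \<open>\<bar>u\<bar>\<close>.
  What remains is the comparison of \<open>\<bar>u + 2 * v\<bar>\<close> with
  \<open>\<bar>u\<bar>\<close> over the integers.\<close>

lemma mod_abs_shear:
  assumes r: "r > 0" and uv: "2 * (\<bar>u\<bar> + \<bar>v\<bar>) < r"
  shows "\<bar>u\<bar> \<le> \<bar>v\<bar> \<or> v = 0 \<Longrightarrow> \<bar>u\<bar> \<le> mod_abs r (u + 2 * v)"
    and "\<bar>u\<bar> < \<bar>v\<bar> \<Longrightarrow> \<bar>u\<bar> < mod_abs r (u + 2 * v)"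
    and "u > 0 \<and> v > 0 \<or> u < 0 \<and> v < 0 \<Longrightarrow> \<bar>u\<bar> < mod_abs r (u + 2 * v)"
proof -
  have *: "mod_abs r (u + 2 * v) = \<bar>u + 2 * v\<bar> \<or> mod_abs r (u + 2 * v) = r - \<bar>u + 2 * v\<bar>"
  proof (cases "2 * \<bar>u + 2 * v\<bar> \<le> r")
    case True
    thus ?thesis using mod_abs_eq_abs[OF r True] by simp
  next
    case False
    thus ?thesis using uv r by (intro disjI2 mod_abs_eq_diff_abs; smt (verit))
  qed
  show "\<bar>u\<bar> \<le> \<bar>v\<bar> \<or> v = 0 \<Longrightarrow> \<bar>u\<bar> \<le> mod_abs r (u + 2 * v)"
    and "\<bar>u\<bar> < \<bar>v\<bar> \<Longrightarrow> \<bar>u\<bar> < mod_abs r (u + 2 * v)"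
    and "u > 0 \<and> v > 0 \<or> u < 0 \<and> v < 0 \<Longrightarrow> \<bar>u\<bar> < mod_abs r (u + 2 * v)"
    using * uv by (smt (verit))+
qed

lemma amgm_weight_shear:
  assumes r: "r > 0" and uv: "2 * (\<bar>u\<bar> + \<bar>v\<bar>) < r"
  shows "\<bar>u\<bar> \<le> \<bar>v\<bar> \<or> v = 0 \<Longrightarrow> amgm_weight r u (u + 2 * v) \<le> 1"
    and "\<bar>u\<bar> < \<bar>v\<bar> \<Longrightarrow> amgm_weight r u (u + 2 * v) = 4 / 5"
    and "u > 0 \<and> v > 0 \<or> u < 0 \<and> v < 0 \<Longrightarrow> amgm_weight r u (u + 2 * v) = 4 / 5"
  using mod_abs_shear[OF assms] mod_abs_eq_abs[OF r, of u] uv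
  by (auto simp: amgm_weight_def)

text \<open>The extremal case is \<open>0 < \<bar>y\<bar> < \<bar>x\<bar>\<close>: both moves of the
  smaller coordinate and one move of the larger lead away from the origin. In the boundary cases
  \<open>\<bar>y\<bar> = \<bar>x\<bar>\<close> and \<open>y = 0\<close> two moves lead away and none
  approaches, with total at most \<open>18 / 5\<close>.\<close>

lemma amgm_weights_diamond_le:
  assumes r: "r > 0" and xy: "2 * (\<bar>x\<bar> + \<bar>y\<bar>) < r" and "\<bar>y\<bar> \<le> \<bar>x\<bar>" "x \<noteq> 0"
  shows "amgm_weight r y (y - 2 * x) + amgm_weight r y (y + 2 * x)
    + amgm_weight r x (x - 2 * y) + amgm_weight r x (x + 2 * y) \<le> 365 / 100"
proof -
  have h: "2 * (\<bar>y\<bar> + \<bar>x\<bar>) < r" "2 * (\<bar>y\<bar> + \<bar>-x\<bar>) < r" "2 * (\<bar>x\<bar> + \<bar>-y\<bar>) < r"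
    using xy by auto
  note y1 = amgm_weight_shear[OF r h(1)] and y2 = amgm_weight_shear[OF r h(2)]
    and x1 = amgm_weight_shear[OF r xy] and x2 = amgm_weight_shear[OF r h(3)]
  have opp: "(x > 0 \<and> y > 0 \<or> x < 0 \<and> y < 0) \<or> (x > 0 \<and> - y > 0 \<or> x < 0 \<and> - y < 0)" if "y \<noteq> 0"
    using that assms(4) by linarith
  consider "\<bar>y\<bar> = \<bar>x\<bar>" | "y = 0" | "\<bar>y\<bar> < \<bar>x\<bar>" "y \<noteq> 0" using assms(3) by linarith
  thus ?thesis
  proof cases
    case 1
    hence "y \<noteq> 0" using assms(4) by auto
    from opp[OF this] have
      "amgm_weight r y (y + 2 * x) = 4 / 5 \<and> amgm_weight r x (x + 2 * y) = 4 / 5 \<or>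
       amgm_weight r y (y - 2 * x) = 4 / 5 \<and> amgm_weight r x (x - 2 * y) = 4 / 5"
      using y1(3) y2(3) x1(3) x2(3) by auto
    thus ?thesis using y1(1) y2(1) x1(1) x2(1) 1 by auto
  next
    case 2
    thus ?thesis using y1(2) y2(2) x1(1) x2(1) assms(4) by auto
  next
    case 3
    have "amgm_weight r x (x + 2 * y) = 4 / 5 \<or> amgm_weight r x (x - 2 * y) = 4 / 5"
      using opp[OF 3(2)] x1(3) x2(3) by auto
    thus ?thesis using y1(2) y2(2) 3(1) amgm_weight_le(1)[of r x "x - 2 * y"]
      amgm_weight_le(1)[of r x "x + 2 * y"] by auto
  qed
qed

lemma cos_mod_abs:
  assumes "r > 0" "x mod r = y mod r"
  shows "\<bar>cos (pi * of_int x / of_int r)\<bar> = \<bar>cos (pi * of_int y / of_int r)\<bar>"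
proof -
  have "char_mod r x = char_mod r y" using char_mod_cong[OF assms] .
  hence "norm (1 + char_mod r x) = norm (1 + char_mod r y)" by simp
  thus ?thesis by (simp add: norm_one_plus_char_mod[OF assms(1)])
qed

lemma cos_sum_le_sqrt2:
  assumes "0 \<le> a" "a \<le> pi / 2" "0 \<le> b" "b \<le> pi / 2" "a + b \<ge> pi / 2"
  shows "cos a + cos b \<le> sqrt 2"
proof -
  have "cos b \<le> cos (pi / 2 - a)"
    using assms by (intro cos_monotone_0_pi_le) auto
  also have "\<dots> = sin a" by (simp add: cos_diff)
  finally have "cos a + cos b \<le> cos a + sin a" by simp
  also have "\<dots> \<le> sqrt 2"
  proof (rule real_le_rsqrt)
    have "0 \<le> (cos a - sin a)\<^sup>2" by simp
    moreover have "(cos a + sin a)\<^sup>2 + (cos a - sin a)\<^sup>2 = 2 * ((sin a)\<^sup>2 + (cos a)\<^sup>2)"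
      by (simp add: power2_eq_square algebra_simps)
    ultimately show "(cos a + sin a)\<^sup>2 \<le> 2" by (simp only: sin_cos_squared_add)
  qed
  finally show ?thesis .
qed

text \<open>Two regimes. Inside the diamond the cosines are bounded by 1 and the weights alone
  suffice. Outside it the weights may all be \<open>5 / 4\<close>, but the two angles add up to at
  least \<open>pi / 2\<close>, so the cosines sum to at most \<open>sqrt 2\<close>, and
  \<open>sqrt 2 * (5 / 2) < 365 / 100\<close>.\<close>

lemma frequency_weight_le:
  assumes r: "r > 0" and nz: "\<not> (r dvd x \<and> r dvd y)"
  shows "\<bar>cos (pi * of_int x / of_int r)\<bar> * (amgm_weight r y (y - 2 * x) + amgm_weight r y (y + 2 * x))
    + \<bar>cos (pi * of_int y / of_int r)\<bar> * (amgm_weight r x (x - 2 * y) + amgm_weight r x (x + 2 * y))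
    \<le> 365 / 100"
proof -
  obtain x' where x': "2 * \<bar>x'\<bar> \<le> r" "x' mod r = x mod r" using balanced_residue_exists[OF r] by blast
  obtain y' where y': "2 * \<bar>y'\<bar> \<le> r" "y' mod r = y mod r" using balanced_residue_exists[OF r] by blast
  have eqs: "amgm_weight r y (y - 2 * x) = amgm_weight r y' (y' - 2 * x')"
    "amgm_weight r y (y + 2 * x) = amgm_weight r y' (y' + 2 * x')"
    "amgm_weight r x (x - 2 * y) = amgm_weight r x' (x' - 2 * y')"
    "amgm_weight r x (x + 2 * y) = amgm_weight r x' (x' + 2 * y')"
    using x' y' by (auto intro!: amgm_weight_cong mod_add_cong mod_diff_cong mod_mult_cong)
  have c: "\<bar>cos (pi * of_int x / of_int r)\<bar> = \<bar>cos (pi * of_int x' / of_int r)\<bar>"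
     "\<bar>cos (pi * of_int y / of_int r)\<bar> = \<bar>cos (pi * of_int y' / of_int r)\<bar>"
    using x' y' by (auto intro!: cos_mod_abs[OF r])
  let ?A = "amgm_weight r y' (y' - 2 * x') + amgm_weight r y' (y' + 2 * x')"
  let ?B = "amgm_weight r x' (x' - 2 * y') + amgm_weight r x' (x' + 2 * y')"
  have AB: "0 \<le> ?A" "?A \<le> 5 / 2" "0 \<le> ?B" "?B \<le> 5 / 2"
    using amgm_weight_le(1)[of r y' "y' - 2 * x'"] amgm_weight_le(1)[of r y' "y' + 2 * x'"]
       amgm_weight_le(1)[of r x' "x' - 2 * y'"] amgm_weight_le(1)[of r x' "x' + 2 * y'"]
    by (auto intro!: add_nonneg_nonneg amgm_weight_le(2))
  show ?thesis unfolding eqs c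
  proof (cases "2 * (\<bar>x'\<bar> + \<bar>y'\<bar>) < r")
    case True
    have "\<not> (x' = 0 \<and> y' = 0)"
      using nz x' y' by (metis mod_0 mod_0_imp_dvd)
    hence AB_le: "?A + ?B \<le> 365 / 100"
      using amgm_weights_diamond_le[OF r, of x' y'] amgm_weights_diamond_le[OF r, of y' x'] True by fastforce
    have "\<bar>cos (pi * of_int x' / of_int r)\<bar> * ?A + \<bar>cos (pi * of_int y' / of_int r)\<bar> * ?B \<le> 1 * ?A + 1 * ?B"
      by (intro add_mono mult_right_mono AB(1,3) abs_cos_le_one)
    also have "\<dots> \<le> 365 / 100" using AB_le by (simp only: mult_1)
    finally show "\<bar>cos (pi * of_int x' / of_int r)\<bar> * ?A + \<bar>cos (pi * of_int y' / of_int r)\<bar> * ?B \<le> 365 / 100" .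
  next
    case False
    define a b where "a = pi * of_int \<bar>x'\<bar> / of_int r" and "b = pi * of_int \<bar>y'\<bar> / of_int r"
    have ca: "\<bar>cos (pi * of_int x' / of_int r)\<bar> = \<bar>cos a\<bar>" "\<bar>cos (pi * of_int y' / of_int r)\<bar> = \<bar>cos b\<bar>"
      by (auto simp: a_def b_def abs_if)
    have rr: "real_of_int r > 0" using r by simp
    have "of_int (2 * \<bar>x'\<bar>) \<le> real_of_int r" "of_int (2 * \<bar>y'\<bar>) \<le> real_of_int r"
      "real_of_int r \<le> of_int (2 * (\<bar>x'\<bar> + \<bar>y'\<bar>))"
      using x'(1) y'(1) False by (auto simp only: of_int_le_iff)
    hence i: "pi * (2 * of_int \<bar>x'\<bar>) \<le> pi * real_of_int r" "pi * (2 * of_int \<bar>y'\<bar>) \<le> pi * real_of_int r"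
      "pi * real_of_int r \<le> pi * (2 * (of_int \<bar>x'\<bar> + of_int \<bar>y'\<bar>))"
      by auto
    have range: "0 \<le> a" "a \<le> pi / 2" "0 \<le> b" "b \<le> pi / 2" "a + b \<ge> pi / 2"
      unfolding a_def b_def add_divide_distrib[symmetric] using rr i
      by (simp_all add: pos_divide_le_eq pos_le_divide_eq divide_le_eq le_divide_eq mult_ac ring_distribs)
    have cs: "cos a + cos b \<le> sqrt 2" by (rule cos_sum_le_sqrt2[OF range])
    have pos: "cos a \<ge> 0" "cos b \<ge> 0" using range by (auto intro!: cos_ge_zero)
    have "\<bar>cos a\<bar> * ?A + \<bar>cos b\<bar> * ?B \<le> cos a * (5 / 2) + cos b * (5 / 2)"
      using AB pos by (intro add_mono mult_mono) auto
    also have "\<dots> = (cos a + cos b) * (5 / 2)" by (simp add: algebra_simps)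
    also have "\<dots> \<le> sqrt 2 * (5 / 2)" using cs by (intro mult_right_mono) auto
    also have "\<dots> \<le> 365 / 100"
    proof -
      have "sqrt 2 \<le> 146 / 100" by (rule real_le_lsqrt) (auto simp: power2_eq_square)
      thus ?thesis by simp
    qed
    finally show "\<bar>cos (pi * of_int x' / of_int r)\<bar> * ?A + \<bar>cos (pi * of_int y' / of_int r)\<bar> * ?B \<le> 365 / 100"
      unfolding ca .
  qed
qed

text \<open>The four forward generators of the Gabber-Galil graph; their inverses enter later by
  symmetry. The \<open>+ 0\<close> makes every term a literal instance of \<open>dft_shear1\<close>
  or \<open>dft_shear2\<close>.\<close>

definition shear_sum :: "int \<Rightarrow> (int \<Rightarrow> int \<Rightarrow> 'b) \<Rightarrow> int \<Rightarrow> int \<Rightarrow> 'b::plus" where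
  "shear_sum r f x y = f ((x + 2 * y + 0) mod r) y + f ((x + 2 * y + 1) mod r) y
     + f x ((y + 2 * x + 0) mod r) + f x ((y + 2 * x + 1) mod r)"

text \<open>In Fourier space the shears only permute frequencies, up to the cosine factors. Weighted
  AM-GM splits each product of two amplitudes into squares, and reindexing collects at each
  frequency exactly the weight bounded by \<open>frequency_weight_le\<close>.\<close>

lemma gabber_galil_quadratic_form:
  fixes f :: "int \<Rightarrow> int \<Rightarrow> real"
  assumes r: "r > 0" and mean: "(\<Sum>x\<in>{0..<r}. \<Sum>y\<in>{0..<r}. f x y) = 0"
  shows "\<bar>\<Sum>x\<in>{0..<r}. \<Sum>y\<in>{0..<r}. f x y * shear_sum r f x y\<bar>
    \<le> 365 / 100 * (\<Sum>x\<in>{0..<r}. \<Sum>y\<in>{0..<r}. (f x y)\<^sup>2)"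
proof -
  let ?I = "{0..<r}"
  define c where "c x y = complex_of_real (f x y)" for x y
  define u where "u = shear_sum r c"
  define F where "F = dft r c"
  define G where "G a b = norm (F a b)" for a b
  define w where "w = amgm_weight r"
  define C where "C x = \<bar>cos (pi * of_int x / of_int r)\<bar>" for x
  \<comment> \<open>The mean-zero hypothesis removes the zero frequency, the one frequency that
    \<open>frequency_weight_le\<close> does not cover.\<close>
  have G0: "G a b = 0" if "r dvd a \<and> r dvd b" for a b
  proof -
    have "F a b = F 0 0" unfolding F_def using that by (intro dft_cong[OF r]) auto
    also have "\<dots> = of_real (\<Sum>x\<in>?I. \<Sum>y\<in>?I. f x y)" by (simp add: F_def dft_def c_def)
    finally show ?thesis using mean by (simp add: G_def)
  qed
  have Gcong: "G a b = G a' b'" if "a mod r = a' mod r" "b mod r = b' mod r" for a b a' b'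
    unfolding G_def F_def using dft_cong[OF r that] by simp
  have U: "dft r u a b = F a (b - 2 * a) * (1 + char_mod r (- a)) + F (a - 2 * b) b * (1 + char_mod r (- b))" for a b
    unfolding u_def shear_sum_def[abs_def] dft_add dft_shear1[OF r] dft_shear2[OF r] F_def by (simp add: algebra_simps)
  have pars: "of_int r ^ 2 * (\<Sum>x\<in>?I. \<Sum>y\<in>?I. cnj (c x y) * u x y)
     = (\<Sum>a\<in>?I. \<Sum>b\<in>?I. cnj (F a b) * dft r u a b)"
    unfolding F_def dft_parseval[OF r] ..
  have parsF: "(\<Sum>a\<in>?I. \<Sum>b\<in>?I. (G a b)\<^sup>2) = of_int r ^ 2 * (\<Sum>x\<in>?I. \<Sum>y\<in>?I. (f x y)\<^sup>2)"
  proof -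
    have "complex_of_real (\<Sum>a\<in>?I. \<Sum>b\<in>?I. (G a b)\<^sup>2) = (\<Sum>a\<in>?I. \<Sum>b\<in>?I. cnj (F a b) * F a b)"
      by (simp only: of_real_sum G_def complex_norm_square mult.commute)
    also have "\<dots> = complex_of_real (of_int r ^ 2 * (\<Sum>x\<in>?I. \<Sum>y\<in>?I. (f x y)\<^sup>2))"
      unfolding F_def dft_parseval[OF r] by (simp add: c_def power2_eq_square)
    finally show ?thesis unfolding of_real_eq_iff .
  qed
  have t1: "2 * G a b * G a (b - 2 * a) * C a \<le> C a * (w b (b - 2 * a) * (G a b)\<^sup>2 + w (b - 2 * a) b * (G a (b - 2 * a))\<^sup>2)" for a b
    using mult_left_mono[OF amgm_weighted[of "G a b" "G a (b - 2 * a)" r b "b - 2 * a"], of "C a"]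
    by (simp add: w_def C_def mult_ac)
  have t2: "2 * G a b * G (a - 2 * b) b * C b \<le> C b * (w a (a - 2 * b) * (G a b)\<^sup>2 + w (a - 2 * b) a * (G (a - 2 * b) b)\<^sup>2)" for a b
    using mult_left_mono[OF amgm_weighted[of "G a b" "G (a - 2 * b) b" r a "a - 2 * b"], of "C b"]
    by (simp add: w_def C_def mult_ac)
  have wcong: "w a b = w a' b'" if "a mod r = a' mod r" "b mod r = b' mod r" for a b a' b'
    unfolding w_def using amgm_weight_cong[OF that] .
  have s1: "(\<Sum>b\<in>?I. w (b - 2 * a) b * (G a (b - 2 * a))\<^sup>2) = (\<Sum>b\<in>?I. w b (b + 2 * a) * (G a b)\<^sup>2)" for a
  proof -
    have "(\<Sum>b\<in>?I. w b (b + 2 * a) * (G a b)\<^sup>2)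
       = (\<Sum>b\<in>?I. w ((b + - (2 * a)) mod r) ((b + - (2 * a)) mod r + 2 * a) * (G a ((b + - (2 * a)) mod r))\<^sup>2)"
      by (rule sum_shift_mod[OF r, symmetric])
    also have "\<dots> = (\<Sum>b\<in>?I. w (b - 2 * a) b * (G a (b - 2 * a))\<^sup>2)"
      by (intro sum.cong refl arg_cong2[where f = "(*)"] arg_cong[where f = "\<lambda>x. x\<^sup>2"] wcong Gcong)
         (simp_all add: mod_simps)
    finally show ?thesis ..
  qed
  have s2: "(\<Sum>a\<in>?I. w (a - 2 * b) a * (G (a - 2 * b) b)\<^sup>2) = (\<Sum>a\<in>?I. w a (a + 2 * b) * (G a b)\<^sup>2)" for b
  proof -
    have "(\<Sum>a\<in>?I. w a (a + 2 * b) * (G a b)\<^sup>2)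
       = (\<Sum>a\<in>?I. w ((a + - (2 * b)) mod r) ((a + - (2 * b)) mod r + 2 * b) * (G ((a + - (2 * b)) mod r) b)\<^sup>2)"
      by (rule sum_shift_mod[OF r, symmetric])
    also have "\<dots> = (\<Sum>a\<in>?I. w (a - 2 * b) a * (G (a - 2 * b) b)\<^sup>2)"
      by (intro sum.cong refl arg_cong2[where f = "(*)"] arg_cong[where f = "\<lambda>x. x\<^sup>2"] wcong Gcong)
         (simp_all add: mod_simps)
    finally show ?thesis ..
  qed
  have n1: "norm (1 + char_mod r (- a)) = 2 * C a" for a
    unfolding norm_one_plus_char_mod[OF r] C_def by simp
  have "norm (\<Sum>a\<in>?I. \<Sum>b\<in>?I. cnj (F a b) * dft r u a b)
    \<le> (\<Sum>a\<in>?I. \<Sum>b\<in>?I. norm (cnj (F a b) * dft r u a b))"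
    by (intro order_trans[OF norm_sum] sum_mono) auto
  also have "\<dots> \<le> (\<Sum>a\<in>?I. \<Sum>b\<in>?I. 2 * G a b * G a (b - 2 * a) * C a + 2 * G a b * G (a - 2 * b) b * C b)"
  proof (intro sum_mono)
    fix a b
    have "norm (cnj (F a b) * dft r u a b) = G a b * norm (dft r u a b)" by (simp add: norm_mult G_def)
    also have "\<dots> \<le> G a b * (G a (b - 2 * a) * (2 * C a) + G (a - 2 * b) b * (2 * C b))"
    proof (rule mult_left_mono)
      show "norm (dft r u a b) \<le> G a (b - 2 * a) * (2 * C a) + G (a - 2 * b) b * (2 * C b)"
        unfolding U G_def n1[symmetric] norm_mult[symmetric] by (rule norm_triangle_ineq)
    qed (simp add: G_def)
    finally show "norm (cnj (F a b) * dft r u a b)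
      \<le> 2 * G a b * G a (b - 2 * a) * C a + 2 * G a b * G (a - 2 * b) b * C b"
      by (simp only: algebra_simps)
  qed
  also have "\<dots> \<le> (\<Sum>a\<in>?I. \<Sum>b\<in>?I. C a * (w b (b - 2 * a) * (G a b)\<^sup>2 + w (b - 2 * a) b * (G a (b - 2 * a))\<^sup>2)
       + C b * (w a (a - 2 * b) * (G a b)\<^sup>2 + w (a - 2 * b) a * (G (a - 2 * b) b)\<^sup>2))"
    by (intro sum_mono add_mono t1 t2)
  also have "\<dots> = (\<Sum>a\<in>?I. C a * (\<Sum>b\<in>?I. w b (b - 2 * a) * (G a b)\<^sup>2)) + (\<Sum>a\<in>?I. C a * (\<Sum>b\<in>?I. w (b - 2 * a) b * (G a (b - 2 * a))\<^sup>2))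
       + (\<Sum>b\<in>?I. C b * (\<Sum>a\<in>?I. w a (a - 2 * b) * (G a b)\<^sup>2)) + (\<Sum>b\<in>?I. C b * (\<Sum>a\<in>?I. w (a - 2 * b) a * (G (a - 2 * b) b)\<^sup>2))"
    (is "?L = ?A + ?B + ?C + ?D")
  proof -
    have "?C = (\<Sum>a\<in>?I. \<Sum>b\<in>?I. C b * (w a (a - 2 * b) * (G a b)\<^sup>2))"
      "?D = (\<Sum>a\<in>?I. \<Sum>b\<in>?I. C b * (w (a - 2 * b) a * (G (a - 2 * b) b)\<^sup>2))"
      by (simp_all only: sum_distrib_left) (rule sum.swap)+
    thus ?thesis by (simp only: sum_distrib_left distrib_left sum.distrib add.assoc)
  qed
  also have "\<dots> = (\<Sum>a\<in>?I. \<Sum>b\<in>?I. (C a * (w b (b - 2 * a) + w b (b + 2 * a)) + C b * (w a (a - 2 * b) + w a (a + 2 * b))) * (G a b)\<^sup>2)"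
  proof -
    have "(\<Sum>b\<in>?I. C b * (\<Sum>a\<in>?I. w a (a - 2 * b) * (G a b)\<^sup>2)) = (\<Sum>a\<in>?I. \<Sum>b\<in>?I. C b * (w a (a - 2 * b) * (G a b)\<^sup>2))"
      "(\<Sum>b\<in>?I. C b * (\<Sum>a\<in>?I. w a (a + 2 * b) * (G a b)\<^sup>2)) = (\<Sum>a\<in>?I. \<Sum>b\<in>?I. C b * (w a (a + 2 * b) * (G a b)\<^sup>2))"
      by (simp_all only: sum_distrib_left) (rule sum.swap)+
    thus ?thesis unfolding s1 s2
      by (simp only: sum_distrib_left sum.distrib[symmetric]) (simp only: algebra_simps)
  qed
  also have "\<dots> \<le> (\<Sum>a\<in>?I. \<Sum>b\<in>?I. 365 / 100 * (G a b)\<^sup>2)"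
  proof (intro sum_mono)
    fix a b
    show "(C a * (w b (b - 2 * a) + w b (b + 2 * a)) + C b * (w a (a - 2 * b) + w a (a + 2 * b))) * (G a b)\<^sup>2
      \<le> 365 / 100 * (G a b)\<^sup>2"
    proof (cases "r dvd a \<and> r dvd b")
      case True
      thus ?thesis by (simp add: G0)
    next
      case False
      show ?thesis
        by (intro mult_right_mono) (use frequency_weight_le[OF r False] in \<open>auto simp: C_def w_def\<close>)
    qed
  qed
  also have "\<dots> = of_int r ^ 2 * (365 / 100 * (\<Sum>x\<in>?I. \<Sum>y\<in>?I. (f x y)\<^sup>2))"
    by (simp only: sum_distrib_left[symmetric] parsF mult.left_commute)
  finally have "of_int r ^ 2 * norm (\<Sum>x\<in>?I. \<Sum>y\<in>?I. cnj (c x y) * u x y)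
     \<le> of_int r ^ 2 * (365 / 100 * (\<Sum>x\<in>?I. \<Sum>y\<in>?I. (f x y)\<^sup>2))"
    unfolding pars[symmetric] by (simp add: norm_mult norm_power)
  hence "norm (\<Sum>x\<in>?I. \<Sum>y\<in>?I. cnj (c x y) * u x y) \<le> 365 / 100 * (\<Sum>x\<in>?I. \<Sum>y\<in>?I. (f x y)\<^sup>2)"
    using r by (simp add: mult_le_cancel_left)
  moreover have "(\<Sum>x\<in>?I. \<Sum>y\<in>?I. cnj (c x y) * u x y) = of_real (\<Sum>x\<in>?I. \<Sum>y\<in>?I. f x y * shear_sum r f x y)"
    by (simp add: c_def u_def shear_sum_def)
  ultimately show ?thesis by (simp only: norm_of_real)
qed

text \<open>Point \<open>(x, y)\<close> of the torus has index \<open>x * r + y\<close>. Labels 4 to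
  7 invert labels 0 to 3; since subtraction on \<open>nat\<close> truncates,
  \<open>2 * (r - y)\<close> and \<open>r - 1\<close> stand for \<open>-2 y\<close> and
  \<open>-1\<close> modulo \<open>r\<close>.\<close>

fun gg_step :: "nat \<Rightarrow> nat \<Rightarrow> nat \<Rightarrow> nat" where
  "gg_step r g i = (let x = i div r; y = i mod r in
     if g = 0 then (x + 2 * y) mod r * r + y
     else if g = 1 then (x + 2 * y + 1) mod r * r + y
     else if g = 2 then x * r + (y + 2 * x) mod r
     else if g = 3 then x * r + (y + 2 * x + 1) mod r
     else if g = 4 then (x + 2 * (r - y)) mod r * r + y
     else if g = 5 then (x + 2 * (r - y) + (r - 1)) mod r * r + y
     else if g = 6 then x * r + (y + 2 * (r - x)) mod r
     else x * r + (y + 2 * (r - x) + (r - 1)) mod r)"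

declare gg_step.simps [simp del]

definition gg_inv :: "nat \<Rightarrow> nat" where
  "gg_inv g = (if g < 4 then g + 4 else g - 4)"

lemma gg_inv_less: "g < 8 \<Longrightarrow> gg_inv g < 8"
  by (auto simp: gg_inv_def)

lemma gg_inv_inv: "g < 8 \<Longrightarrow> gg_inv (gg_inv g) = g"
  by (auto simp: gg_inv_def)

lemma less_8_cases:
  assumes "(g::nat) < 8"
  obtains "g = 0" | "g = 1" | "g = 2" | "g = 3" | "g = 4" | "g = 5" | "g = 6" | "g = 7"
  using assms by linarith

lemma pair_index_less: "(x::nat) < r \<Longrightarrow> y < r \<Longrightarrow> x * r + y < r * r"
proof -
  assume "x < r" "y < r"
  hence "x * r + y < (x + 1) * r" by simp
  also have "\<dots> \<le> r * r" using \<open>x < r\<close> by (intro mult_right_mono) auto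
  finally show ?thesis .
qed

lemma gg_step_less:
  assumes "i < r * r"
  shows "gg_step r g i < r * r"
proof -
  have "r > 0" using assms by (cases r) auto
  moreover have "i div r < r" using assms by (simp add: less_mult_imp_div_less)
  ultimately show ?thesis
    by (auto simp: gg_step.simps Let_def intro!: pair_index_less)
qed

lemma mod_add_sub_cancel:
  fixes x r a b c :: nat
  assumes "x < r" "a + b = c * r"
  shows "((x + a) mod r + b) mod r = x"
proof -
  have "((x + a) mod r + b) mod r = (x + c * r) mod r"
    by (simp add: mod_add_left_eq add.assoc assms(2))
  thus ?thesis using assms(1) by simp
qed

lemma gg_step_inv:
  assumes "i < r * r" "g < 8"
  shows "gg_step r (gg_inv g) (gg_step r g i) = i"
proof -
  have r: "r > 0" using assms by (cases r) auto
  define x y where "x = i div r" and "y = i mod r"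
  have xy: "x < r" "y < r" "i = x * r + y"
    using assms r by (auto simp: x_def y_def less_mult_imp_div_less)
  have decode: "(u * r + v) div r = u" "(u * r + v) mod r = v" if "v < r" for u v
    using that r by auto
  have inv: "((u + 2 * v) mod r + 2 * (r - v)) mod r = u"
    "((u + 2 * v + 1) mod r + 2 * (r - v) + (r - 1)) mod r = u"
    "((u + 2 * (r - v)) mod r + 2 * v) mod r = u"
    "((u + 2 * (r - v) + (r - 1)) mod r + 2 * v + 1) mod r = u" if uv: "u < r" "v < r" for u v
  proof -
    have e: "2 * v + 2 * (r - v) = 2 * r" "2 * (r - v) + 2 * v = 2 * r"
      "(2 * v + 1) + (2 * (r - v) + (r - 1)) = 3 * r" "(2 * (r - v) + (r - 1)) + (2 * v + 1) = 3 * r"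
      using uv r by auto
    show "((u + 2 * v) mod r + 2 * (r - v)) mod r = u"
      by (rule mod_add_sub_cancel[OF uv(1) e(1)])
    show "((u + 2 * v + 1) mod r + 2 * (r - v) + (r - 1)) mod r = u"
      using mod_add_sub_cancel[OF uv(1) e(3)] by (simp only: add.assoc)
    show "((u + 2 * (r - v)) mod r + 2 * v) mod r = u"
      by (rule mod_add_sub_cancel[OF uv(1) e(2)])
    show "((u + 2 * (r - v) + (r - 1)) mod r + 2 * v + 1) mod r = u"
      using mod_add_sub_cancel[OF uv(1) e(4)] by (simp only: add.assoc)
  qed
  have m: "m mod r < r" for m using r by simp
  note xi = inv[OF xy(1,2)] and yi = inv[OF xy(2,1)]
  have st: "gg_step r g (u * r + v) = (
     if g = 0 then (u + 2 * v) mod r * r + v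
     else if g = 1 then (u + 2 * v + 1) mod r * r + v
     else if g = 2 then u * r + (v + 2 * u) mod r
     else if g = 3 then u * r + (v + 2 * u + 1) mod r
     else if g = 4 then (u + 2 * (r - v)) mod r * r + v
     else if g = 5 then (u + 2 * (r - v) + (r - 1)) mod r * r + v
     else if g = 6 then u * r + (v + 2 * (r - u)) mod r
     else u * r + (v + 2 * (r - u) + (r - 1)) mod r)" if "v < r" for g u v
    unfolding gg_step.simps Let_def decode[OF that] ..
  from assms(2) show ?thesis
  proof (cases rule: less_8_cases)
    case 1 show ?thesis unfolding xy(3) 1 gg_inv_def using st[OF xy(2)] xi(1) by simp
  next
    case 2 show ?thesis unfolding xy(3) 2 gg_inv_def using st[OF xy(2)] xi(2) by simp
  next
    case 3 show ?thesis unfolding xy(3) 3 gg_inv_def using st[OF xy(2)] st[OF m] yi(1) by simp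
  next
    case 4 show ?thesis unfolding xy(3) 4 gg_inv_def using st[OF xy(2)] st[OF m] yi(2) by simp
  next
    case 5 show ?thesis unfolding xy(3) 5 gg_inv_def using st[OF xy(2)] xi(3) by simp
  next
    case 6 show ?thesis unfolding xy(3) 6 gg_inv_def using st[OF xy(2)] xi(4) by simp
  next
    case 7 show ?thesis unfolding xy(3) 7 gg_inv_def using st[OF xy(2)] st[OF m] yi(3) by simp
  next
    case 8 show ?thesis unfolding xy(3) 8 gg_inv_def using st[OF xy(2)] st[OF m] yi(4) by simp
  qed
qed

lemma gg_step_bij:
  assumes "g < 8"
  shows "bij_betw (gg_step r g) {..<r * r} {..<r * r}"
proof (rule bij_betw_byWitness[where f' = "gg_step r (gg_inv g)"])
  show "\<forall>a\<in>{..<r * r}. gg_step r (gg_inv g) (gg_step r g a) = a"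
    using gg_step_inv assms by auto
  show "\<forall>a\<in>{..<r * r}. gg_step r g (gg_step r (gg_inv g) a) = a"
    using gg_step_inv[of _ r "gg_inv g"] assms by (auto simp: gg_inv_less gg_inv_inv)
qed (auto simp: gg_step_less)

section \<open>Spectral gap and edge expansion of the torus graph\<close>

lemma sum_index_pairs:
  fixes h :: "nat \<Rightarrow> 'b::comm_monoid_add"
  assumes "r > 0"
  shows "(\<Sum>i<r * r. h i) = (\<Sum>x\<in>{0..<int r}. \<Sum>y\<in>{0..<int r}. h (nat x * r + nat y))"
proof -
  have *: "(\<Sum>x\<in>{0..<int r}. g (nat x)) = (\<Sum>x<r. g x)" for g :: "nat \<Rightarrow> 'b"
    by (rule sum.reindex_bij_witness[of _ int nat]) auto
  have "(\<Sum>i<r * r. h i) = (\<Sum>p\<in>{..<r} \<times> {..<r}. h (fst p * r + snd p))"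
  proof (rule sum.reindex_bij_witness[of _ "\<lambda>p. fst p * r + snd p" "\<lambda>i. (i div r, i mod r)"])
  qed (use assms in \<open>auto simp: less_mult_imp_div_less pair_index_less\<close>)
  also have "\<dots> = (\<Sum>x<r. \<Sum>y<r. h (x * r + y))"
    by (simp add: sum.cartesian_product split_def)
  also have "\<dots> = (\<Sum>x\<in>{0..<int r}. \<Sum>y<r. h (nat x * r + y))"
    by (rule *[symmetric])
  also have "\<dots> = (\<Sum>x\<in>{0..<int r}. \<Sum>y\<in>{0..<int r}. h (nat x * r + nat y))"
    by (intro sum.cong refl *[symmetric])
  finally show ?thesis .
qed

definition gg_sum :: "nat \<Rightarrow> (nat \<Rightarrow> real) \<Rightarrow> nat \<Rightarrow> real" where
  "gg_sum r h i = (\<Sum>g<8. h (gg_step r g i))"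

lemma gg_half_form_bound:
  fixes h :: "nat \<Rightarrow> real"
  assumes mean: "(\<Sum>i<r * r. h i) = 0"
  shows "\<bar>\<Sum>i<r * r. h i * (\<Sum>g<4. h (gg_step r g i))\<bar> \<le> 365 / 100 * (\<Sum>i<r * r. (h i)\<^sup>2)"
proof (cases "r = 0")
  case False
  hence r: "r > 0" by simp
  define f where "f x y = h (nat x * r + nat y)" for x y :: int
  have g4: "{..<4::nat} = {0, 1, 2, 3}" by auto
  have "(\<Sum>i<r * r. h i * (\<Sum>g<4. h (gg_step r g i)))
    = (\<Sum>x\<in>{0..<int r}. \<Sum>y\<in>{0..<int r}. f x y * shear_sum (int r) f x y)"
    unfolding sum_index_pairs[OF r]
  proof (intro sum.cong refl)
    fix x y assume xy: "x \<in> {0..<int r}" "y \<in> {0..<int r}"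
    then obtain u v where uv: "x = int u" "y = int v" "u < r" "v < r"
      by (metis atLeastLessThan_iff nonneg_int_cases of_nat_less_iff)
    have n: "nat ((int u + 2 * int v) mod int r) = (u + 2 * v) mod r"
      "nat ((int u + 2 * int v + 1) mod int r) = (u + 2 * v + 1) mod r" for u v
      by (simp_all add: nat_mod_distrib nat_add_distrib nat_mult_distrib)
    have d: "(u * r + v) div r = u" "(u * r + v) mod r = v" using uv by auto
    show "h (nat x * r + nat y) * (\<Sum>g<4. h (gg_step r g (nat x * r + nat y)))
      = f x y * shear_sum (int r) f x y"
      unfolding f_def uv(1,2) shear_sum_def add_0_right n nat_int
      by (simp add: g4 gg_step.simps Let_def d uv(3,4) add.assoc)
  qed
  moreover have "(\<Sum>x\<in>{0..<int r}. \<Sum>y\<in>{0..<int r}. f x y) = 0"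
    using mean unfolding sum_index_pairs[OF r] f_def .
  moreover have "(\<Sum>i<r * r. (h i)\<^sup>2) = (\<Sum>x\<in>{0..<int r}. \<Sum>y\<in>{0..<int r}. (f x y)\<^sup>2)"
    unfolding sum_index_pairs[OF r] f_def ..
  ultimately show ?thesis using gabber_galil_quadratic_form[of "int r" f] r by simp
qed simp

lemma sum_less_8_split:
  fixes F :: "nat \<Rightarrow> 'b::comm_monoid_add"
  shows "(\<Sum>g<8. F g) = (\<Sum>g<4. F g) + (\<Sum>g<4. F (g + 4))"
proof -
  have "{..<8::nat} = {0, 1, 2, 3, 4, 5, 6, 7}" "{..<4::nat} = {0, 1, 2, 3}" by auto
  thus ?thesis by (simp add: add.assoc)
qed

text \<open>The label \<open>g + 4\<close> is the inverse permutation of \<open>g\<close>, so a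
  substitution of the summation index transposes its term. The form is therefore symmetric, and on
  the diagonal it is twice the form of the four shears, whence
  \<open>73 / 10 = 2 * (365 / 100)\<close>.\<close>

lemma gg_form_symmetric:
  "(\<Sum>i<r * r. k i * gg_sum r h i) = (\<Sum>i<r * r. \<Sum>g<4. k i * h (gg_step r g i) + k (gg_step r g i) * h i)"
proof -
  have "(\<Sum>i<r * r. k i * gg_sum r h i) = (\<Sum>g<8. \<Sum>i<r * r. k i * h (gg_step r g i))"
    unfolding gg_sum_def sum_distrib_left by (rule sum.swap)
  also have "\<dots> = (\<Sum>g<4. \<Sum>i<r * r. k i * h (gg_step r g i)) + (\<Sum>g<4. \<Sum>i<r * r. k i * h (gg_step r (g + 4) i))"
    by (rule sum_less_8_split)
  also have "(\<Sum>g<4. \<Sum>i<r * r. k i * h (gg_step r (g + 4) i)) = (\<Sum>g<4. \<Sum>i<r * r. k (gg_step r g i) * h i)"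
  proof (rule sum.cong[OF refl])
    fix g :: nat assume "g \<in> {..<4}"
    hence g: "g < 8" "gg_inv g = g + 4" by (auto simp: gg_inv_def)
    have "(\<Sum>i<r * r. k i * h (gg_step r (g + 4) i))
      = (\<Sum>i<r * r. k (gg_step r g i) * h (gg_step r (g + 4) (gg_step r g i)))"
      by (rule sum.reindex_bij_betw[OF gg_step_bij[OF g(1)], symmetric])
    also have "\<dots> = (\<Sum>i<r * r. k (gg_step r g i) * h i)"
      using gg_step_inv[of _ r g] g by (intro sum.cong refl) auto
    finally show "(\<Sum>i<r * r. k i * h (gg_step r (g + 4) i)) = (\<Sum>i<r * r. k (gg_step r g i) * h i)" .
  qed
  finally show ?thesis
    by (simp only: sum.distrib sum.swap[of _ "{..<r * r}"])
qed

lemma gg_form_bound: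
  assumes "(\<Sum>i<r * r. h i) = 0"
  shows "\<bar>\<Sum>i<r * r. h i * gg_sum r h i\<bar> \<le> 73 / 10 * (\<Sum>i<r * r. (h i)\<^sup>2)"
proof -
  have "(\<Sum>i<r * r. h i * gg_sum r h i) = 2 * (\<Sum>i<r * r. h i * (\<Sum>g<4. h (gg_step r g i)))"
    unfolding gg_form_symmetric sum_distrib_left
    by (intro sum.cong refl) (simp add: algebra_simps)
  thus ?thesis using gg_half_form_bound[OF assms] by simp
qed

lemma gg_sum_sum: "(\<Sum>i<r * r. gg_sum r h i) = 8 * (\<Sum>i<r * r. h i)"
proof -
  have "(\<Sum>i<r * r. gg_sum r h i) = (\<Sum>g<8::nat. \<Sum>i<r * r. h (gg_step r g i))"
    unfolding gg_sum_def by (rule sum.swap)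
  also have "\<dots> = (\<Sum>g<8::nat. \<Sum>i<r * r. h i)"
    by (intro sum.cong refl sum.reindex_bij_betw gg_step_bij) auto
  finally show ?thesis by simp
qed

text \<open>Polarization turns the bound on the quadratic form into a bound on the operator norm.\<close>

lemma gg_sum_contraction:
  assumes mean: "(\<Sum>i<r * r. h i) = 0"
  shows "(\<Sum>i<r * r. (gg_sum r h i)\<^sup>2) \<le> (73 / 10)\<^sup>2 * (\<Sum>i<r * r. (h i)\<^sup>2)"
proof -
  define B where "B u v = (\<Sum>i<r * r. u i * gg_sum r v i)" for u v
  \<comment> \<open>Scaled by the reciprocal of the bound on the form: after polarization the term
    with \<open>N k\<close> then absorbs exactly half of the left side.\<close>
  define k where "k i = 10 / 73 * gg_sum r h i" for i
  define N where "N u = (\<Sum>i<r * r. (u i)\<^sup>2)" for u :: "nat \<Rightarrow> real"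
  have Bs: "B u v = B v u" for u v
    unfolding B_def gg_form_symmetric by (intro sum.cong refl) (simp add: algebra_simps)
  have lin: "gg_sum r (\<lambda>i. u i + c * v i) i = gg_sum r u i + c * gg_sum r v i" for u v c i
    unfolding gg_sum_def by (simp add: sum.distrib sum_distrib_left)
  have expand: "B (\<lambda>i. h i + c * k i) (\<lambda>i. h i + c * k i) = B h h + c * (B h k + B k h) + c\<^sup>2 * B k k" for c
    unfolding B_def lin by (simp add: algebra_simps sum.distrib sum_distrib_left power2_eq_square)
  have km: "(\<Sum>i<r * r. k i) = 0"
    unfolding k_def sum_distrib_left[symmetric] gg_sum_sum mean by simp
  have zero: "(\<Sum>i<r * r. h i + c * k i) = 0" for c
    using mean km by (simp add: sum.distrib sum_distrib_left[symmetric])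
  have bd: "\<bar>B u u\<bar> \<le> 73 / 10 * N u" if "(\<Sum>i<r * r. u i) = 0" for u
    using gg_form_bound[OF that] by (simp add: B_def N_def)
  have Nexp: "N (\<lambda>i. h i + c * k i) = N h + 2 * c * (\<Sum>i<r * r. h i * k i) + c\<^sup>2 * N k" for c
    unfolding N_def by (simp add: power2_eq_square algebra_simps sum.distrib sum_distrib_left)
  have "4 * B k h = B (\<lambda>i. h i + 1 * k i) (\<lambda>i. h i + 1 * k i) - B (\<lambda>i. h i + (-1) * k i) (\<lambda>i. h i + (-1) * k i)"
    unfolding expand using Bs[of h k] by simp
  also have "\<dots> \<le> 73 / 10 * N (\<lambda>i. h i + 1 * k i) + 73 / 10 * N (\<lambda>i. h i + (-1) * k i)"
    using bd[OF zero[of 1]] bd[OF zero[of "-1"]] by linarith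
  also have "\<dots> = 73 / 5 * (N h + N k)"
    unfolding Nexp by (simp add: field_simps)
  finally have "4 * B k h \<le> 73 / 5 * (N h + N k)" .
  moreover have "B k h = 10 / 73 * N (gg_sum r h)"
    unfolding B_def N_def k_def by (simp add: sum_distrib_left power2_eq_square mult_ac)
  moreover have "N k = (10 / 73)\<^sup>2 * N (gg_sum r h)"
    unfolding N_def k_def by (simp only: power_mult_distrib sum_distrib_left)
  ultimately show ?thesis by (simp add: N_def power2_eq_square)
qed

text \<open>The easy direction of Cheeger's inequality: the form is tested on the centered indicator
  of \<open>S\<close>, and \<open>7 / 10\<close> is the gap \<open>8 - 73 / 10\<close>.\<close>

lemma gg_boundary_ge:
  assumes S: "S \<subseteq> {..<r * r}"
  shows "7 / 10 * (real (card S) * (1 - real (card S) / real (r * r)))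
    \<le> (\<Sum>i<r * r. \<Sum>g<8. of_bool (i \<in> S \<and> gg_step r g i \<notin> S))"
proof (cases "r = 0")
  case True
  thus ?thesis using S by simp
next
  case False
  define n where "n = real (r * r)"
  have n: "n > 0" using False by (simp add: n_def)
  define s where "s = real (card S)"
  define f where "f i = (of_bool (i \<in> S) :: real)" for i
  define h where "h i = f i - s / n" for i
  have fs: "(\<Sum>i<r * r. f i) = s"
    using S by (simp add: f_def s_def of_bool_def sum.If_cases Int_absorb1)
  have hm: "(\<Sum>i<r * r. h i) = 0"
    using False unfolding h_def sum_subtractf fs by (simp add: n_def)
  have hs: "(\<Sum>i<r * r. (h i)\<^sup>2) = s * (1 - s / n)"
  proof -
    have "(h i)\<^sup>2 = (1 - 2 * s / n) * f i + (s / n)\<^sup>2" for i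
      by (simp add: h_def f_def power2_eq_square algebra_simps)
    hence "(\<Sum>i<r * r. (h i)\<^sup>2) = (1 - 2 * s / n) * s + n * (s / n)\<^sup>2"
      by (simp add: sum.distrib sum_distrib_left[symmetric] fs n_def)
    thus ?thesis using n by (simp add: power2_eq_square field_simps)
  qed
  have hg: "gg_sum r h i = gg_sum r f i - 8 * (s / n)" for i
    by (simp add: gg_sum_def h_def sum_subtractf)
  have form: "(\<Sum>i<r * r. h i * gg_sum r h i) = (\<Sum>i<r * r. f i * gg_sum r f i) - 8 * s\<^sup>2 / n"
  proof -
    have "(\<Sum>i<r * r. h i * gg_sum r h i) = (\<Sum>i<r * r. h i * gg_sum r f i) - 8 * (s / n) * (\<Sum>i<r * r. h i)"
      unfolding hg by (simp add: algebra_simps sum_subtractf sum_distrib_left sum_divide_distrib)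
    also have "\<dots> = (\<Sum>i<r * r. f i * gg_sum r f i) - s / n * (\<Sum>i<r * r. gg_sum r f i)"
      unfolding hm by (simp add: h_def algebra_simps sum_subtractf sum_distrib_left sum_divide_distrib)
    finally show ?thesis unfolding gg_sum_sum fs by (simp add: power2_eq_square)
  qed
  have "(\<Sum>i<r * r. f i * gg_sum r f i) = (\<Sum>i<r * r. h i * gg_sum r h i) + 8 * s\<^sup>2 / n"
    using form by simp
  also have "\<dots> \<le> 73 / 10 * (s * (1 - s / n)) + 8 * s\<^sup>2 / n"
    using gg_form_bound[OF hm] unfolding hs by linarith
  finally have *: "(\<Sum>i<r * r. f i * gg_sum r f i) \<le> 73 / 10 * (s * (1 - s / n)) + 8 * s\<^sup>2 / n" .
  have "(\<Sum>i<r * r. \<Sum>g<8. of_bool (i \<in> S \<and> gg_step r g i \<notin> S)) = (\<Sum>i<r * r. 8 * f i - f i * gg_sum r f i)"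
  proof (intro sum.cong refl)
    fix i
    have "(\<Sum>g<8::nat. of_bool (i \<in> S \<and> gg_step r g i \<notin> S)) = (\<Sum>g<8::nat. f i - f i * f (gg_step r g i))"
      by (intro sum.cong refl) (auto simp: f_def)
    thus "(\<Sum>g<8. of_bool (i \<in> S \<and> gg_step r g i \<notin> S)) = 8 * f i - f i * gg_sum r f i"
      by (simp add: sum_subtractf gg_sum_def sum_distrib_left)
  qed
  also have "\<dots> = 8 * s - (\<Sum>i<r * r. f i * gg_sum r f i)"
    by (simp add: sum_subtractf sum_distrib_left[symmetric] fs)
  finally have bd: "(\<Sum>i<r * r. \<Sum>g<8. of_bool (i \<in> S \<and> gg_step r g i \<notin> S))
    = 8 * s - (\<Sum>i<r * r. f i * gg_sum r f i)" .
  have q: "s * (1 - s / n) = s - s\<^sup>2 / n" by (simp add: power2_eq_square algebra_simps)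
  show ?thesis using * unfolding s_def[symmetric] n_def[symmetric] bd q by argo
qed

text \<open>A class other than the plurality has at most half of the points, so the factor
  \<open>1 - card S / n\<close> in the boundary bound is at least \<open>1 / 2\<close>. A directed
  edge between two classes is counted once, in the class of its start, so the bounds for all classes
  add up.\<close>

lemma gg_plurality:
  fixes \<sigma> :: "nat \<Rightarrow> 'a"
  assumes plur: "\<And>x. card {i. i < r * r \<and> \<sigma> i = x} \<le> card {i. i < r * r \<and> \<sigma> i = \<tau>}"
  shows "7 / 20 * real (card {i. i < r * r \<and> \<sigma> i \<noteq> \<tau>})
    \<le> (\<Sum>i<r * r. \<Sum>g<8. of_bool (\<sigma> i \<noteq> \<sigma> (gg_step r g i)))"
proof -
  define X where "X = \<sigma> ` {..<r * r}"
  define S where "S x = {i. i < r * r \<and> \<sigma> i = x}" for x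
  have fin: "finite X" "\<And>x. finite (S x)" by (auto simp: X_def S_def)
  have b: "(\<Sum>g<8::nat. of_bool (\<sigma> i \<noteq> \<sigma> (gg_step r g i)) :: real)
      = (\<Sum>x\<in>X. \<Sum>g<8. of_bool (i \<in> S x \<and> gg_step r g i \<notin> S x))" if i: "i < r * r" for i
  proof -
    have "(\<Sum>x\<in>X. \<Sum>g<8. of_bool (i \<in> S x \<and> gg_step r g i \<notin> S x)) =
       (\<Sum>x\<in>X. if x = \<sigma> i then (\<Sum>g<8. of_bool (\<sigma> i \<noteq> \<sigma> (gg_step r g i))) else 0 :: real)"
      using i gg_step_less[OF i] by (intro sum.cong refl) (auto simp: S_def simp del: sum_of_bool_eq intro!: sum.cong)
    thus ?thesis using i fin by (simp add: X_def)
  qed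
  have half: "1 / 2 * real (card (S x)) \<le> real (card (S x)) * (1 - real (card (S x)) / real (r * r))" if "x \<noteq> \<tau>" for x
  proof -
    have "card (S x) + card (S \<tau>) = card (S x \<union> S \<tau>)"
      using that by (intro card_Un_disjoint[symmetric]) (auto simp: S_def)
    also have "\<dots> \<le> card {..<r * r}" by (intro card_mono) (auto simp: S_def)
    finally have "2 * card (S x) \<le> r * r" using plur[of x] by (simp add: S_def)
    hence "2 * real (card (S x)) \<le> real (r * r)" by (metis of_nat_le_iff of_nat_mult of_nat_numeral)
    moreover have "real (r * r) > 0 \<or> card (S x) = 0" using calculation by auto
    ultimately have "1 / 2 \<le> 1 - real (card (S x)) / real (r * r) \<or> card (S x) = 0"
      by (auto simp: field_simps)
    thus ?thesis
      using mult_left_mono[of "1 / 2" "1 - real (card (S x)) / real (r * r)" "real (card (S x))"] by auto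
  qed
  have nn: "0 \<le> real (card (S x)) * (1 - real (card (S x)) / real (r * r))" for x
  proof -
    have "card (S x) \<le> card {..<r * r}" by (intro card_mono) (auto simp: S_def)
    hence "real (card (S x)) \<le> real (r * r)" by (metis card_lessThan of_nat_le_iff)
    hence "real (card (S x)) / real (r * r) \<le> 1"
      by (cases "r = 0") (simp_all add: divide_le_eq_1)
    thus ?thesis by simp
  qed
  have "{i. i < r * r \<and> \<sigma> i \<noteq> \<tau>} = (\<Union>x\<in>X - {\<tau>}. S x)" by (auto simp: X_def S_def)
  hence "card {i. i < r * r \<and> \<sigma> i \<noteq> \<tau>} = (\<Sum>x\<in>X - {\<tau>}. card (S x))"
    by (simp only:) (intro card_UN_disjoint, use fin in \<open>auto simp: S_def\<close>)
  hence "7 / 20 * real (card {i. i < r * r \<and> \<sigma> i \<noteq> \<tau>}) = (\<Sum>x\<in>X - {\<tau>}. 7 / 10 * (1 / 2 * real (card (S x))))"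
    by (simp add: sum_distrib_left)
  also have "\<dots> \<le> (\<Sum>x\<in>X - {\<tau>}. 7 / 10 * (real (card (S x)) * (1 - real (card (S x)) / real (r * r))))"
    using half by (intro sum_mono mult_left_mono) auto
  also have "\<dots> \<le> (\<Sum>x\<in>X. 7 / 10 * (real (card (S x)) * (1 - real (card (S x)) / real (r * r))))"
    using nn fin by (intro sum_mono2) auto
  also have "\<dots> \<le> (\<Sum>x\<in>X. \<Sum>i<r * r. \<Sum>g<8. of_bool (i \<in> S x \<and> gg_step r g i \<notin> S x))"
    by (intro sum_mono gg_boundary_ge) (auto simp: S_def)
  also have "\<dots> = (\<Sum>i<r * r. \<Sum>x\<in>X. \<Sum>g<8. of_bool (i \<in> S x \<and> gg_step r g i \<notin> S x))"
    by (rule sum.swap)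
  also have "\<dots> = (\<Sum>i<r * r. \<Sum>g<8. of_bool (\<sigma> i \<noteq> \<sigma> (gg_step r g i)))"
    using b by (intro sum.cong refl) auto
  finally show ?thesis .
qed

section \<open>Rejection of random walks on an expander\<close>

definition label_words :: "nat \<Rightarrow> nat \<Rightarrow> nat list set" where
  "label_words D L = {w. set w \<subseteq> {..<D} \<and> length w = L}"

lemma finite_label_words [simp]: "finite (label_words D L)"
  unfolding label_words_def by (rule finite_lists_length_eq) simp

lemma label_words_0 [simp]: "label_words D 0 = {[]}"
  by (auto simp: label_words_def)

lemma sum_label_words_Suc:
  fixes f :: "nat list \<Rightarrow> 'b::comm_monoid_add"
  shows "(\<Sum>w\<in>label_words D (Suc L). f w) = (\<Sum>l<D. \<Sum>w\<in>label_words D L. f (l # w))"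
proof -
  have "(\<Sum>w\<in>label_words D (Suc L). f w) = (\<Sum>p\<in>{..<D} \<times> label_words D L. f (fst p # snd p))"
  proof (rule sum.reindex_bij_witness[of _ "\<lambda>p. fst p # snd p" "\<lambda>w. (hd w, tl w)"])
    fix w assume "w \<in> label_words D (Suc L)"
    then obtain l v where "w = l # v" "l < D" "v \<in> label_words D L"
      by (cases w) (auto simp: label_words_def)
    thus "fst (hd w, tl w) # snd (hd w, tl w) = w" "(hd w, tl w) \<in> {..<D} \<times> label_words D L"
      "f (fst (hd w, tl w) # snd (hd w, tl w)) = f w" by auto
  qed (auto simp: label_words_def)
  thus ?thesis by (simp add: sum.cartesian_product split_def)
qed

lemma sum_label_words_append:
  fixes f :: "nat list \<Rightarrow> 'b::comm_monoid_add"
  shows "(\<Sum>w\<in>label_words D (L + M). f w) = (\<Sum>u\<in>label_words D L. \<Sum>v\<in>label_words D M. f (u @ v))"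
proof (induction L arbitrary: f)
  case (Suc L)
  show ?case
    using Suc[of "\<lambda>w. f (_ # w)"] by (simp add: sum_label_words_Suc)
qed simp

lemma card_label_words: "card (label_words D L) = D ^ L"
  unfolding label_words_def using card_lists_length_eq[of "{..<D}" L] by simp

lemma L2_set_centered_le:
  fixes f :: "nat \<Rightarrow> real"
  shows "L2_set (\<lambda>z. f z - (\<Sum>z<n. f z) / real n) {..<n} \<le> L2_set f {..<n}"
proof (cases "n = 0")
  case False
  define m where "m = (\<Sum>z<n. f z) / real n"
  have "(\<Sum>z<n. (f z - m)\<^sup>2) = (\<Sum>z<n. (f z)\<^sup>2) - 2 * m * (\<Sum>z<n. f z) + real n * m\<^sup>2"
    by (simp add: power2_eq_square algebra_simps sum.distrib sum_subtractf sum_distrib_left)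
  also have "(\<Sum>z<n. f z) = real n * m" using False by (simp add: m_def)
  finally have "(\<Sum>z<n. (f z - m)\<^sup>2) = (\<Sum>z<n. (f z)\<^sup>2) - real n * m\<^sup>2"
    by (simp add: power2_eq_square algebra_simps)
  hence "(\<Sum>z<n. (f z - m)\<^sup>2) \<le> (\<Sum>z<n. (f z)\<^sup>2)" by simp
  thus ?thesis unfolding L2_set_def m_def[symmetric] by simp
qed simp

text \<open>The two alternatives behind the constant: if some opinion is unpopular, the equality checks
  fail with probability at least one half; otherwise both plurality opinions occur together with
  probability at least one quarter.\<close>

lemma independent_opinions_reject:
  fixes wt :: "'i \<Rightarrow> real" and X :: "'i \<Rightarrow> 'a" and Y :: "'i \<Rightarrow> 'a"
  assumes I: "finite I" and wt: "\<And>i. i \<in> I \<Longrightarrow> wt i \<ge> 0" "(\<Sum>i\<in>I. wt i) = 1"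
    and px: "\<And>x. (\<Sum>i\<in>I. wt i * of_bool (X i = x)) \<le> (\<Sum>i\<in>I. wt i * of_bool (X i = \<sigma>))"
    and py: "\<And>y. (\<Sum>i\<in>I. wt i * of_bool (Y i = y)) \<le> (\<Sum>i\<in>I. wt i * of_bool (Y i = \<tau>))"
    and R: "\<not> R \<sigma> \<tau>"
  shows "1 / 4 \<le> (\<Sum>i\<in>I. \<Sum>j\<in>I. wt i * wt j * of_bool (\<not> (X i = X' j \<and> Y' i = Y j \<and> R (X i) (Y j))))"
    (is "_ \<le> (\<Sum>i\<in>I. \<Sum>j\<in>I. wt i * wt j * of_bool (?B i j))")
proof -
  define p where "p = (\<Sum>i\<in>I. wt i * of_bool (X i = \<sigma>))"
  define q where "q = (\<Sum>i\<in>I. wt i * of_bool (Y i = \<tau>))"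
  have neg: "(\<Sum>i\<in>I. wt i * of_bool (Z i \<noteq> x)) = 1 - (\<Sum>i\<in>I. wt i * of_bool (Z i = x))" for Z :: "'i \<Rightarrow> 'a" and x
    unfolding wt(2)[symmetric] sum_subtractf[symmetric] by (intro sum.cong refl) auto
  consider "p \<le> 1 / 2" | "q \<le> 1 / 2" | "p > 1 / 2" "q > 1 / 2" by linarith
  thus ?thesis
  proof cases
    case 1
    have "1 / 4 \<le> (\<Sum>j\<in>I. wt j * (1 / 2))"
      unfolding sum_distrib_right[symmetric] wt(2) by simp
    also have "\<dots> \<le> (\<Sum>j\<in>I. wt j * (\<Sum>i\<in>I. wt i * of_bool (X i \<noteq> X' j)))"
    proof (intro sum_mono mult_left_mono wt(1))
      fix j
      show "1 / 2 \<le> (\<Sum>i\<in>I. wt i * of_bool (X i \<noteq> X' j))"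
        unfolding neg using px[of "X' j"] 1 by (simp add: p_def)
    qed
    also have "\<dots> = (\<Sum>i\<in>I. \<Sum>j\<in>I. wt i * wt j * of_bool (X i \<noteq> X' j))"
      by (subst sum.swap) (simp add: sum_distrib_left mult_ac)
    also have "\<dots> \<le> (\<Sum>i\<in>I. \<Sum>j\<in>I. wt i * wt j * of_bool (?B i j))"
      by (intro sum_mono mult_left_mono mult_nonneg_nonneg wt(1)) auto
    finally show ?thesis .
  next
    case 2
    have "1 / 4 \<le> (\<Sum>i\<in>I. wt i * (1 / 2))"
      unfolding sum_distrib_right[symmetric] wt(2) by simp
    also have "\<dots> \<le> (\<Sum>i\<in>I. wt i * (\<Sum>j\<in>I. wt j * of_bool (Y j \<noteq> Y' i)))"
    proof (intro sum_mono mult_left_mono wt(1))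
      fix i
      show "1 / 2 \<le> (\<Sum>j\<in>I. wt j * of_bool (Y j \<noteq> Y' i))"
        unfolding neg using py[of "Y' i"] 2 by (simp add: q_def)
    qed
    also have "\<dots> = (\<Sum>i\<in>I. \<Sum>j\<in>I. wt i * wt j * of_bool (Y j \<noteq> Y' i))"
      by (simp add: sum_distrib_left mult_ac)
    also have "\<dots> \<le> (\<Sum>i\<in>I. \<Sum>j\<in>I. wt i * wt j * of_bool (?B i j))"
      by (intro sum_mono mult_left_mono mult_nonneg_nonneg wt(1)) auto
    finally show ?thesis .
  next
    case 3
    have "1 / 4 = 1 / 2 * (1 / 2 :: real)" by simp
    also have "\<dots> \<le> p * q" using 3 by (intro mult_mono) auto
    also have "\<dots> = (\<Sum>i\<in>I. \<Sum>j\<in>I. wt i * wt j * of_bool (X i = \<sigma> \<and> Y j = \<tau>))"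
      unfolding p_def q_def sum_product by (intro sum.cong refl) auto
    also have "\<dots> \<le> (\<Sum>i\<in>I. \<Sum>j\<in>I. wt i * wt j * of_bool (?B i j))"
      using R by (intro sum_mono mult_left_mono mult_nonneg_nonneg wt(1)) auto
    finally show ?thesis .
  qed
qed

text \<open>A regular graph given by \<open>D\<close> permutations of its vertices. The label
  \<open>il l\<close> of the reversed edge depends on \<open>l\<close> alone, so a walk can be
  retraced from its labels without knowledge of the vertices.\<close>

locale labelled_graph =
  fixes n D :: nat and st :: "nat \<Rightarrow> nat \<Rightarrow> nat" and il :: "nat \<Rightarrow> nat"
  assumes il_less: "l < D \<Longrightarrow> il l < D" and il_il: "l < D \<Longrightarrow> il (il l) = l"
    and st_less: "l < D \<Longrightarrow> z < n \<Longrightarrow> st l z < n"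
    and st_il: "l < D \<Longrightarrow> z < n \<Longrightarrow> st (il l) (st l z) = z"
begin

lemma st_bij: "l < D \<Longrightarrow> bij_betw (st l) {..<n} {..<n}"
proof (rule bij_betw_byWitness[where f' = "st (il l)"])
  assume l: "l < D"
  show "\<forall>a\<in>{..<n}. st (il l) (st l a) = a" using st_il l by auto
  show "\<forall>a\<in>{..<n}. st l (st (il l) a) = a"
    using st_il[of "il l"] l by (auto simp: il_less il_il)
qed (auto simp: st_less il_less)

lemma sum_st: "l < D \<Longrightarrow> (\<Sum>z<n. f (st l z)) = (\<Sum>z<n. f z)"
  by (rule sum.reindex_bij_betw[OF st_bij])

definition walk :: "nat list \<Rightarrow> nat \<Rightarrow> nat" where
  "walk w z = fold st w z"

definition rv :: "nat list \<Rightarrow> nat list" where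
  "rv w = rev (map il w)"

lemma walk_simps [simp]: "walk [] z = z" "walk (l # w) z = walk w (st l z)"
  "walk (u @ v) z = walk v (walk u z)"
  by (simp_all add: walk_def)

lemma walk_less: "w \<in> label_words D L \<Longrightarrow> z < n \<Longrightarrow> walk w z < n"
  by (induction w arbitrary: z L) (auto simp: label_words_def st_less)

lemma rv_label_words: "w \<in> label_words D L \<Longrightarrow> rv w \<in> label_words D L"
  by (auto simp: label_words_def rv_def il_less)

lemma rv_rv: "w \<in> label_words D L \<Longrightarrow> rv (rv w) = w"
  by (auto simp: label_words_def rv_def rev_map[symmetric] il_il intro!: map_idI)

lemma walk_rv: "w \<in> label_words D L \<Longrightarrow> z < n \<Longrightarrow> walk (rv w) (walk w z) = z"
proof (induction w arbitrary: z L)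
  case (Cons l w)
  have l: "l < D" and w: "w \<in> label_words D (length w)"
    using Cons.prems(1) by (auto simp: label_words_def)
  have "walk (rv (l # w)) (walk (l # w) z) = st (il l) (walk (rv w) (walk w (st l z)))"
    by (simp add: rv_def)
  thus ?case using Cons.IH[OF w st_less[OF l Cons.prems(2)]] st_il[OF l Cons.prems(2)] by simp
qed (simp add: rv_def)

text \<open>Sending a walk to its end point with the reversed word is an involution; it lets walks
  be counted from a point in their middle.\<close>

lemma sum_reverse_walks:
  "(\<Sum>a<n. \<Sum>w\<in>label_words D i. f a w) = (\<Sum>u<n. \<Sum>v\<in>label_words D i. f (walk v u) (rv v))"
proof -
  have "(\<Sum>p\<in>{..<n} \<times> label_words D i. f (fst p) (snd p))
      = (\<Sum>p\<in>{..<n} \<times> label_words D i. f (walk (snd p) (fst p)) (rv (snd p)))"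
    by (rule sum.reindex_bij_witness[of _ "\<lambda>p. (walk (snd p) (fst p), rv (snd p))"
          "\<lambda>p. (walk (snd p) (fst p), rv (snd p))"])
       (auto simp: walk_rv rv_rv rv_label_words walk_less)
  thus ?thesis by (simp add: sum.cartesian_product split_def)
qed

end

text \<open>The contraction hypothesis bounds the adjacency operator itself and not only its
  quadratic form, because below it is applied repeatedly to vectors of deviations.\<close>

locale expanding_graph = labelled_graph +
  fixes \<gamma> :: real
  assumes \<gamma>: "0 \<le> \<gamma>" "\<gamma> < 1"
    and contraction: "\<And>h. (\<Sum>z<n. h z) = 0 \<Longrightarrow>
      L2_set (\<lambda>z. \<Sum>l<D. h (st l z)) {..<n} \<le> \<gamma> * real D * L2_set h {..<n}"
begin

section \<open>First and second moments of the number of marked steps of a walk\<close>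

context
  fixes F :: "(nat \<times> nat) set"
  assumes F: "F \<subseteq> {..<n} \<times> {..<D}"
begin

definition ind :: "nat \<Rightarrow> nat \<Rightarrow> real" where
  "ind z l = of_bool ((z, l) \<in> F)"

primrec hits :: "nat list \<Rightarrow> nat \<Rightarrow> real" where
  "hits [] z = 0"
| "hits (l # w) z = ind z l + hits w (st l z)"

lemma hits_nth: "hits w z = (\<Sum>i<length w. ind (walk (take i w) z) (w ! i))"
  by (induction w arbitrary: z) (simp_all add: sum.lessThan_Suc_shift del: sum.lessThan_Suc)

definition out_deg :: "nat \<Rightarrow> real" where
  "out_deg z = (\<Sum>l<D. ind z l)"

text \<open>Counts the marked steps that end in \<open>z\<close>: along label \<open>l\<close> the
  predecessor of \<open>z\<close> is \<open>st (il l) z\<close>.\<close>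

definition in_deg :: "nat \<Rightarrow> real" where
  "in_deg z = (\<Sum>l<D. ind (st (il l) z) l)"

lemma sum_ind: "(\<Sum>z<n. \<Sum>l<D. ind z l) = real (card F)"
proof -
  have "(\<Sum>z<n. \<Sum>l<D. ind z l) = (\<Sum>p\<in>{..<n} \<times> {..<D}. of_bool (p \<in> F))"
    unfolding sum.cartesian_product by (intro sum.cong) (auto simp: ind_def)
  also have "\<dots> = real (card F)"
    using F by (simp add: sum.If_cases of_bool_def Int_absorb1)
  finally show ?thesis .
qed

lemma sum_out_deg: "(\<Sum>z<n. out_deg z) = real (card F)"
  unfolding out_deg_def by (rule sum_ind)

lemma sum_along_F: "(\<Sum>z<n. \<Sum>l<D. ind z l * h (st l z)) = (\<Sum>z<n. in_deg z * h z)"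
proof -
  have "(\<Sum>z<n. \<Sum>l<D. ind z l * h (st l z)) = (\<Sum>l<D. \<Sum>z<n. ind z l * h (st l z))"
    by (rule sum.swap)
  also have "\<dots> = (\<Sum>l<D. \<Sum>z<n. ind (st (il l) (st l z)) l * h (st l z))"
    by (intro sum.cong refl) (simp add: st_il)
  also have "\<dots> = (\<Sum>l<D. \<Sum>z<n. ind (st (il l) z) l * h z)"
    by (intro sum.cong[OF refl] sum_st[where f = "\<lambda>z. ind (st (il l) z) l * h z" for l]) auto
  also have "\<dots> = (\<Sum>z<n. in_deg z * h z)"
    unfolding in_deg_def sum_distrib_right by (rule sum.swap)
  finally show ?thesis .
qed

lemma sum_in_deg: "(\<Sum>z<n. in_deg z) = real (card F)"
  using sum_along_F[of "\<lambda>_. 1"] sum_ind by simp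

lemma deg_bounds: "0 \<le> out_deg z" "out_deg z \<le> real D" "0 \<le> in_deg z" "in_deg z \<le> real D"
proof -
  have "out_deg z \<le> (\<Sum>l<D. 1)" "in_deg z \<le> (\<Sum>l<D. 1)"
    unfolding out_deg_def in_deg_def by (intro sum_mono; simp add: ind_def)+
  thus "out_deg z \<le> real D" "in_deg z \<le> real D" by auto
qed (auto simp: out_deg_def in_deg_def ind_def intro!: sum_nonneg)

lemma L2_deg:
  "L2_set out_deg {..<n} \<le> sqrt (real D * real (card F))"
  "L2_set in_deg {..<n} \<le> sqrt (real D * real (card F))"
proof -
  have "(\<Sum>z<n. (out_deg z)\<^sup>2) \<le> (\<Sum>z<n. real D * out_deg z)"
    "(\<Sum>z<n. (in_deg z)\<^sup>2) \<le> (\<Sum>z<n. real D * in_deg z)"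
    unfolding power2_eq_square by (intro sum_mono mult_right_mono deg_bounds)+
  thus "L2_set out_deg {..<n} \<le> sqrt (real D * real (card F))"
    "L2_set in_deg {..<n} \<le> sqrt (real D * real (card F))"
    unfolding L2_set_def by (simp_all add: sum_distrib_left[symmetric] sum_out_deg sum_in_deg)
qed

definition total_hits :: "nat \<Rightarrow> nat \<Rightarrow> real" where
  "total_hits L z = (\<Sum>w\<in>label_words D L. hits w z)"

lemma total_hits_Suc:
  "total_hits (Suc L) z = real D ^ L * out_deg z + (\<Sum>l<D. total_hits L (st l z))"
  unfolding total_hits_def sum_label_words_Suc
  by (simp add: sum.distrib card_label_words out_deg_def sum_distrib_left)

definition mean_hits :: "nat \<Rightarrow> real" where
  "mean_hits L = real L * real D ^ (L - 1) * (real (card F) / real n)"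

lemma mean_hits_Suc: "mean_hits (Suc L) = real D ^ L * (real (card F) / real n) + real D * mean_hits L"
  unfolding mean_hits_def by (cases L) (simp_all add: algebra_simps)

text \<open>Splitting off the first step, the deviation for \<open>Suc L\<close> is the centered
  out-degree, scaled, plus the adjacency operator applied to the deviation for \<open>L\<close>.
  Contraction turns this into a geometric series in \<open>\<gamma>\<close>, so the bound has no
  factor \<open>L\<close>. The factor \<open>real D\<close> on the left avoids the exponent
  \<open>L - 1\<close> at \<open>L = 0\<close>.\<close>

lemma total_hits_deviation:
  assumes n: "n > 0"
  shows "(\<Sum>z<n. total_hits L z - mean_hits L) = 0
    \<and> real D * L2_set (\<lambda>z. total_hits L z - mean_hits L) {..<n}
      \<le> real D ^ L * (sqrt (real D * real (card F)) / (1 - \<gamma>))"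
proof (induction L)
  case 0
  show ?case using \<gamma> by (simp add: total_hits_def mean_hits_def L2_set_def)
next
  case (Suc L)
  define m where "m = real (card F) / real n"
  define s where "s = sqrt (real D * real (card F))"
  define r where "r = (\<lambda>z. total_hits L z - mean_hits L)"
  have r: "(\<Sum>z<n. r z) = 0" "real D * L2_set r {..<n} \<le> real D ^ L * (s / (1 - \<gamma>))"
    using Suc by (auto simp: r_def s_def)
  have s0: "s \<ge> 0" by (simp add: s_def)
  have eq: "total_hits (Suc L) z - mean_hits (Suc L) = real D ^ L * (out_deg z - m) + (\<Sum>l<D. r (st l z))" for z
    unfolding total_hits_Suc mean_hits_Suc r_def by (simp add: sum_subtractf algebra_simps m_def)
  have m0: "(\<Sum>z<n. out_deg z - m) = 0"
    using n by (simp add: sum_subtractf sum_out_deg m_def)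
  have "(\<Sum>z<n. \<Sum>l<D. r (st l z)) = (\<Sum>l<D. \<Sum>z<n. r (st l z))" by (rule sum.swap)
  also have "\<dots> = (\<Sum>l<D. \<Sum>z<n. r z)" by (intro sum.cong[OF refl] sum_st) auto
  finally have 1: "(\<Sum>z<n. total_hits (Suc L) z - mean_hits (Suc L)) = 0"
    unfolding eq sum.distrib sum_distrib_left[symmetric] m0 r by simp
  have d: "L2_set (\<lambda>z. out_deg z - m) {..<n} \<le> s"
    using L2_set_centered_le[of out_deg n] L2_deg(1) unfolding sum_out_deg m_def s_def by linarith
  have "L2_set (\<lambda>z. real D ^ L * (out_deg z - m) + (\<Sum>l<D. r (st l z))) {..<n}
     \<le> L2_set (\<lambda>z. real D ^ L * (out_deg z - m)) {..<n} + L2_set (\<lambda>z. \<Sum>l<D. r (st l z)) {..<n}"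
    by (rule L2_set_triangle_ineq)
  also have "\<dots> \<le> real D ^ L * s + \<gamma> * real D * L2_set r {..<n}"
    using contraction[OF r(1)] d
    by (intro add_mono) (simp_all add: L2_set_right_distrib[symmetric] mult_left_mono)
  also have "\<dots> \<le> real D ^ L * s + \<gamma> * (real D ^ L * (s / (1 - \<gamma>)))"
    using mult_left_mono[OF r(2) \<gamma>(1)] by (simp add: mult_ac)
  also have "\<dots> = real D ^ L * (s / (1 - \<gamma>))"
    using \<gamma> by (simp add: field_simps)
  finally have "L2_set (\<lambda>z. total_hits (Suc L) z - mean_hits (Suc L)) {..<n} \<le> real D ^ L * (s / (1 - \<gamma>))"
    unfolding eq .
  from mult_left_mono[OF this, of "real D"] 1 show ?case
    by (simp add: s_def mult_ac)
qed

definition dens :: real where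
  "dens = real (card F) / (real n * real D)"

lemma card_F_dens: "n > 0 \<Longrightarrow> D > 0 \<Longrightarrow> real (card F) = dens * real n * real D"
  by (simp add: dens_def)

text \<open>Correlation between a marked step into \<open>z\<close> and the marked steps after it.
  The term with \<open>dens\<^sup>2\<close> is what independence would give; the rest is
  Cauchy-Schwarz applied to the deviation from the mean.\<close>

lemma cross_hits_le:
  assumes n: "n > 0" and D: "D > 0"
  shows "(\<Sum>z<n. in_deg z * total_hits L z)
    \<le> real n * real D ^ (Suc L) * (real L * dens\<^sup>2 + dens / (1 - \<gamma>))"
proof -
  define s where "s = sqrt (real D * real (card F))"
  define r where "r = (\<lambda>z. total_hits L z - mean_hits L)"
  have s2: "s * s = real D * real (card F)" by (simp add: s_def)
  have s0: "s \<ge> 0" by (simp add: s_def)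
  have rr: "real D * L2_set r {..<n} \<le> real D ^ L * (s / (1 - \<gamma>))"
    using total_hits_deviation[OF n, of L] by (simp add: r_def s_def)
  have "(\<Sum>z<n. in_deg z * total_hits L z) = (\<Sum>z<n. in_deg z * r z) + mean_hits L * (\<Sum>z<n. in_deg z)"
    by (simp add: r_def algebra_simps sum_subtractf sum_distrib_left)
  moreover have "(\<Sum>z<n. in_deg z * r z) \<le> (\<Sum>z<n. \<bar>in_deg z\<bar> * \<bar>r z\<bar>)"
    by (intro sum_mono) (metis abs_ge_self abs_mult)
  moreover have "\<dots> \<le> L2_set in_deg {..<n} * L2_set r {..<n}"
    by (rule L2_set_mult_ineq)
  moreover have "\<dots> \<le> s * L2_set r {..<n}"
    using L2_deg(2) by (intro mult_right_mono) (auto simp: s_def)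
  ultimately have "(\<Sum>z<n. in_deg z * total_hits L z) \<le> s * L2_set r {..<n} + mean_hits L * real (card F)"
    by (simp add: sum_in_deg)
  hence "real D * (\<Sum>z<n. in_deg z * total_hits L z) \<le> s * (real D * L2_set r {..<n}) + real D * mean_hits L * real (card F)"
    using D by (simp add: algebra_simps) (metis distrib_left mult.left_commute mult_le_cancel_left_pos of_nat_0_less_iff)
  also have "\<dots> \<le> s * (real D ^ L * (s / (1 - \<gamma>))) + real L * real D ^ L * (real (card F) / real n) * real (card F)"
  proof (rule add_mono)
    show "s * (real D * L2_set r {..<n}) \<le> s * (real D ^ L * (s / (1 - \<gamma>)))"
      by (rule mult_left_mono[OF rr s0])
    show "real D * mean_hits L * real (card F) \<le> real L * real D ^ L * (real (card F) / real n) * real (card F)"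
      unfolding mean_hits_def by (cases L) (simp_all add: mult_ac)
  qed
  also have "s * (real D ^ L * (s / (1 - \<gamma>))) = real D ^ L * (real D * real (card F)) / (1 - \<gamma>)"
    unfolding s2[symmetric] by simp
  also have "real D ^ L * (real D * real (card F)) / (1 - \<gamma>) + real L * real D ^ L * (real (card F) / real n) * real (card F)
    = real D * (real n * real D ^ (Suc L) * (real L * dens\<^sup>2 + dens / (1 - \<gamma>)))"
    unfolding card_F_dens[OF n D] using n \<gamma> by (simp add: field_simps power2_eq_square)
  finally show ?thesis using D by (simp add: mult_le_cancel_left_pos)
qed

definition sq_hits :: "nat \<Rightarrow> real" where
  "sq_hits L = (\<Sum>z<n. \<Sum>w\<in>label_words D L. (hits w z)\<^sup>2)"

lemma sq_hits_Suc:
  "sq_hits (Suc L) = real D ^ L * real (card F) + 2 * (\<Sum>z<n. in_deg z * total_hits L z) + real D * sq_hits L"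
proof -
  have "sq_hits (Suc L) = (\<Sum>z<n. \<Sum>l<D. \<Sum>w\<in>label_words D L. ind z l + 2 * ind z l * hits w (st l z) + (hits w (st l z))\<^sup>2)"
    unfolding sq_hits_def sum_label_words_Suc
    by (intro sum.cong refl) (auto simp: power2_eq_square algebra_simps ind_def)
  also have "\<dots> = (\<Sum>z<n. \<Sum>l<D. real D ^ L * ind z l) + 2 * (\<Sum>z<n. \<Sum>l<D. ind z l * total_hits L (st l z))
      + (\<Sum>z<n. \<Sum>l<D. \<Sum>w\<in>label_words D L. (hits w (st l z))\<^sup>2)"
    unfolding total_hits_def
    by (simp add: sum.distrib card_label_words sum_distrib_left mult.assoc)
  also have "(\<Sum>z<n. \<Sum>l<D. real D ^ L * ind z l) = real D ^ L * real (card F)"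
    by (simp only: sum_distrib_left[symmetric] sum_ind)
  also have "(\<Sum>z<n. \<Sum>l<D. ind z l * total_hits L (st l z)) = (\<Sum>z<n. in_deg z * total_hits L z)"
    by (rule sum_along_F)
  also have "(\<Sum>z<n. \<Sum>l<D. \<Sum>w\<in>label_words D L. (hits w (st l z))\<^sup>2) = real D * sq_hits L"
  proof -
    have "(\<Sum>z<n. \<Sum>l<D. \<Sum>w\<in>label_words D L. (hits w (st l z))\<^sup>2)
       = (\<Sum>l<D. \<Sum>z<n. \<Sum>w\<in>label_words D L. (hits w (st l z))\<^sup>2)" by (rule sum.swap)
    also have "\<dots> = (\<Sum>l<D. sq_hits L)"
      unfolding sq_hits_def
      by (intro sum.cong[OF refl] sum_st[where f = "\<lambda>z. \<Sum>w\<in>label_words D L. (hits w z)\<^sup>2"]) auto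
    finally show ?thesis by simp
  qed
  finally show ?thesis .
qed

text \<open>Squaring after splitting off the first step yields a diagonal term, twice a cross term,
  and the square for the shorter walk. The diagonal contributes the 1, and the correlations
  contribute the \<open>2 / (1 - \<gamma>)\<close>.\<close>

lemma sq_hits_le:
  assumes n: "n > 0" and D: "D > 0"
  shows "sq_hits L \<le> real n * real D ^ L * (real L * dens * (1 + 2 / (1 - \<gamma>)) + (real L)\<^sup>2 * dens\<^sup>2)"
proof (induction L)
  case 0
  show ?case by (simp add: sq_hits_def)
next
  case (Suc L)
  define K where "K = 1 / (1 - \<gamma>)"
  define P where "P = real n * real D ^ Suc L"
  have P0: "P \<ge> 0" by (simp add: P_def)
  have "sq_hits (Suc L) \<le> real D ^ L * real (card F)
     + 2 * (P * (real L * dens\<^sup>2 + dens * K)) + real D * sq_hits L"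
    unfolding sq_hits_Suc using cross_hits_le[OF n D, of L] by (simp add: K_def P_def)
  also have "real D ^ L * real (card F) = P * dens"
    unfolding card_F_dens[OF n D] by (simp add: P_def)
  also have "real D * sq_hits L \<le> real D * (real n * real D ^ L * (real L * dens * (1 + 2 * K) + (real L)\<^sup>2 * dens\<^sup>2))"
    using Suc by (intro mult_left_mono) (auto simp: K_def)
  also have "real D * (real n * real D ^ L * (real L * dens * (1 + 2 * K) + (real L)\<^sup>2 * dens\<^sup>2))
    = P * (real L * dens * (1 + 2 * K) + (real L)\<^sup>2 * dens\<^sup>2)"
    by (simp add: P_def)
  also have "P * dens + 2 * (P * (real L * dens\<^sup>2 + dens * K)) + P * (real L * dens * (1 + 2 * K) + (real L)\<^sup>2 * dens\<^sup>2)
    = P * (real (Suc L) * dens * (1 + 2 * K) + ((real L)\<^sup>2 + 2 * real L) * dens\<^sup>2)"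
    by (simp add: algebra_simps)
  also have "\<dots> \<le> P * (real (Suc L) * dens * (1 + 2 * K) + (real (Suc L))\<^sup>2 * dens\<^sup>2)"
    by (intro mult_left_mono P0 add_left_mono mult_right_mono) (auto simp: power2_eq_square algebra_simps)
  finally show ?case by (simp add: K_def P_def)
qed

end

text \<open>Only the two end points of a walk are variables, so every passed point is named twice:
  by a prefix of the word at the start and by a reversed suffix at the end. An edge is tested on the
  opinion of the start about its tail and of the end about its head, the pair that is independent
  when both distances are random.\<close>

definition reject :: "(nat \<Rightarrow> nat list \<Rightarrow> 'a) \<Rightarrow> (nat \<Rightarrow> nat \<Rightarrow> 'a \<Rightarrow> 'a \<Rightarrow> bool) \<Rightarrow> nat list \<Rightarrow> nat \<Rightarrow> bool" where
  "reject op R w a \<longleftrightarrow> \<not> ((\<forall>p\<le>length w. op a (take p w) = op (walk w a) (rv (drop p w))) \<and>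
     (\<forall>p<length w. R (w ! p) (walk (take p w) a) (op a (take p w)) (op (walk w a) (rv (drop (Suc p) w)))))"

text \<open>The walk is described from its step \<open>(u, l)\<close>: \<open>\<mu>\<close> leads
  from \<open>u\<close> back to the start and \<open>\<nu>\<close> from the head on to the end. The
  three failures are the comparisons at positions \<open>i\<close> and \<open>Suc i\<close> and the
  edge test between them.\<close>

lemma reject_middle:
  assumes u: "u < n" and l: "l < D" and mu: "\<mu> \<in> label_words D i"
    and bad: "\<not> (op (walk \<mu> u) (rv \<mu>) = op (walk \<nu> (st l u)) (rv (l # \<nu>))
      \<and> op (walk \<mu> u) (rv \<mu> @ [l]) = op (walk \<nu> (st l u)) (rv \<nu>)
      \<and> R l u (op (walk \<mu> u) (rv \<mu>)) (op (walk \<nu> (st l u)) (rv \<nu>)))"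
  shows "reject op R (rv \<mu> @ l # \<nu>) (walk \<mu> u)"
proof -
  define w where "w = rv \<mu> @ l # \<nu>"
  have len: "length (rv \<mu>) = i" using rv_label_words[OF mu] by (simp add: label_words_def)
  have b: "walk w (walk \<mu> u) = walk \<nu> (st l u)" using walk_rv[OF mu u] by (simp add: w_def)
  have t: "take i w = rv \<mu>" "drop i w = l # \<nu>" "take (Suc i) w = rv \<mu> @ [l]" "drop (Suc i) w = \<nu>"
    "w ! i = l" "i < length w"
    using len by (auto simp: w_def)
  show ?thesis
  proof (rule ccontr)
    assume "\<not> reject op R (rv \<mu> @ l # \<nu>) (walk \<mu> u)"
    hence 1: "\<And>p. p \<le> length w \<Longrightarrow> op (walk \<mu> u) (take p w) = op (walk w (walk \<mu> u)) (rv (drop p w))"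
      and 2: "\<And>p. p < length w \<Longrightarrow> R (w ! p) (walk (take p w) (walk \<mu> u)) (op (walk \<mu> u) (take p w)) (op (walk w (walk \<mu> u)) (rv (drop (Suc p) w)))"
      unfolding reject_def w_def by blast+
    show False
      using 1[of i] 1[of "Suc i"] 2[of i] bad t b walk_rv[OF mu u] by auto
  qed
qed

text \<open>The probability that a random holder has opinion \<open>x\<close> about
  \<open>u\<close>, where a distance below \<open>t\<close> and then a word of that length are
  uniform. The holder \<open>walk \<mu> u\<close> sees \<open>u\<close> along the reversed
  word.\<close>

definition popularity :: "nat \<Rightarrow> (nat \<Rightarrow> nat list \<Rightarrow> 'a) \<Rightarrow> nat \<Rightarrow> 'a \<Rightarrow> real" where
  "popularity t op u x = (\<Sum>i<t. \<Sum>\<mu>\<in>label_words D i. 1 / (real t * real D ^ i) * of_bool (op (walk \<mu> u) (rv \<mu>) = x))"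

text \<open>The type of opinions may be infinite, but popularity vanishes outside the finite set of
  opinions that occur, so the maximum is attained.\<close>

lemma plurality_opinion_exists:
  "\<exists>\<sigma>. \<forall>u x. popularity t op u x \<le> popularity t op u (\<sigma> u)"
proof -
  have "\<exists>s. \<forall>x. popularity t op u x \<le> popularity t op u s" for u
  proof -
    define X where "X = (\<lambda>\<mu>. op (walk \<mu> u) (rv \<mu>)) ` (\<Union>i<t. label_words D i)"
    have fin: "finite X" by (auto simp: X_def)
    have nn: "popularity t op u x \<ge> 0" for x
      unfolding popularity_def by (intro sum_nonneg) auto
    have z: "popularity t op u x = 0" if "x \<notin> X" for x
      unfolding popularity_def using that by (intro sum.neutral ballI) (auto simp: X_def)
    show ?thesis
    proof (cases "X = {}")
      case True
      thus ?thesis using z by auto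
    next
      case False
      have "Max (popularity t op u ` X) \<in> popularity t op u ` X"
        using fin False by (intro Max_in) auto
      then obtain s where s: "Max (popularity t op u ` X) = popularity t op u s" by auto
      have "popularity t op u x \<le> popularity t op u s" for x
      proof (cases "x \<in> X")
        case True
        thus ?thesis using fin s[symmetric] by simp
      next
        case False
        thus ?thesis using z nn by simp
      qed
      thus ?thesis by blast
    qed
  qed
  thus ?thesis by metis
qed

text \<open>An instance of \<open>independent_opinions_reject\<close> in which \<open>i\<close> and
  \<open>j\<close> range over pairs of a distance and a word, one for each side of the marked
  edge.\<close>

lemma middle_rejection_prob:
  assumes t: "t > 0" and D: "D > 0" and u: "u < n" and l: "l < D"
    and plur: "\<And>u x. popularity t op u x \<le> popularity t op u (\<sigma> u)"
    and R: "\<not> R l u (\<sigma> u) (\<sigma> (st l u))"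
  shows "1 / 4 \<le> (\<Sum>i<t. \<Sum>j<t. 1 / (real t * real D ^ i) * (1 / (real t * real D ^ j)) *
     (\<Sum>\<mu>\<in>label_words D i. \<Sum>\<nu>\<in>label_words D j. of_bool (reject op R (rv \<mu> @ l # \<nu>) (walk \<mu> u))))"
proof -
  define I where "I = Sigma {..<t} (label_words D)"
  define wt where "wt p = 1 / (real t * real D ^ fst p)" for p :: "nat \<times> nat list"
  have fin: "finite I" by (simp add: I_def)
  have sI: "(\<Sum>p\<in>I. g p) = (\<Sum>i<t. \<Sum>\<mu>\<in>label_words D i. g (i, \<mu>))" for g :: "_ \<Rightarrow> real"
    unfolding I_def by (subst sum.Sigma) (auto simp: split_def)
  have w0: "wt p \<ge> 0" for p by (simp add: wt_def)
  have w1: "(\<Sum>p\<in>I. wt p) = 1"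
    using t D unfolding sI wt_def by (simp add: card_label_words)
  define X where "X u p = op (walk (snd p) u) (rv (snd p))" for u and p :: "nat \<times> nat list"
  have pop: "(\<Sum>p\<in>I. wt p * of_bool (X u p = x)) = popularity t op u x" for u x
    unfolding sI popularity_def wt_def X_def by simp
  define X' where "X' p = op (walk (snd p) (st l u)) (rv (l # snd p))" for p :: "nat \<times> nat list"
  define Y' where "Y' p = op (walk (snd p) u) (rv (snd p) @ [l])" for p :: "nat \<times> nat list"
  have "1 / 4 \<le> (\<Sum>p\<in>I. \<Sum>q\<in>I. wt p * wt q * of_bool (\<not> (X u p = X' q \<and> Y' p = X (st l u) q \<and> R l u (X u p) (X (st l u) q))))"
    by (rule independent_opinions_reject[where R = "R l u" and X = "X u" and Y = "X (st l u)" and \<sigma> = "\<sigma> u" and \<tau> = "\<sigma> (st l u)"])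
       (use fin w0 w1 R in \<open>simp_all add: pop plur\<close>)
  also have "\<dots> \<le> (\<Sum>p\<in>I. \<Sum>q\<in>I. wt p * wt q * of_bool (reject op R (rv (snd p) @ l # snd q) (walk (snd p) u)))"
  proof (intro sum_mono mult_left_mono mult_nonneg_nonneg w0)
    fix p q assume "p \<in> I"
    hence "snd p \<in> label_words D (fst p)" by (auto simp: I_def)
    from reject_middle[OF u l this, of op "snd q" R]
    show "(of_bool (\<not> (X u p = X' q \<and> Y' p = X (st l u) q \<and> R l u (X u p) (X (st l u) q))) :: real)
      \<le> of_bool (reject op R (rv (snd p) @ l # snd q) (walk (snd p) u))"
      unfolding X_def X'_def Y'_def by auto
  qed
  also have "\<dots> = (\<Sum>i<t. \<Sum>j<t. 1 / (real t * real D ^ i) * (1 / (real t * real D ^ j)) *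
     (\<Sum>\<mu>\<in>label_words D i. \<Sum>\<nu>\<in>label_words D j. of_bool (reject op R (rv \<mu> @ l # \<nu>) (walk \<mu> u))))"
    unfolding sI wt_def fst_conv snd_conv sum_distrib_left
    by (rule sum.cong[OF refl], rule sum.swap)
  finally show ?thesis .
qed

text \<open>Walks are rooted at the tail of their step number \<open>i\<close> instead of at their
  start. The last \<open>k\<close> labels lie beyond the prefix that is inspected and contribute the
  factor \<open>D ^ k\<close>.\<close>

lemma sum_over_middle_edge:
  fixes F
  assumes F: "F \<subseteq> {..<n} \<times> {..<D}" and L: "L = i + Suc (j + k)"
  shows "(\<Sum>a<n. \<Sum>w\<in>label_words D L. ind F (walk (take i w) a) (w ! i) * V (take (Suc (i + j)) w) a)
    = real D ^ k * (\<Sum>u<n. \<Sum>l<D. ind F u l * (\<Sum>\<mu>\<in>label_words D i. \<Sum>\<nu>\<in>label_words D j. V (rv \<mu> @ l # \<nu>) (walk \<mu> u)))"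
proof -
  have "(\<Sum>w\<in>label_words D L. ind F (walk (take i w) a) (w ! i) * V (take (Suc (i + j)) w) a)
    = (\<Sum>x\<in>label_words D i. \<Sum>l<D. \<Sum>y\<in>label_words D j. real D ^ k * (ind F (walk x a) l * V (x @ l # y) a))" for a
    unfolding L sum_label_words_append sum_label_words_Suc
  proof (intro sum.cong refl)
    fix x l y
    assume "x \<in> label_words D i" "y \<in> label_words D j"
    hence len: "length x = i" "length y = j" by (auto simp: label_words_def)
    show "(\<Sum>z\<in>label_words D k. ind F (walk (take i (x @ l # y @ z)) a) ((x @ l # y @ z) ! i)
          * V (take (Suc (i + j)) (x @ l # y @ z)) a) = real D ^ k * (ind F (walk x a) l * V (x @ l # y) a)"
      using len by (simp add: card_label_words nth_append take_append)
  qed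
  hence "(\<Sum>a<n. \<Sum>w\<in>label_words D L. ind F (walk (take i w) a) (w ! i) * V (take (Suc (i + j)) w) a)
    = (\<Sum>a<n. \<Sum>x\<in>label_words D i. \<Sum>l<D. \<Sum>y\<in>label_words D j. real D ^ k * (ind F (walk x a) l * V (x @ l # y) a))"
    by simp
  also have "\<dots> = (\<Sum>u<n. \<Sum>\<mu>\<in>label_words D i. \<Sum>l<D. \<Sum>\<nu>\<in>label_words D j.
      real D ^ k * (ind F (walk (rv \<mu>) (walk \<mu> u)) l * V (rv \<mu> @ l # \<nu>) (walk \<mu> u)))"
    by (rule sum_reverse_walks)
  also have "\<dots> = (\<Sum>u<n. \<Sum>\<mu>\<in>label_words D i. \<Sum>l<D. \<Sum>\<nu>\<in>label_words D j.
      real D ^ k * (ind F u l * V (rv \<mu> @ l # \<nu>) (walk \<mu> u)))"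
    by (intro sum.cong refl) (simp add: walk_rv)
  also have "\<dots> = (\<Sum>u<n. \<Sum>l<D. \<Sum>\<mu>\<in>label_words D i. \<Sum>\<nu>\<in>label_words D j.
      real D ^ k * (ind F u l * V (rv \<mu> @ l # \<nu>) (walk \<mu> u)))"
    by (rule sum.cong[OF refl], rule sum.swap)
  finally show ?thesis by (simp only: sum_distrib_left)
qed

text \<open>The number of rejecting walks is bounded below by the second moment method: a walk of
  \<open>2 t - 1\<close> steps is counted once for each pair \<open>i, j < t\<close> such that its step after \<open>i\<close> steps is
  violated by the plurality opinions and the prefix that ends \<open>j\<close> steps later is rejected.\<close>

lemma amplification:
  fixes F
  assumes t: "t > 0" and D: "D > 0" and n: "n > 0"
    and plur: "\<And>u x. popularity t op u x \<le> popularity t op u (\<sigma> u)"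
    and F_def: "F = {(u, l). u < n \<and> l < D \<and> \<not> R l u (\<sigma> u) (\<sigma> (st l u))}"
  defines "L \<equiv> 2 * t - 1"
  defines "\<epsilon> \<equiv> real (card F) / (real n * real D)"
  shows "real n * real D ^ L * real L * (min (real t * \<epsilon>) 1 / (128 * (3 + 2 / (1 - \<gamma>))))
    \<le> (\<Sum>a<n. \<Sum>w\<in>label_words D L. \<Sum>k\<in>{1..L}. of_bool (reject op R (take k w) a))"
proof -
  have F: "F \<subseteq> {..<n} \<times> {..<D}" by (auto simp: F_def)
  note ind = ind_def[OF F]
  define V :: "nat list \<Rightarrow> nat \<Rightarrow> real" where "V w a = of_bool (reject op R w a)" for w a
  define C where "C = (\<Sum>a<n. \<Sum>w\<in>label_words D L. \<Sum>k\<in>{1..L}. V (take k w) a)"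
  define Y where "Y i j a w = ind F (walk (take i w) a) (w ! i) * V (take (Suc (i + j)) w) a" for i j a w
  define T where "T = (\<Sum>a<n. \<Sum>w\<in>label_words D L. \<Sum>i<t. \<Sum>j<t. Y i j a w)"
  define Z where "Z u l i j = 1 / (real t * real D ^ i) * (1 / (real t * real D ^ j)) *
    (\<Sum>\<mu>\<in>label_words D i. \<Sum>\<nu>\<in>label_words D j. V (rv \<mu> @ l # \<nu>) (walk \<mu> u))" for u l i j
  \<comment> \<open>Turns the probabilities in \<open>Z\<close> into counts of walks:
    \<open>t\<^sup>2\<close> pairs of distances, and one free label for each of the
    \<open>L - 1\<close> steps other than the marked one.\<close>
  define G where "G = (real t)\<^sup>2 * real D ^ (L - 1)"
  define M where "M = real n * real D ^ L"
  define x where "x = real t * \<epsilon>"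
  define \<kappa> where "\<kappa> = 1 + 2 / (1 - \<gamma>)"
  have \<kappa>: "\<kappa> > 0" using \<gamma> by (simp add: \<kappa>_def add_pos_pos)
  have M: "M > 0" using n D by (simp add: M_def)
  have V: "(V w a)\<^sup>2 = V w a" "0 \<le> V w a" for w a by (auto simp: V_def)
  have e0: "\<epsilon> \<ge> 0" by (simp add: \<epsilon>_def)
  have dens: "dens F = \<epsilon>" by (simp add: dens_def[OF F] \<epsilon>_def)
  have L: "L > 0" "real L \<le> 2 * real t" using t by (auto simp: L_def)
  have C0: "C \<ge> 0" unfolding C_def by (intro sum_nonneg V)

  \<comment> \<open>Lower bound on \<open>T\<close>: each marked edge contributes at least
    \<open>1 / 4\<close>, and the sum is then regrouped by walks.\<close>
  have "(\<Sum>u<n. \<Sum>l<D. G * ind F u l * (1 / 4)) \<le> (\<Sum>u<n. \<Sum>l<D. G * ind F u l * (\<Sum>i<t. \<Sum>j<t. Z u l i j))"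
  proof (intro sum_mono)
    fix u l assume ul: "u \<in> {..<n}" "l \<in> {..<D}"
    show "G * ind F u l * (1 / 4) \<le> G * ind F u l * (\<Sum>i<t. \<Sum>j<t. Z u l i j)"
    proof (cases "(u, l) \<in> F")
      case True
      hence "\<not> R l u (\<sigma> u) (\<sigma> (st l u))" by (simp add: F_def)
      from middle_rejection_prob[where R = R, OF t D _ _ plur this] ul show ?thesis
        unfolding V_def Z_def by (intro mult_left_mono) (auto simp: ind G_def)
    qed (simp add: ind)
  qed
  also have "\<dots> = (\<Sum>u<n. \<Sum>l<D. \<Sum>i<t. \<Sum>j<t. G * ind F u l * Z u l i j)"
    by (simp only: sum_distrib_left)
  also have "\<dots> = (\<Sum>i<t. \<Sum>j<t. \<Sum>u<n. \<Sum>l<D. G * ind F u l * Z u l i j)"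
    by (rule sum_swap_pairs)
  also have "\<dots> = (\<Sum>i<t. \<Sum>j<t. \<Sum>a<n. \<Sum>w\<in>label_words D L. Y i j a w)"
  proof (rule sum.cong[OF refl], rule sum.cong[OF refl])
    fix i j assume "i \<in> {..<t}" "j \<in> {..<t}"
    hence k: "L = i + Suc (j + (L - 1 - (i + j)))" by (auto simp: L_def)
    define k where "k = L - 1 - (i + j)"
    have L1: "L - 1 = i + j + k" using k by (simp add: k_def)
    have c: "real D ^ k = G * (1 / (real t * real D ^ i) * (1 / (real t * real D ^ j)))"
      using t D unfolding L1 G_def by (simp add: power_add power2_eq_square)
    show "(\<Sum>u<n. \<Sum>l<D. G * ind F u l * Z u l i j) = (\<Sum>a<n. \<Sum>w\<in>label_words D L. Y i j a w)"
      unfolding Y_def Z_def sum_over_middle_edge[OF F k] k_def[symmetric] c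
        sum_distrib_left[of _ _ "{..<n}"] sum_distrib_left[of _ _ "{..<D}"]
      by (intro sum.cong refl) (simp only: mult_ac)
  qed
  also have "\<dots> = T" unfolding T_def by (rule sum_swap_pairs)
  finally have "(\<Sum>u<n. \<Sum>l<D. G * ind F u l * (1 / 4)) \<le> T" .
  moreover have "(\<Sum>u<n. \<Sum>l<D. G * ind F u l * (1 / 4)) = G * real (card F) * (1 / 4)"
    by (simp only: sum_distrib_right[symmetric] sum_distrib_left[symmetric] sum_ind[OF F])
  moreover have "real (card F) = \<epsilon> * real n * real D" using card_F_dens[OF F n D] dens by simp
  moreover have "real D ^ L = real D ^ (L - 1) * real D" using L by (cases L) auto
  ultimately have lower: "M * ((real t)\<^sup>2 * \<epsilon>) / 4 \<le> T" by (simp add: M_def G_def mult_ac)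

  have "0 \<le> M * ((real t)\<^sup>2 * \<epsilon>) / 4" using M e0 by simp
  with lower have T0: "0 \<le> T" by linarith
  define P where "P = {..<n} \<times> label_words D L \<times> {1..L}"
  have P: "(\<Sum>p\<in>P. g (fst p) (fst (snd p)) (snd (snd p))) = (\<Sum>a<n. \<Sum>w\<in>label_words D L. \<Sum>k\<in>{1..L}. g a w k)"
    for g :: "nat \<Rightarrow> nat list \<Rightarrow> nat \<Rightarrow> real"
    unfolding P_def by (simp add: sum.cartesian_product split_def)
  \<comment> \<open>Upper bound on \<open>T\<close>: for fixed \<open>i\<close> the lengths
    \<open>Suc (i + j)\<close> are distinct elements of \<open>{1..L}\<close>, since
    \<open>i\<close> and \<open>j\<close> are below \<open>t\<close>. Cauchy-Schwarz then separates
    the rejections from the hits.\<close>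
  have "T \<le> (\<Sum>a<n. \<Sum>w\<in>label_words D L. \<Sum>k\<in>{1..L}. V (take k w) a * hits F w a)"
    unfolding T_def
  proof (intro sum_mono)
    fix a w assume w: "w \<in> label_words D L"
    define S where "S = (\<Sum>k\<in>{1..L}. V (take k w) a)"
    have "(\<Sum>i<t. \<Sum>j<t. Y i j a w) = (\<Sum>i<t. ind F (walk (take i w) a) (w ! i) * (\<Sum>j<t. V (take (Suc (i + j)) w) a))"
      by (simp add: Y_def sum_distrib_left)
    also have "\<dots> \<le> (\<Sum>i<t. ind F (walk (take i w) a) (w ! i) * S)"
    proof (intro sum_mono mult_left_mono)
      fix i assume i: "i \<in> {..<t}"
      have "(\<Sum>j<t. V (take (Suc (i + j)) w) a) = (\<Sum>k\<in>(\<lambda>j. Suc (i + j)) ` {..<t}. V (take k w) a)"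
        by (subst sum.reindex) (auto simp: inj_on_def)
      also have "\<dots> \<le> S"
        unfolding S_def using i by (intro sum_mono2 V) (auto simp: L_def)
      finally show "(\<Sum>j<t. V (take (Suc (i + j)) w) a) \<le> S" .
    qed (simp add: ind)
    also have "\<dots> = (\<Sum>i<t. ind F (walk (take i w) a) (w ! i)) * S"
      by (simp only: sum_distrib_right)
    also have "\<dots> \<le> hits F w a * S"
    proof (rule mult_right_mono)
      have "length w = L" using w by (simp add: label_words_def)
      thus "(\<Sum>i<t. ind F (walk (take i w) a) (w ! i)) \<le> hits F w a"
        unfolding hits_nth[OF F] using t by (intro sum_mono2) (auto simp: L_def ind)
    qed (simp add: S_def sum_nonneg V)
    finally show "(\<Sum>i<t. \<Sum>j<t. Y i j a w) \<le> (\<Sum>k\<in>{1..L}. V (take k w) a * hits F w a)"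
      by (simp add: S_def sum_distrib_left mult.commute)
  qed
  also have "\<dots> = (\<Sum>p\<in>P. V (take (snd (snd p)) (fst (snd p))) (fst p) * hits F (fst (snd p)) (fst p))"
    by (rule P[symmetric])
  finally have "T\<^sup>2 \<le> (\<Sum>p\<in>P. V (take (snd (snd p)) (fst (snd p))) (fst p) * hits F (fst (snd p)) (fst p))\<^sup>2"
    using T0 by (intro power_mono)
  also have "\<dots> \<le> (\<Sum>p\<in>P. (V (take (snd (snd p)) (fst (snd p))) (fst p))\<^sup>2) * (\<Sum>p\<in>P. (hits F (fst (snd p)) (fst p))\<^sup>2)"
    by (rule Cauchy_Schwarz_ineq_sum)
  also have "(\<Sum>p\<in>P. (V (take (snd (snd p)) (fst (snd p))) (fst p))\<^sup>2) = C"
    unfolding V(1) C_def by (rule P)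
  also have "(\<Sum>p\<in>P. (hits F (fst (snd p)) (fst p))\<^sup>2) = (\<Sum>a<n. \<Sum>w\<in>label_words D L. \<Sum>k\<in>{1..L}. (hits F w a)\<^sup>2)"
    by (rule P)
  also have "\<dots> = real L * sq_hits F L"
    by (simp add: sq_hits_def[OF F] sum_distrib_left)
  finally have "T\<^sup>2 \<le> C * (real L * sq_hits F L)" .
  also have "\<dots> \<le> C * (real L * (M * (real L * \<epsilon> * \<kappa> + (real L)\<^sup>2 * \<epsilon>\<^sup>2)))"
    using sq_hits_le[OF F n D, of L] unfolding dens M_def \<kappa>_def
    by (intro mult_left_mono C0) auto
  finally have upper: "T\<^sup>2 \<le> C * (real L * (M * (real L * \<epsilon> * \<kappa> + (real L)\<^sup>2 * \<epsilon>\<^sup>2)))" .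

  have "M * real L * (min x 1 / (128 * (\<kappa> + 2))) \<le> C"
  proof (cases "\<epsilon> = 0")
    case True
    thus ?thesis using C0 by (simp add: x_def)
  next
    case False
    hence e: "\<epsilon> > 0" using e0 by simp
    have x: "x > 0" using e t by (simp add: x_def)
    have "(M * ((real t)\<^sup>2 * \<epsilon>) / 4)\<^sup>2 \<le> T\<^sup>2"
      using lower M e by (intro power_mono) auto
    also note upper
    also have "C * (real L * (M * (real L * \<epsilon> * \<kappa> + (real L)\<^sup>2 * \<epsilon>\<^sup>2)))
      = (M * \<epsilon>) * (C * (real L)\<^sup>2 * (\<kappa> + real L * \<epsilon>))"
      by (simp add: power2_eq_square algebra_simps)
    also have "(M * ((real t)\<^sup>2 * \<epsilon>) / 4)\<^sup>2 = (M * \<epsilon>) * (M * (real t)\<^sup>2 * (real t)\<^sup>2 * \<epsilon> / 16)"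
      by (simp add: power2_eq_square)
    finally have 1: "M * (real t)\<^sup>2 * (real t)\<^sup>2 * \<epsilon> / 16 \<le> C * (real L)\<^sup>2 * (\<kappa> + real L * \<epsilon>)"
      by (rule mult_left_le_imp_le) (use M e in simp)
    \<comment> \<open>The constant is \<open>128 = 16 * 8\<close>, from the square of
      \<open>1 / 4\<close> and from the cube of \<open>L \<le> 2 * t\<close>.\<close>
    have "(real L)\<^sup>2 * (M * real L * x / 128) = M * \<epsilon> * real t / 128 * (real L * (real L)\<^sup>2)"
      by (simp add: x_def power2_eq_square)
    also have "\<dots> \<le> M * \<epsilon> * real t / 128 * ((2 * real t) * (2 * real t)\<^sup>2)"
      using M e L by (intro mult_left_mono mult_mono power_mono) auto
    also have "\<dots> = M * (real t)\<^sup>2 * (real t)\<^sup>2 * \<epsilon> / 16"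
      by (simp add: power2_eq_square)
    also note 1
    also have "C * (real L)\<^sup>2 * (\<kappa> + real L * \<epsilon>) \<le> C * (real L)\<^sup>2 * (\<kappa> + 2 * x)"
      using L e C0 by (intro mult_left_mono add_left_mono) (auto simp: x_def)
    also have "\<dots> = (real L)\<^sup>2 * (C * (\<kappa> + 2 * x))" by simp
    finally have 2: "M * real L * x / 128 \<le> C * (\<kappa> + 2 * x)"
      by (rule mult_left_le_imp_le) (use L in simp)
    \<comment> \<open>Treats few and many expected hits together, so that the factor
      \<open>\<kappa> + 2 * x\<close> can be cancelled.\<close>
    have 3: "min x 1 * (\<kappa> + 2 * x) \<le> x * (\<kappa> + 2)"
    proof (cases "x \<le> 1")
      case True
      thus ?thesis using x by (simp add: min_def mult_left_mono)
    next
      case False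
      hence "\<kappa> \<le> x * \<kappa>" using \<kappa> by simp
      thus ?thesis using False by (simp add: min_def algebra_simps)
    qed
    have "(M * real L / 128) * (min x 1 * (\<kappa> + 2 * x)) \<le> (M * real L / 128) * (x * (\<kappa> + 2))"
      using M by (intro mult_left_mono 3) auto
    also have "\<dots> = M * real L * x / 128 * (\<kappa> + 2)" by simp
    also have "\<dots> \<le> C * (\<kappa> + 2 * x) * (\<kappa> + 2)"
      using \<kappa> by (intro mult_right_mono 2) auto
    finally have "(M * real L / 128 * min x 1) * (\<kappa> + 2 * x) \<le> (C * (\<kappa> + 2)) * (\<kappa> + 2 * x)"
      by (simp add: mult_ac)
    hence "M * real L / 128 * min x 1 \<le> C * (\<kappa> + 2)"
      by (rule mult_right_le_imp_le) (use \<kappa> x in simp)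
    thus ?thesis using \<kappa> by (simp add: field_simps)
  qed
  thus ?thesis by (simp add: C_def V_def M_def x_def \<kappa>_def)
qed

end

section \<open>Programs that run in polynomial time\<close>

text \<open>The encoding is fixed by the type, so that running times can be stated for HOL functions
  and composed without mentioning trees.\<close>

class encodable =
  fixes enc :: "'a \<Rightarrow> tree"

instantiation nat :: encodable
begin
definition enc_nat :: "nat \<Rightarrow> tree" where "enc_nat = encode_nat"
instance ..
end

instantiation bool :: encodable
begin
definition enc_bool :: "bool \<Rightarrow> tree" where "enc_bool = encode_bool"
instance ..
end

instantiation unit :: encodable
begin
definition enc_unit :: "unit \<Rightarrow> tree" where "enc_unit _ = Leaf"
instance ..
end

instantiation list :: (encodable) encodable
begin
definition enc_list :: "'a list \<Rightarrow> tree" where "enc_list = encode_list enc"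
instance ..
end

instantiation prod :: (encodable, encodable) encodable
begin
definition enc_prod :: "'a \<times> 'b \<Rightarrow> tree" where "enc_prod p = Node (enc (fst p)) (enc (snd p))"
instance ..
end

lemma enc_Nil [simp]: "enc [] = Leaf" and enc_Cons [simp]: "enc (x # xs) = Node (enc x) (enc xs)"
  by (simp_all add: enc_list_def)

lemma enc_Pair [simp]: "enc (x, y) = Node (enc x) (enc y)"
  by (simp add: enc_prod_def)

lemma enc_0 [simp]: "enc (0::nat) = Leaf" and enc_Suc [simp]: "enc (Suc n) = Node Leaf (enc n)"
  by (simp_all add: enc_nat_def encode_nat_def)

lemma enc_Unity [simp]: "enc () = Leaf"
  by (simp add: enc_unit_def)

lemma enc_True [simp]: "enc True = Node Leaf Leaf" and enc_False [simp]: "enc False = Leaf"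
  by (simp_all add: enc_bool_def encode_bool_def)

text \<open>A unary number and a list of units are the same tree, so list operations double as
  arithmetic.\<close>

lemma enc_units: "enc (replicate n ()) = enc n"
  by (induction n) auto

definition esize :: "'a::encodable \<Rightarrow> nat" where
  "esize x = tree_size (enc x)"

lemma tree_size_pos [simp]: "tree_size x > 0"
  by (induction x) auto

lemma esize_pos: "esize x \<ge> 1"
  using tree_size_pos[of "enc x"] by (simp add: esize_def Suc_le_eq del: tree_size_pos)

lemma esize_simps [simp]:
  "esize (x, y) = esize x + esize y + 1"
  "esize (x # xs) = esize x + esize xs + 1"
  "esize ([] :: 'b::encodable list) = 1"
  "esize (0::nat) = 1" "esize (Suc n) = esize n + 2"
  by (simp_all add: esize_def)

lemma esize_nat: "esize n = 2 * n + 1"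
  by (induction n) auto

lemma length_le_esize: "length xs \<le> esize xs"
  by (induction xs) auto

lemma esize_append: "esize (xs @ ys) + 1 = esize xs + esize ys"
  by (induction xs) auto

lemma esize_append_ge: "esize xs \<le> esize (xs @ ys)" "esize ys \<le> esize (xs @ ys)"
  using esize_append[of xs ys] esize_pos[of xs] esize_pos[of ys] by linarith+

lemma esize_rev: "esize (rev xs) = esize xs"
proof (induction xs)
  case (Cons x xs)
  show ?case using esize_append[of "rev xs" "[x]"] Cons by simp
qed simp

lemma esize_list_le:
  assumes "\<And>x. x \<in> set xs \<Longrightarrow> esize x \<le> B"
  shows "esize xs \<le> length xs * (B + 1) + 1"
  using assms by (induction xs) force+

lemma esize_mem_le: "x \<in> set xs \<Longrightarrow> esize x \<le> esize xs"
  by (induction xs) auto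

section \<open>Polynomial bounds and functions computed in polynomial time\<close>

definition poly_bounded :: "('a::encodable \<Rightarrow> nat) \<Rightarrow> bool" where
  "poly_bounded g \<longleftrightarrow> (\<exists>c e. \<forall>x. g x \<le> c * esize x ^ e)"

lemma poly_boundedI: "(\<And>x. g x \<le> c * esize x ^ e) \<Longrightarrow> poly_bounded g"
  unfolding poly_bounded_def by blast

lemma poly_bounded_mono: "poly_bounded g \<Longrightarrow> (\<And>x. f x \<le> g x) \<Longrightarrow> poly_bounded f"
  unfolding poly_bounded_def by (meson order_trans)

lemma poly_bounded_const: "poly_bounded (\<lambda>x. c)"
  by (rule poly_boundedI[of _ c 0]) simp

lemma poly_bounded_esize: "poly_bounded esize"
  by (rule poly_boundedI[of _ 1 1]) simp

lemma poly_bounded_add: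
  assumes "poly_bounded f" "poly_bounded g"
  shows "poly_bounded (\<lambda>x. f x + g x)"
proof -
  obtain c e where f: "\<And>x. f x \<le> c * esize x ^ e" using assms(1) unfolding poly_bounded_def by blast
  obtain d k where g: "\<And>x. g x \<le> d * esize x ^ k" using assms(2) unfolding poly_bounded_def by blast
  show ?thesis
  proof (rule poly_boundedI)
    fix x :: 'a
    have "f x + g x \<le> c * esize x ^ e + d * esize x ^ k" by (intro add_mono f g)
    also have "\<dots> \<le> c * esize x ^ max e k + d * esize x ^ max e k"
      by (intro add_mono mult_left_mono power_increasing esize_pos) auto
    finally show "f x + g x \<le> (c + d) * esize x ^ max e k" by (simp add: algebra_simps)
  qed
qed

lemma poly_bounded_mult:
  assumes "poly_bounded f" "poly_bounded g"
  shows "poly_bounded (\<lambda>x. f x * g x)"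
proof -
  obtain c e where f: "\<And>x. f x \<le> c * esize x ^ e" using assms(1) unfolding poly_bounded_def by blast
  obtain d k where g: "\<And>x. g x \<le> d * esize x ^ k" using assms(2) unfolding poly_bounded_def by blast
  show ?thesis
  proof (rule poly_boundedI)
    fix x :: 'a
    have "f x * g x \<le> (c * esize x ^ e) * (d * esize x ^ k)" by (intro mult_mono f g) auto
    thus "f x * g x \<le> (c * d) * esize x ^ (e + k)" by (simp add: power_add mult_ac)
  qed
qed

lemma poly_bounded_power: "poly_bounded f \<Longrightarrow> poly_bounded (\<lambda>x. f x ^ k)"
  by (induction k) (auto intro: poly_bounded_const poly_bounded_mult)

lemma poly_bounded_comp:
  assumes "poly_bounded g" "poly_bounded (\<lambda>x. esize (f x))"
  shows "poly_bounded (\<lambda>x. g (f x))"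
proof -
  obtain c e where g: "\<And>x. g x \<le> c * esize x ^ e" using assms(1) unfolding poly_bounded_def by blast
  show ?thesis
    by (rule poly_bounded_mono[OF _ g]) (intro poly_bounded_mult poly_bounded_const poly_bounded_power assms)
qed

lemmas poly_bounded_intros =
  poly_bounded_const poly_bounded_esize poly_bounded_add poly_bounded_mult poly_bounded_power

text \<open>Correctness is required on every value of the type, which keeps the closure lemmas free
  of side conditions on the inputs.\<close>

definition ptime :: "('a::encodable \<Rightarrow> 'b::encodable) \<Rightarrow> bool" where
  "ptime f \<longleftrightarrow> (\<exists>p g. poly_bounded g \<and> (\<forall>x. \<exists>n\<le>g x. run p (enc x) n (enc (f x))))"

lemma ptimeI:
  assumes "poly_bounded g" "\<And>x. \<exists>n\<le>g x. run p (enc x) n (enc (f x))"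
  shows "ptime f"
  using assms unfolding ptime_def by blast

text \<open>Each step is charged the size of its tree, so the cost bounds the size of the output.
  Outputs are therefore polynomially large, which is what makes composition polynomial.\<close>

lemma run_size: "run p x n y \<Longrightarrow> tree_size y \<le> n"
proof (induction rule: run.induct)
  case (3 x) show ?case by (cases x) auto
next
  case (4 x) show ?case by (cases x) auto
next
  case (5 p x m y q n z) show ?case using 5 tree_size_pos[of x] by (simp del: tree_size_pos)
qed (auto simp: Suc_le_eq)

lemma ptime_esize:
  assumes "ptime f"
  shows "poly_bounded (\<lambda>x. esize (f x))"
proof -
  obtain p g where "poly_bounded g" "\<And>x. \<exists>n\<le>g x. run p (enc x) n (enc (f x))" using assms unfolding ptime_def by blast
  thus ?thesis using run_size unfolding esize_def by (meson order_trans poly_bounded_mono)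
qed

lemma ptime_retype:
  assumes "ptime f" "\<And>x. enc (g x) = enc (f x)"
  shows "ptime g"
  using assms unfolding ptime_def by simp

lemma ptime_id: "ptime (\<lambda>x. x)"
  by (rule ptimeI[OF poly_bounded_esize]) (auto simp: esize_def intro: run.intros)

lemma ptime_comp:
  assumes "ptime f" "ptime g"
  shows "ptime (\<lambda>x. g (f x))"
proof -
  obtain p G where G: "poly_bounded G" "\<And>x. \<exists>n\<le>G x. run p (enc x) n (enc (f x))" using assms(1) unfolding ptime_def by blast
  obtain q H where H: "poly_bounded H" "\<And>x. \<exists>n\<le>H x. run q (enc x) n (enc (g x))" using assms(2) unfolding ptime_def by blast
  show ?thesis
  proof (rule ptimeI)
    show "poly_bounded (\<lambda>x. G x + H (f x) + esize x)"
      by (intro poly_bounded_intros G poly_bounded_comp[OF H(1)] ptime_esize assms)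
    fix x
    obtain m n where "m \<le> G x" "run p (enc x) m (enc (f x))" "n \<le> H (f x)" "run q (enc (f x)) n (enc (g (f x)))"
      using G(2) H(2) by meson
    thus "\<exists>n\<le>G x + H (f x) + esize x. run (Seq p q) (enc x) n (enc (g (f x)))"
      by (intro exI[of _ "m + n + tree_size (enc x)"]) (auto simp: esize_def intro: run.intros)
  qed
qed

primrec const_prog :: "tree \<Rightarrow> prog" where
  "const_prog Leaf = Empty"
| "const_prog (Node a b) = Pair (const_prog a) (const_prog b)"

lemma run_const_prog: "run (const_prog t) x (tree_size t * tree_size x) t"
proof (induction t)
  case (Node a b)
  from run.intros(5)[OF Node] show ?case by (simp add: algebra_simps)
qed (simp add: run.intros)

lemma ptime_const: "ptime (\<lambda>x. c)"
proof (rule ptimeI)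
  show "poly_bounded (\<lambda>x. tree_size (enc c) * esize x)" by (intro poly_bounded_intros)
  show "\<exists>n\<le>tree_size (enc c) * esize x. run (const_prog (enc c)) (enc x) n (enc c)" for x :: 'a
    using run_const_prog by (auto simp: esize_def)
qed

lemma ptime_Pair:
  assumes "ptime f" "ptime g"
  shows "ptime (\<lambda>x. (f x, g x))"
proof -
  obtain p G where G: "poly_bounded G" "\<And>x. \<exists>n\<le>G x. run p (enc x) n (enc (f x))" using assms(1) unfolding ptime_def by blast
  obtain q H where H: "poly_bounded H" "\<And>x. \<exists>n\<le>H x. run q (enc x) n (enc (g x))" using assms(2) unfolding ptime_def by blast
  show ?thesis
  proof (rule ptimeI)
    show "poly_bounded (\<lambda>x. G x + H x + esize x)" by (intro poly_bounded_intros G H)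
    fix x
    obtain m n where "m \<le> G x" "run p (enc x) m (enc (f x))" "n \<le> H x" "run q (enc x) n (enc (g x))"
      using G(2) H(2) by meson
    thus "\<exists>n\<le>G x + H x + esize x. run (Pair p q) (enc x) n (enc (f x, g x))"
      by (intro exI[of _ "m + n + tree_size (enc x)"]) (auto simp: esize_def intro: run.intros)
  qed
qed

lemma ptime_Cons: "ptime f \<Longrightarrow> ptime g \<Longrightarrow> ptime (\<lambda>x. f x # g x)"
  by (rule ptime_retype[OF ptime_Pair[of f g]]) auto

lemma ptime_fst: "ptime f \<Longrightarrow> ptime (\<lambda>x. fst (f x))"
proof (erule ptime_comp, rule ptimeI[OF poly_bounded_esize])
  show "\<exists>n\<le>esize p. run Left (enc p) n (enc (fst p))" for p :: "'b \<times> 'c"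
    using run.intros(3)[of "enc p"] by (auto simp: esize_def enc_prod_def)
qed

lemma ptime_snd: "ptime f \<Longrightarrow> ptime (\<lambda>x. snd (f x))"
proof (erule ptime_comp, rule ptimeI[OF poly_bounded_esize])
  show "\<exists>n\<le>esize p. run Right (enc p) n (enc (snd p))" for p :: "'b \<times> 'c"
    using run.intros(4)[of "enc p"] by (auto simp: esize_def enc_prod_def)
qed

lemma ptime_tl: "ptime f \<Longrightarrow> ptime (\<lambda>x. tl (f x))"
proof (erule ptime_comp, rule ptimeI[OF poly_bounded_esize])
  show "\<exists>n\<le>esize xs. run Right (enc xs) n (enc (tl xs))" for xs :: "'b list"
    using run.intros(4)[of "enc xs"] by (cases xs) (auto simp: esize_def)
qed

lemma ptime_Suc: "ptime f \<Longrightarrow> ptime (\<lambda>x. Suc (f x))"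
  by (rule ptime_retype[OF ptime_Cons[OF ptime_const[of "()"], of "\<lambda>x. replicate (f x) ()"]])
     (auto simp: enc_units intro: ptime_retype)

lemma ptime_if:
  assumes "ptime b" "ptime f" "ptime g"
  shows "ptime (\<lambda>x. if b x then f x else g x)"
proof -
  obtain p G where G: "poly_bounded G" "\<And>x. \<exists>n\<le>G x. run p (enc (x :: 'a)) n (enc (f x))" using assms(2) unfolding ptime_def by blast
  obtain q H where H: "poly_bounded H" "\<And>x. \<exists>n\<le>H x. run q (enc (x :: 'a)) n (enc (g x))" using assms(3) unfolding ptime_def by blast
  \<comment> \<open>Paired with the input, the Boolean is the left component, and
    \<open>Right\<close> recovers the input. The test of \<open>Cond\<close> succeeds because
    \<open>True\<close> is encoded by a node and \<open>False\<close> by a leaf.\<close>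
  have *: "ptime (\<lambda>y. if fst y then f (snd y) else g (snd y))"
  proof (rule ptimeI)
    show "poly_bounded (\<lambda>y :: bool \<times> 'a. 3 * esize y + (G (snd y) + H (snd y)))"
      by (intro poly_bounded_intros poly_bounded_comp[OF G(1)] poly_bounded_comp[OF H(1)] ptime_esize ptime_snd ptime_id)
    fix y :: "bool \<times> 'a"
    obtain b x where y: "y = (b, x)" by (cases y)
    obtain m n where mn: "m \<le> G x" "run p (enc x) m (enc (f x))" "n \<le> H x" "run q (enc x) n (enc (g x))"
      using G(2) H(2) by meson
    have r: "run Right (enc y) (tree_size (enc y)) (enc x)" using run.intros(4)[of "enc y"] y by simp
    show "\<exists>n\<le>3 * esize y + (G (snd y) + H (snd y)). run (Cond (Seq Right p) (Seq Right q)) (enc y) n (enc (if fst y then f (snd y) else g (snd y)))"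
    proof (cases b)
      case True
      have "run (Cond (Seq Right p) (Seq Right q)) (enc y) (tree_size (enc y) + m + tree_size (enc y) + tree_size (enc y)) (enc (f x))"
        by (intro run.intros(7) run.intros(6)[OF r mn(2)]) (simp add: y True)
      thus ?thesis using mn True y by (intro exI conjI) (auto simp: esize_def)
    next
      case False
      have "run (Cond (Seq Right p) (Seq Right q)) (enc y) (tree_size (enc y) + n + tree_size (enc y) + tree_size (enc y)) (enc (g x))"
        by (intro run.intros(8) run.intros(6)[OF r mn(4)]) (simp add: y False)
      thus ?thesis using mn False y by (intro exI conjI) (auto simp: esize_def)
    qed
  qed
  show ?thesis using ptime_comp[OF ptime_Pair[OF assms(1) ptime_id] *] by (simp only: fst_conv snd_conv)
qed

lemma ptime_case_list:
  fixes l :: "'a::encodable \<Rightarrow> 'c::encodable list" and f :: "'a \<Rightarrow> 'b::encodable" and g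
  assumes "ptime l" "ptime f" "ptime (\<lambda>p. g (fst p) (fst (snd p)) (snd (snd p)))"
  shows "ptime (\<lambda>x. case l x of [] \<Rightarrow> f x | y # ys \<Rightarrow> g x y ys)"
proof -
  let ?g = "\<lambda>p. g (fst p) (fst (snd p)) (snd (snd p))"
  obtain p G where G: "poly_bounded G" "\<And>x. \<exists>n\<le>G x. run p (enc (x :: 'a)) n (enc (f x))" using assms(2) unfolding ptime_def by blast
  obtain q H where H: "poly_bounded H" "\<And>x. \<exists>n\<le>H x. run q (enc (x :: 'a \<times> 'c \<times> 'c list)) n (enc (?g x))" using assms(3) unfolding ptime_def by blast
  have *: "ptime (\<lambda>y. case fst y of [] \<Rightarrow> f (snd y) | z # zs \<Rightarrow> g (snd y) z zs)"
  proof (rule ptimeI)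
    have "poly_bounded (\<lambda>y :: 'c list \<times> 'a. case fst y of [] \<Rightarrow> 0 | z # zs \<Rightarrow> H (snd y, z, zs))"
    proof -
      obtain c e where H': "\<And>x. H x \<le> c * esize x ^ e" using H(1) unfolding poly_bounded_def by blast
      show ?thesis
      proof (rule poly_boundedI)
        fix y :: "'c list \<times> 'a"
        show "(case fst y of [] \<Rightarrow> 0 | z # zs \<Rightarrow> H (snd y, z, zs)) \<le> c * esize y ^ e"
        proof (cases "fst y")
          case (Cons z zs)
          hence "esize (snd y, z, zs) = esize y" by (cases y) simp
          thus ?thesis using Cons H'[of "(snd y, z, zs)"] by simp
        qed simp
      qed
    qed
    thus "poly_bounded (\<lambda>y :: 'c list \<times> 'a. 6 * esize y + (G (snd y) + (case fst y of [] \<Rightarrow> 0 | z # zs \<Rightarrow> H (snd y, z, zs))))"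
      by (intro poly_bounded_intros poly_bounded_comp[OF G(1)] ptime_esize ptime_snd ptime_id)
    fix y :: "'c list \<times> 'a"
    let ?s = "tree_size (enc y)"
    obtain l x where y: "y = (l, x)" by (cases y)
    have r: "run Right (enc y) ?s (enc x)" "run Left (enc y) ?s (enc l)"
      using run.intros(3,4)[of "enc y"] y by simp_all
    show "\<exists>n\<le>6 * esize y + (G (snd y) + (case fst y of [] \<Rightarrow> 0 | z # zs \<Rightarrow> H (snd y, z, zs))).
       run (Cond (Seq (Pair Right Left) q) (Seq Right p)) (enc y) n (enc (case fst y of [] \<Rightarrow> f (snd y) | z # zs \<Rightarrow> g (snd y) z zs))"
    proof (cases l)
      case Nil
      obtain m where m: "m \<le> G x" "run p (enc x) m (enc (f x))" using G(2) by meson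
      have "run (Cond (Seq (Pair Right Left) q) (Seq Right p)) (enc y) (?s + m + ?s + ?s) (enc (f x))"
        by (intro run.intros(8) run.intros(6)[OF r(1) m(2)]) (simp add: y Nil)
      thus ?thesis using m Nil y by (intro exI conjI) (auto simp: esize_def)
    next
      case (Cons z zs)
      obtain n where n: "n \<le> H (x, z, zs)" "run q (enc (x, z, zs)) n (enc (g x z zs))" using H(2)[of "(x, z, zs)"] by auto
      \<comment> \<open>Swapping the components of \<open>(z # zs, x)\<close> yields literally the
        tree of \<open>(x, z, zs)\<close>, because a nonempty list is encoded like a pair.\<close>
      have "run (Pair Right Left) (enc y) (?s + ?s + ?s) (enc (x, z, zs))"
        using run.intros(5)[OF r] Cons by simp
      from run.intros(6)[OF this n(2)]
      have "run (Cond (Seq (Pair Right Left) q) (Seq Right p)) (enc y) (?s + ?s + ?s + n + ?s + ?s) (enc (g x z zs))"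
        by (intro run.intros(7)) (simp_all add: y Cons)
      thus ?thesis using n Cons y by (intro exI conjI) (auto simp: esize_def)
    qed
  qed
  show ?thesis using ptime_comp[OF ptime_Pair[OF assms(1) ptime_id] *] by (simp only: fst_conv snd_conv)
qed

text \<open>The loop state holds the remaining list, the environment \<open>e\<close> and the
  accumulator; \<open>While\<close> stops when the list, its left component, is a leaf.
  \<open>B\<close> bounds the cost of one pass and \<open>S\<close> the size of every state.\<close>

lemma run_While_fold:
  assumes body: "\<And>y ys pre. xs = pre @ y # ys \<Longrightarrow>
      \<exists>n\<le>B. run p (Node (enc (y # ys)) (Node e (enc (fold g pre a)))) n (Node (enc ys) (Node e (enc (g y (fold g pre a)))))"
    and size: "\<And>ys pre. xs = pre @ ys \<Longrightarrow> tree_size (Node (enc ys) (Node e (enc (fold g pre a)))) \<le> S"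
  shows "xs = pre @ ys \<Longrightarrow> \<exists>n\<le>length ys * (B + S) + S.
    run (While p) (Node (enc ys) (Node e (enc (fold g pre a)))) n (Node Leaf (Node e (enc (fold g xs a))))"
proof (induction ys arbitrary: pre)
  case Nil
  thus ?case using size[of pre "[]"] run.intros(10)[of "Node (enc []) (Node e (enc (fold g pre a)))" p] by auto
next
  case (Cons y ys)
  obtain m where m: "m \<le> B" "run p (Node (enc (y # ys)) (Node e (enc (fold g pre a)))) m (Node (enc ys) (Node e (enc (g y (fold g pre a)))))"
    using body[OF Cons.prems] by blast
  have "fold g (pre @ [y]) a = g y (fold g pre a)" by simp
  with Cons.IH[of "pre @ [y]"] Cons.prems obtain n where n: "n \<le> length ys * (B + S) + S"
    "run (While p) (Node (enc ys) (Node e (enc (g y (fold g pre a))))) n (Node Leaf (Node e (enc (fold g xs a))))"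
    by auto
  have "run (While p) (Node (enc (y # ys)) (Node e (enc (fold g pre a)))) (m + n + tree_size (Node (enc (y # ys)) (Node e (enc (fold g pre a)))))
    (Node Leaf (Node e (enc (fold g xs a))))"
    by (rule run.intros(9)[OF _ m(2) n(2)]) simp
  moreover have "m + n + tree_size (Node (enc (y # ys)) (Node e (enc (fold g pre a)))) \<le> length (y # ys) * (B + S) + S"
    using m(1) n(1) size[OF Cons.prems] by simp
  ultimately show ?case by blast
qed

text \<open>Iterating a polynomial-time step can make the accumulator grow exponentially. Hence the
  explicit bound \<open>bd\<close> on every intermediate accumulator, which has to be supplied at
  each use.\<close>

lemma ptime_fold:
  fixes g :: "'e::encodable \<Rightarrow> 'x::encodable \<Rightarrow> 'a::encodable \<Rightarrow> 'a"
    and xs :: "'e \<Rightarrow> 'x list" and a :: "'e \<Rightarrow> 'a" and bd :: "'e \<Rightarrow> nat"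
  assumes xs: "ptime xs" and a: "ptime a" and g: "ptime (\<lambda>p. g (fst p) (fst (snd p)) (snd (snd p)))"
    and bd: "poly_bounded bd" "\<And>e pre ys. xs e = pre @ ys \<Longrightarrow> esize (fold (g e) pre (a e)) \<le> bd e"
  shows "ptime (\<lambda>e. fold (g e) (xs e) (a e))"
proof -
  let ?g = "\<lambda>p. g (fst p) (fst (snd p)) (snd (snd p))"
  obtain px Gx where Gx: "poly_bounded Gx" "\<And>x. \<exists>n\<le>Gx x. run px (enc x) n (enc (xs x))" using xs unfolding ptime_def by blast
  obtain pa Ga where Ga: "poly_bounded Ga" "\<And>x. \<exists>n\<le>Ga x. run pa (enc x) n (enc (a x))" using a unfolding ptime_def by blast
  obtain q H where H: "poly_bounded H" "\<And>p. \<exists>n\<le>H p. run q (enc p) n (enc (?g p))" using g unfolding ptime_def by blast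
  obtain c k where ck: "\<And>p. H p \<le> c * esize p ^ k" using H(1) unfolding poly_bounded_def by blast
  define S where "S e = esize (xs e) + esize e + bd e + 2" for e :: 'e
  define B where "B e = 24 * S e + c * S e ^ k" for e :: 'e
  have S: "poly_bounded S" unfolding S_def[abs_def]
    by (intro poly_bounded_intros bd(1) ptime_esize xs)
  have B: "poly_bounded B" unfolding B_def[abs_def] by (intro poly_bounded_intros S)
  have len: "poly_bounded (\<lambda>e. length (xs e))"
    by (rule poly_bounded_mono[OF ptime_esize[OF xs] length_le_esize])
  \<comment> \<open>One pass of the loop takes the list \<open>y # ys\<close>, the environment
    \<open>e\<close> and the accumulator \<open>v\<close> to \<open>ys\<close>, \<open>e\<close> and
    \<open>g e y v\<close>.\<close>
  define body where "body = Pair (Seq Left Right) (Pair (Seq Right Left)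
     (Seq (Pair (Seq Right Left) (Pair (Seq Left Left) (Seq Right Right))) q))"
  show ?thesis
  proof (rule ptimeI)
    show "poly_bounded (\<lambda>e. Gx e + Ga e + 8 * S e + (length (xs e) * (B e + S e) + S e))"
      by (intro poly_bounded_intros Gx Ga S B len)
    fix e :: 'e
    define st where "st ys v = Node (enc ys) (Node (enc e) (enc v))" for ys :: "'x list" and v :: 'a
    have size: "tree_size (st ys (fold (g e) pre (a e))) \<le> S e" if "xs e = pre @ ys" for ys pre
      using bd(2)[OF that] esize_append_ge(2)[of ys pre] that
      by (simp add: st_def S_def esize_def)
    have step: "\<exists>n\<le>B e. run body (st (y # ys) (fold (g e) pre (a e))) n (st ys (g e y (fold (g e) pre (a e))))"
      if "xs e = pre @ y # ys" for y ys pre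
    proof -
      define v where "v = fold (g e) pre (a e)"
      define s where "s = st (y # ys) v"
      define z where "z = tree_size s"
      have zS: "z \<le> S e" unfolding z_def s_def v_def by (rule size[OF that])
      have sl: "left s = Node (enc y) (enc ys)" "right s = Node (enc e) (enc v)" by (simp_all add: s_def st_def)
      have L: "run Left s z (left s)" and R: "run Right s z (right s)" unfolding z_def by (rule run.intros)+
      have lz: "tree_size (left s) \<le> z" "tree_size (right s) \<le> z"
        unfolding z_def s_def st_def by auto
      have LR: "run (Seq Left Right) s (z + tree_size (left s) + z) (enc ys)"
        using run.intros(6)[OF L run.intros(4)[of "left s"]] by (simp add: sl z_def)
      have LL: "run (Seq Left Left) s (z + tree_size (left s) + z) (enc y)"
        using run.intros(6)[OF L run.intros(3)[of "left s"]] by (simp add: sl z_def)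
      have RL: "run (Seq Right Left) s (z + tree_size (right s) + z) (enc e)"
        using run.intros(6)[OF R run.intros(3)[of "right s"]] by (simp add: sl z_def)
      have RR: "run (Seq Right Right) s (z + tree_size (right s) + z) (enc v)"
        using run.intros(6)[OF R run.intros(4)[of "right s"]] by (simp add: sl z_def)
      obtain n where n: "n \<le> H (e, y, v)" "run q (enc (e, y, v)) n (enc (g e y v))" using H(2)[of "(e, y, v)"] by auto
      have "esize (e, y, v) \<le> z" by (simp add: z_def s_def st_def esize_def)
      hence "c * esize (e, y, v) ^ k \<le> c * S e ^ k" using zS by (intro mult_left_mono power_mono) auto
      hence nB: "n \<le> c * S e ^ k" using n(1) ck[of "(e, y, v)"] by linarith
      from run.intros(5)[OF LR run.intros(5)[OF RL run.intros(6)[OF run.intros(5)[OF RL run.intros(5)[OF LL RR]] n(2)[simplified]]]]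
      obtain m where m: "run body s m (st ys (g e y v))" "m \<le> 24 * z + n"
        unfolding body_def st_def using lz by (auto simp: z_def)
      show ?thesis using m zS nB unfolding B_def v_def s_def by (intro exI[of _ m]) auto
    qed
    from run_While_fold[of "xs e" "B e" body "enc e" "g e" "a e" "S e", OF step[unfolded st_def] size[unfolded st_def], of "[]" "xs e"]
    obtain n where n: "n \<le> length (xs e) * (B e + S e) + S e"
      "run (While body) (st (xs e) (a e)) n (st [] (fold (g e) (xs e) (a e)))"
      by (auto simp: st_def)
    obtain m1 m2 where m: "m1 \<le> Gx e" "run px (enc e) m1 (enc (xs e))" "m2 \<le> Ga e" "run pa (enc e) m2 (enc (a e))"
      using Gx(2) Ga(2) by meson
    define f where "f = st [] (fold (g e) (xs e) (a e))"
    define z where "z = tree_size (enc e)"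
    have zS: "z \<le> S e" by (simp add: z_def S_def esize_def)
    have fS: "tree_size f \<le> S e" unfolding f_def using size[of "xs e" "[]"] by simp
    have sS: "tree_size (st (xs e) (a e)) \<le> S e" using size[of "[]" "xs e"] by simp
    have 1: "run (Pair px (Pair Ident pa)) (enc e) (m1 + (z + m2 + z) + z) (st (xs e) (a e))"
      unfolding st_def z_def by (intro run.intros m)
    have 2: "run (Seq Right Right) f (tree_size f + tree_size (right f) + tree_size f) (enc (fold (g e) (xs e) (a e)))"
      using run.intros(6)[OF run.intros(4)[of f] run.intros(4)[of "right f"]] by (simp add: f_def st_def)
    from run.intros(6)[OF 1 run.intros(6)[OF n(2)[folded f_def] 2]]
    have "run (Seq (Pair px (Pair Ident pa)) (Seq (While body) (Seq Right Right))) (enc e)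
       (m1 + (z + m2 + z) + z + (n + (tree_size f + tree_size (right f) + tree_size f) + tree_size (st (xs e) (a e))) + z)
       (enc (fold (g e) (xs e) (a e)))"
      unfolding z_def .
    moreover have "tree_size (right f) \<le> tree_size f" by (simp add: f_def st_def)
    ultimately show "\<exists>n\<le>Gx e + Ga e + 8 * S e + (length (xs e) * (B e + S e) + S e).
       run (Seq (Pair px (Pair Ident pa)) (Seq (While body) (Seq Right Right))) (enc e) n (enc (fold (g e) (xs e) (a e)))"
      using m n(1) zS fS sS by (intro exI conjI) (auto simp: z_def)
  qed
qed

section \<open>Programs for lists and for unary arithmetic\<close>

lemmas ptime_basic = ptime_const ptime_id ptime_Pair ptime_Cons ptime_fst ptime_snd ptime_Suc ptime_if

lemma ptime_rev:
  fixes f :: "_ \<Rightarrow> 'b::encodable list"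
  assumes "ptime f"
  shows "ptime (\<lambda>x. rev (f x))"
proof -
  have rev: "fold (\<lambda>x acc. x # acc) xs [] = rev xs" for xs :: "'b list"
    by (induction xs rule: rev_induct) auto
  have "ptime (\<lambda>e. fold (\<lambda>x acc. x # acc) (f e) [])"
  proof (rule ptime_fold[OF assms ptime_const])
    show "ptime (\<lambda>p :: _ \<times> 'b \<times> 'b list. fst (snd p) # snd (snd p))"
      by (intro ptime_basic)
    show "poly_bounded (\<lambda>e. esize (f e))" by (rule ptime_esize[OF assms])
    show "esize (fold (\<lambda>x acc. x # acc) pre []) \<le> esize (f e)" if "f e = pre @ ys" for e pre ys
      using that esize_append_ge(1)[of pre ys] by (simp add: rev esize_rev)
  qed
  thus ?thesis by (simp add: rev)
qed

lemma ptime_map: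
  fixes xs :: "'e::encodable \<Rightarrow> 'x::encodable list" and g :: "'e \<Rightarrow> 'x \<Rightarrow> 'b::encodable"
  assumes xs: "ptime xs" and g: "ptime (\<lambda>p. g (fst p) (snd p))"
  shows "ptime (\<lambda>e. map (g e) (xs e))"
proof -
  have eq: "fold (\<lambda>x acc. g e x # acc) ys [] = rev (map (g e) ys)" for e ys
    by (induction ys rule: rev_induct) auto
  obtain c k where ck: "\<And>p. esize (g (fst p) (snd p)) \<le> c * esize p ^ k"
    using ptime_esize[OF g] unfolding poly_bounded_def by blast
  have "ptime (\<lambda>e. fold (\<lambda>x acc. g e x # acc) (xs e) [])"
  proof (rule ptime_fold[OF xs ptime_const])
    show "ptime (\<lambda>p :: 'e \<times> 'x \<times> 'b list. g (fst p) (fst (snd p)) # snd (snd p))"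
      using ptime_comp[OF ptime_Pair[OF ptime_fst[OF ptime_id] ptime_fst[OF ptime_snd[OF ptime_id]]] g]
      by (intro ptime_basic) simp
    show "poly_bounded (\<lambda>e. esize (xs e) * (c * (esize e + esize (xs e) + 1) ^ k + 1) + 1)"
      by (intro poly_bounded_intros ptime_esize xs)
    fix e pre ys assume e: "xs e = pre @ ys"
    have "esize (g e x) \<le> c * (esize e + esize (xs e) + 1) ^ k" if "x \<in> set pre" for x
    proof -
      have "esize x \<le> esize (xs e)" using that e by (intro esize_mem_le) auto
      hence "c * esize (e, x) ^ k \<le> c * (esize e + esize (xs e) + 1) ^ k"
        by (intro mult_left_mono power_mono) auto
      with ck[of "(e, x)"] show ?thesis unfolding fst_conv snd_conv by (rule order_trans)
    qed
    hence "esize (map (g e) pre) \<le> length pre * (c * (esize e + esize (xs e) + 1) ^ k + 1) + 1"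
      using esize_list_le[of "map (g e) pre" "c * (esize e + esize (xs e) + 1) ^ k"] by auto
    also have "\<dots> \<le> esize (xs e) * (c * (esize e + esize (xs e) + 1) ^ k + 1) + 1"
      using length_le_esize[of "xs e"] e by (intro add_mono mult_right_mono) auto
    finally show "esize (fold (\<lambda>x acc. g e x # acc) pre []) \<le> esize (xs e) * (c * (esize e + esize (xs e) + 1) ^ k + 1) + 1"
      by (simp add: eq esize_rev)
  qed
  from ptime_rev[OF this] show ?thesis by (simp add: eq)
qed

lemma esize_filter: "esize (filter P xs) \<le> esize xs"
  by (induction xs) auto

lemma ptime_filter:
  fixes xs :: "'e::encodable \<Rightarrow> 'x::encodable list" and P :: "'e \<Rightarrow> 'x \<Rightarrow> bool"
  assumes xs: "ptime xs" and P: "ptime (\<lambda>p. P (fst p) (snd p))"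
  shows "ptime (\<lambda>e. filter (P e) (xs e))"
proof -
  have eq: "fold (\<lambda>x acc. if P e x then x # acc else acc) ys [] = rev (filter (P e) ys)" for e ys
    by (induction ys rule: rev_induct) auto
  have "ptime (\<lambda>e. fold (\<lambda>x acc. if P e x then x # acc else acc) (xs e) [])"
  proof (rule ptime_fold[OF xs ptime_const])
    show "ptime (\<lambda>p :: 'e \<times> 'x \<times> 'x list. if P (fst p) (fst (snd p)) then fst (snd p) # snd (snd p) else snd (snd p))"
      using ptime_comp[OF ptime_Pair[OF ptime_fst[OF ptime_id] ptime_fst[OF ptime_snd[OF ptime_id]]] P]
      by (intro ptime_basic) simp
    show "poly_bounded (\<lambda>e. esize (xs e))" by (rule ptime_esize[OF xs])
    show "esize (fold (\<lambda>x acc. if P e x then x # acc else acc) pre []) \<le> esize (xs e)" if "xs e = pre @ ys" for e pre ys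
      using that esize_append_ge(1)[of pre ys] esize_filter[of "P e" pre] unfolding eq esize_rev by simp
  qed
  from ptime_rev[OF this] show ?thesis by (simp add: eq)
qed

lemma ptime_append:
  fixes f g :: "_ \<Rightarrow> 'b::encodable list"
  assumes f: "ptime f" and g: "ptime g"
  shows "ptime (\<lambda>x. f x @ g x)"
proof -
  have eq: "fold (\<lambda>x acc. x # acc) (rev xs) zs = xs @ zs" for xs zs :: "'b list"
    by (induction xs arbitrary: zs) auto
  have "ptime (\<lambda>e. fold (\<lambda>x acc. x # acc) (rev (f e)) (g e))"
  proof (rule ptime_fold[OF ptime_rev[OF f] g])
    show "ptime (\<lambda>p :: _ \<times> 'b \<times> 'b list. fst (snd p) # snd (snd p))"
      by (intro ptime_basic)
    show "poly_bounded (\<lambda>e. esize (f e) + esize (g e))" by (intro poly_bounded_intros ptime_esize f g)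
    show "esize (fold (\<lambda>x acc. x # acc) pre (g e)) \<le> esize (f e) + esize (g e)" if "rev (f e) = pre @ ys" for e pre ys
    proof -
      have "fold (\<lambda>x acc. x # acc) pre (g e) = rev pre @ g e" using eq[of "rev pre" "g e"] by simp
      moreover have "esize pre \<le> esize (f e)" using that esize_append_ge(1)[of pre ys] esize_rev[of "f e"] by simp
      ultimately show ?thesis using esize_append[of "rev pre" "g e"] esize_rev[of pre] by simp
    qed
  qed
  thus ?thesis by (simp add: eq)
qed

lemma esize_concat: "esize (concat xss) \<le> esize xss"
proof (induction xss)
  case (Cons xs xss)
  thus ?case using esize_append[of xs "concat xss"] by simp
qed simp

lemma ptime_concat:
  fixes f :: "_ \<Rightarrow> 'b::encodable list list"
  assumes f: "ptime f"
  shows "ptime (\<lambda>x. concat (f x))"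
proof -
  have eq: "fold (\<lambda>xs acc. acc @ xs) xss [] = concat xss" for xss :: "'b list list"
    by (induction xss rule: rev_induct) auto
  have "ptime (\<lambda>e. fold (\<lambda>xs acc. acc @ xs) (f e) [])"
  proof (rule ptime_fold[OF f ptime_const])
    show "ptime (\<lambda>p :: _ \<times> 'b list \<times> 'b list. snd (snd p) @ fst (snd p))"
      by (intro ptime_basic ptime_append)
    show "poly_bounded (\<lambda>e. esize (f e))" by (rule ptime_esize[OF f])
    show "esize (fold (\<lambda>xs acc. acc @ xs) pre []) \<le> esize (f e)" if "f e = pre @ ys" for e pre ys
      using that esize_append_ge(1)[of pre ys] esize_concat[of pre] unfolding eq by simp
  qed
  thus ?thesis by (simp add: eq)
qed

lemma ptime_units: "ptime f \<Longrightarrow> ptime (\<lambda>x. replicate (f x) ())"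
  by (erule ptime_retype) (simp add: enc_units)

lemma ptime_of_units: "ptime f \<Longrightarrow> ptime (\<lambda>x. length (f x))" for f :: "_ \<Rightarrow> unit list"
proof (erule ptime_retype)
  show "enc (length (f x)) = enc (f x)" for x
    using enc_units[of "length (f x)"] by (metis replicate_length_same old.unit.exhaust)
qed

lemma ptime_length:
  assumes "ptime f"
  shows "ptime (\<lambda>x. length (f x))"
proof -
  have "ptime (\<lambda>x. length (map (\<lambda>_. ()) (f x)))"
    by (intro ptime_of_units ptime_map[where g = "\<lambda>_ _. ()"] assms ptime_const)
  thus ?thesis by simp
qed

lemma ptime_add: "ptime f \<Longrightarrow> ptime g \<Longrightarrow> ptime (\<lambda>x. f x + g x)" for f g :: "_ \<Rightarrow> nat"
  using ptime_of_units[OF ptime_append[OF ptime_units ptime_units], of f g] by simp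

lemma ptime_mult:
  fixes f g :: "_ \<Rightarrow> nat"
  assumes "ptime f" "ptime g"
  shows "ptime (\<lambda>x. f x * g x)"
proof -
  have "ptime (\<lambda>x. length (concat (map (\<lambda>_. replicate (g x) ()) (replicate (f x) ()))))"
    by (intro ptime_of_units ptime_concat ptime_map[where g = "\<lambda>x _. replicate (g x) ()"] ptime_units assms
        ptime_comp[OF ptime_fst[OF ptime_id] assms(2)])
  thus ?thesis by (simp add: length_concat sum_list_replicate)
qed

lemma ptime_drop:
  fixes f :: "_ \<Rightarrow> nat" and xs :: "_ \<Rightarrow> 'b::encodable list"
  assumes f: "ptime f" and xs: "ptime xs"
  shows "ptime (\<lambda>x. drop (f x) (xs x))"
proof -
  have eq: "fold (\<lambda>_. tl) us ys = drop (length us) ys" for us :: "unit list" and ys :: "'b list"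
    by (induction us arbitrary: ys) (auto simp: drop_Suc)
  have "ptime (\<lambda>e. fold (\<lambda>_ ys. tl ys) (replicate (f e) ()) (xs e))"
  proof (rule ptime_fold[OF ptime_units[OF f] xs])
    show "ptime (\<lambda>p :: _ \<times> unit \<times> 'b list. tl (snd (snd p)))"
      by (intro ptime_basic ptime_tl)
    show "poly_bounded (\<lambda>e. esize (xs e))" by (rule ptime_esize[OF xs])
    show "esize (fold (\<lambda>_ ys. tl ys) pre (xs e)) \<le> esize (xs e)" for e and pre :: "unit list"
      using esize_append_ge(2)[of "drop (length pre) (xs e)" "take (length pre) (xs e)"] by (simp add: eq)
  qed
  thus ?thesis unfolding eq by simp
qed

lemma ptime_minus: "ptime f \<Longrightarrow> ptime g \<Longrightarrow> ptime (\<lambda>x. f x - g x)" for f g :: "_ \<Rightarrow> nat"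
  using ptime_of_units[OF ptime_drop[OF _ ptime_units], of g f] by simp

lemma ptime_upt:
  assumes f: "ptime f"
  shows "ptime (\<lambda>x. [0..<f x])"
proof -
  let ?g = "\<lambda>(_ :: unit) acc. case acc of [] \<Rightarrow> [0] | y # ys \<Rightarrow> Suc y # y # ys"
  have eq: "fold ?g us [] = rev [0..<length us]" for us
  proof (induction us rule: rev_induct)
    case (snoc u us)
    show ?case using snoc by (cases "length us") auto
  qed simp
  have "ptime (\<lambda>e. fold ?g (replicate (f e) ()) [])"
  proof (rule ptime_fold[OF ptime_units[OF f] ptime_const])
    show "ptime (\<lambda>p :: _ \<times> unit \<times> nat list. ?g (fst (snd p)) (snd (snd p)))"
      by (intro ptime_basic ptime_case_list)
    show "poly_bounded (\<lambda>e. esize (f e) * (2 * esize (f e) + 2) + 1)"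
      by (intro poly_bounded_intros ptime_esize f)
    show "esize (fold ?g pre []) \<le> esize (f e) * (2 * esize (f e) + 2) + 1" if "replicate (f e) () = pre @ ys" for e pre ys
    proof -
      have "length (replicate (f e) ()) = length (pre @ ys)" using that by simp
      hence len: "length pre \<le> f e" by simp
      have "esize [0..<length pre] \<le> length [0..<length pre] * (2 * length pre + 1 + 1) + 1"
        by (rule esize_list_le) (auto simp: esize_nat)
      also have "\<dots> \<le> esize (f e) * (2 * esize (f e) + 2) + 1"
        using len by (intro add_mono mult_mono) (auto simp: esize_nat)
      finally show ?thesis unfolding eq esize_rev .
    qed
  qed
  from ptime_rev[OF this] show ?thesis unfolding eq by simp
qed

lemma ptime_less:
  fixes f g :: "_ \<Rightarrow> nat"
  assumes "ptime f" "ptime g"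
  shows "ptime (\<lambda>x. f x < g x)"
proof -
  have "ptime (\<lambda>x. case replicate (g x - f x) () of [] \<Rightarrow> False | y # ys \<Rightarrow> True)"
    by (intro ptime_case_list ptime_units ptime_minus ptime_const assms)
  moreover have "(case replicate (g x - f x) () of [] \<Rightarrow> False | y # ys \<Rightarrow> True) = (f x < g x)" for x
    by (cases "g x - f x") auto
  ultimately show ?thesis by simp
qed

lemma ptime_not: "ptime b \<Longrightarrow> ptime (\<lambda>x. \<not> b x)"
  by (rule ptime_retype[OF ptime_if[OF _ ptime_const[of False] ptime_const[of True], of b]]) auto

lemma ptime_conj: "ptime a \<Longrightarrow> ptime b \<Longrightarrow> ptime (\<lambda>x. a x \<and> b x)"
  by (rule ptime_retype[OF ptime_if[OF _ _ ptime_const[of False], of a b]]) auto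

lemma ptime_disj: "ptime a \<Longrightarrow> ptime b \<Longrightarrow> ptime (\<lambda>x. a x \<or> b x)"
  using ptime_not[OF ptime_conj[OF ptime_not ptime_not], of a b] by simp

lemma ptime_le: "ptime f \<Longrightarrow> ptime g \<Longrightarrow> ptime (\<lambda>x. f x \<le> g x)" for f g :: "_ \<Rightarrow> nat"
  using ptime_not[OF ptime_less[of g f]] by (simp add: not_less)

lemma ptime_eq: "ptime f \<Longrightarrow> ptime g \<Longrightarrow> ptime (\<lambda>x. f x = g x)" for f g :: "_ \<Rightarrow> nat"
  using ptime_conj[OF ptime_le ptime_le, of f g g f] by (simp add: eq_iff)

text \<open>List access made total, so that it is computed by a program on every input.\<close>

definition nth_or :: "'a \<Rightarrow> 'a list \<Rightarrow> nat \<Rightarrow> 'a" where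
  "nth_or d xs i = (if i < length xs then xs ! i else d)"

lemma nth_or_nth [simp]: "i < length xs \<Longrightarrow> nth_or d xs i = xs ! i"
  by (simp add: nth_or_def)

lemma ptime_nth_or:
  assumes "ptime d" "ptime xs" "ptime i"
  shows "ptime (\<lambda>x. nth_or (d x) (xs x) (i x))"
proof -
  have "ptime (\<lambda>x. case drop (i x) (xs x) of [] \<Rightarrow> d x | y # ys \<Rightarrow> y)"
    by (intro ptime_case_list ptime_drop ptime_basic assms)
  moreover have "(case drop j ys of [] \<Rightarrow> z | y # _ \<Rightarrow> y) = nth_or z ys j" for j z and ys :: "'b list"
    by (cases "j < length ys") (auto simp: nth_or_def Cons_nth_drop_Suc[symmetric])
  ultimately show ?thesis by simp
qed

text \<open>Counts up to \<open>f x\<close> with a carry at \<open>g x\<close>. For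
  \<open>g x = 0\<close> the carry never occurs, which agrees with the HOL conventions for division
  by zero.\<close>

lemma ptime_div_mod:
  fixes f g :: "_ \<Rightarrow> nat"
  assumes f: "ptime f" and g: "ptime g"
  shows "ptime (\<lambda>x. (f x div g x, f x mod g x))"
proof -
  let ?h = "\<lambda>r (_ :: unit) p. if Suc (snd p) = r then (Suc (fst p), 0) else (fst p, Suc (snd p))"
  have eq: "fold (?h r) us (0, 0) = (length us div r, length us mod r)" for r us
    by (induction us rule: rev_induct) (auto simp: div_Suc mod_Suc)
  have "ptime (\<lambda>e. fold (?h (g e)) (replicate (f e) ()) (0, 0))"
  proof (rule ptime_fold[OF ptime_units[OF f] ptime_const])
    show "ptime (\<lambda>p :: _ \<times> unit \<times> nat \<times> nat. ?h (g (fst p)) (fst (snd p)) (snd (snd p)))"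
      by (intro ptime_basic ptime_eq ptime_comp[OF ptime_fst[OF ptime_id] g])
    show "poly_bounded (\<lambda>e. 4 * esize (f e) + 4)"
      by (intro poly_bounded_intros ptime_esize f)
    show "esize (fold (?h (g e)) pre (0, 0)) \<le> 4 * esize (f e) + 4" if "replicate (f e) () = pre @ ys" for e pre ys
    proof -
      have "length (replicate (f e) ()) = length (pre @ ys)" using that by simp
      hence len: "length pre \<le> f e" by simp
      have "length pre div g e \<le> length pre" "length pre mod g e \<le> length pre" by auto
      hence "2 * (length pre div g e) + 2 * (length pre mod g e) \<le> 4 * f e" using len by linarith
      thus ?thesis unfolding eq by (simp add: esize_nat)
    qed
  qed
  thus ?thesis unfolding eq by simp
qed

lemma ptime_div: "ptime f \<Longrightarrow> ptime g \<Longrightarrow> ptime (\<lambda>x. f x div g x)" for f g :: "_ \<Rightarrow> nat"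
  using ptime_fst[OF ptime_div_mod] by simp

lemma ptime_mod: "ptime f \<Longrightarrow> ptime g \<Longrightarrow> ptime (\<lambda>x. f x mod g x)" for f g :: "_ \<Rightarrow> nat"
  using ptime_snd[OF ptime_div_mod] by simp

text \<open>A list that does not depend on the input is unrolled, so each element may have a program
  of its own. Templates and the rows of truth tables are handled in this way.\<close>

lemma ptime_map_const:
  assumes "\<And>c. c \<in> set cs \<Longrightarrow> ptime (f c)"
  shows "ptime (\<lambda>x. map (\<lambda>c. f c x) cs)"
  using assms by (induction cs) (auto intro: ptime_const ptime_Cons)

lemma ptime_ball_const:
  assumes "\<And>c. c \<in> set cs \<Longrightarrow> ptime (f c)"
  shows "ptime (\<lambda>x. \<forall>c\<in>set cs. f c x)"
  using assms by (induction cs) (auto intro: ptime_const ptime_conj)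

lemmas ptime_intros = ptime_basic ptime_append ptime_concat ptime_length ptime_add ptime_mult ptime_minus ptime_upt
  ptime_less ptime_not ptime_conj ptime_disj ptime_le ptime_eq ptime_nth_or ptime_div ptime_mod ptime_units

section \<open>Replacing vertices by tori\<close>

text \<open>The ceiling of the square root, as the number of \<open>r\<close> with
  \<open>r * r < d\<close>; in this form a filter computes it.\<close>

definition csq :: "nat \<Rightarrow> nat" where
  "csq d = length (filter (\<lambda>r. r * r < d) [0..<d])"

lemma csq_card: "csq d = card {r. r * r < d}"
proof -
  have "{r. r * r < d} = set (filter (\<lambda>r. r * r < d) [0..<d])"
    by (auto intro: le_less_trans[OF le_square])
  thus ?thesis unfolding csq_def by (simp only: distinct_card distinct_filter distinct_upt)
qed

lemma csq_char: "r * r < d \<longleftrightarrow> r < csq d"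
proof -
  have fin: "finite {r. r * r < d}"
    by (rule finite_subset[of _ "{..<d}"]) (auto intro: le_less_trans[OF le_square])
  show ?thesis
  proof
    assume "r * r < d"
    hence "{..r} \<subseteq> {r. r * r < d}" by (auto intro: le_less_trans[OF mult_le_mono])
    from card_mono[OF fin this] show "r < csq d" by (simp add: csq_card)
  next
    assume r: "r < csq d"
    show "r * r < d"
    proof (rule ccontr)
      assume "\<not> r * r < d"
      hence "{r. r * r < d} \<subseteq> {..<r}"
        by (auto simp: not_less) (metis mult_le_mono not_le order_trans)
      from card_mono[OF _ this] r show False by (simp add: csq_card)
    qed
  qed
qed

lemma csq_ge: "d \<le> csq d * csq d"
  using csq_char[of "csq d" d] by simp

lemma csq_le: "csq d * csq d \<le> 4 * d"
proof (cases "csq d")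
  case (Suc r)
  hence r: "r * r < d" using csq_char[of r d] by simp
  have "csq d * csq d = r * r + 2 * r + 1" using Suc by simp
  also have "2 * r \<le> r * r + 1"
    by (cases r; cases "r - 1") (auto simp: algebra_simps)
  finally show ?thesis using r by simp
qed simp

section \<open>The points of the new graph and its seventeen labels\<close>

definition incident :: "(nat \<times> nat) list \<Rightarrow> nat \<Rightarrow> nat list" where
  "incident P v = filter (\<lambda>j. fst (nth_or (0, 0) P j) = v \<or> snd (nth_or (0, 0) P j) = v) [0..<length P]"

text \<open>A cell \<open>(v, i, r, h)\<close> is point \<open>i\<close> of the \<open>r \<times> r\<close> torus that replaces vertex \<open>v\<close>. It carries
  an end of edge \<open>j\<close> if \<open>h = Suc j\<close>, and it is padding if \<open>h = 0\<close>.\<close>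

type_synonym cell = "nat \<times> nat \<times> nat \<times> nat"

definition cloud :: "(nat \<times> nat) list \<Rightarrow> nat \<Rightarrow> cell list" where
  "cloud P v = map (\<lambda>i. (v, i, csq (length (incident P v)),
      if i < length (incident P v) then Suc (nth_or 0 (incident P v) i) else 0))
    [0..<csq (length (incident P v)) * csq (length (incident P v))]"

definition clouds :: "nat \<Rightarrow> (nat \<times> nat) list \<Rightarrow> cell list" where
  "clouds nv P = concat (map (cloud P) [0..<nv])"

text \<open>The filler cells are one-point tori of the fictitious vertex \<open>nv\<close>. They
  round the number of points up to a square, as the global torus requires.\<close>

definition cells :: "nat \<Rightarrow> (nat \<times> nat) list \<Rightarrow> cell list" where
  "cells nv P = clouds nv P @ map (\<lambda>_. (nv, 0, 1, 0))
     [0..<csq (length (clouds nv P)) * csq (length (clouds nv P)) - length (clouds nv P)]"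

definition cell_at :: "cell list \<Rightarrow> nat \<Rightarrow> cell" where
  "cell_at cs z = nth_or (0, 0, 0, 0) cs z"

definition vtx :: "cell list \<Rightarrow> nat \<Rightarrow> nat" where
  "vtx cs z = fst (cell_at cs z)"

definition pos :: "cell list \<Rightarrow> nat \<Rightarrow> nat" where
  "pos cs z = fst (snd (cell_at cs z))"

definition side :: "cell list \<Rightarrow> nat \<Rightarrow> nat" where
  "side cs z = fst (snd (snd (cell_at cs z)))"

definition half :: "cell list \<Rightarrow> nat \<Rightarrow> nat" where
  "half cs z = snd (snd (snd (cell_at cs z)))"

definition partner :: "cell list \<Rightarrow> nat \<Rightarrow> nat" where
  "partner cs z = (if half cs z = 0 then z
     else nth_or z (filter (\<lambda>y. y \<noteq> z \<and> half cs y = half cs z) [0..<length cs]) 0)"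

text \<open>Label 0 crosses an input edge, labels 1 to 8 move inside the torus of a vertex, and
  labels 9 to 16 move in the global torus. The torus of a vertex starts at index
  \<open>z - pos cs z\<close>.\<close>

definition step :: "cell list \<Rightarrow> nat \<Rightarrow> nat \<Rightarrow> nat" where
  "step cs l z = (if l = 0 then partner cs z
     else if l \<le> 8 then z - pos cs z + gg_step (side cs z) (l - 1) (pos cs z)
     else gg_step (csq (length cs)) (l - 9) z)"

definition label_inv :: "nat \<Rightarrow> nat" where
  "label_inv l = (if l = 0 then 0 else if l \<le> 8 then Suc (gg_inv (l - 1)) else 9 + gg_inv (l - 9))"

lemma label_inv_less: "l < 17 \<Longrightarrow> label_inv l < 17"
  by (auto simp: label_inv_def gg_inv_def)

lemma label_inv_inv: "l < 17 \<Longrightarrow> label_inv (label_inv l) = l"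
  by (auto simp: label_inv_def gg_inv_def)

lemma csq_square: "csq (r * r) = r"
proof -
  have "a * a < r * r \<longleftrightarrow> a < r" for a
    by (metis mult_strict_mono' not_less mult_le_mono zero_le)
  hence "{a. a * a < r * r} = {..<r}" by auto
  thus ?thesis by (simp add: csq_card)
qed

lemma length_cells: "length (cells nv P) = csq (length (clouds nv P)) * csq (length (clouds nv P))"
  unfolding cells_def using csq_ge[of "length (clouds nv P)"] by simp

lemma csq_length_cells: "length (cells nv P) = csq (length (cells nv P)) * csq (length (cells nv P))"
  unfolding length_cells csq_square ..

definition torus_block :: "cell list \<Rightarrow> bool" where
  "torus_block b \<longleftrightarrow> (\<exists>v r. length b = r * r \<and> (\<forall>i<r * r. \<exists>h. b ! i = (v, i, r, h)))"

text \<open>Every cell stores its offset and the side of its torus, so the block around it can be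
  located without knowing the blocks before it.\<close>

lemma concat_torus_blocks:
  assumes "\<And>b. b \<in> set bs \<Longrightarrow> torus_block b" "z < length (concat bs)" "concat bs ! z = (v, i, r, h)"
  shows "i \<le> z \<and> i < r * r \<and> z - i + r * r \<le> length (concat bs) \<and>
    (\<forall>i'<r * r. \<exists>h'. concat bs ! (z - i + i') = (v, i', r, h'))"
  using assms
proof (induction bs arbitrary: z)
  case (Cons b bs)
  show ?case
  proof (cases "z < length b")
    case True
    obtain v' r' where b: "length b = r' * r'" "\<And>i. i < r' * r' \<Longrightarrow> \<exists>h. b ! i = (v', i, r', h)"
      using Cons.prems(1)[of b] unfolding torus_block_def by auto
    obtain h' where "b ! z = (v', z, r', h')" using b True by auto
    hence "v = v'" "i = z" "r = r'" using Cons.prems(3) True by (auto simp: nth_append)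
    thus ?thesis using b True by (auto simp: nth_append)
  next
    case False
    define y where "y = z - length b"
    have y: "z = length b + y" "y < length (concat bs)" "concat bs ! y = (v, i, r, h)"
      using False Cons.prems by (auto simp: y_def nth_append)
    have IH: "i \<le> y" "i < r * r" "y - i + r * r \<le> length (concat bs)"
      "\<And>i'. i' < r * r \<Longrightarrow> \<exists>h'. concat bs ! (y - i + i') = (v, i', r, h')"
      using Cons.IH[OF _ y(2,3)] Cons.prems(1) by auto
    have zi: "z - i = length b + (y - i)" using y IH by simp
    have nb: "concat (b # bs) ! (length b + k) = concat bs ! k" for k by (simp add: nth_append)
    have "z - i + r * r \<le> length (concat (b # bs))" using IH(3) zi by simp
    moreover have "\<exists>h'. concat (b # bs) ! (z - i + i') = (v, i', r, h')" if "i' < r * r" for i'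
      using IH(4)[OF that] unfolding zi add.assoc nb .
    ultimately show ?thesis using IH(1,2) y(1) by simp
  qed
qed simp

lemma torus_block_cloud: "torus_block (cloud P v)"
  unfolding torus_block_def cloud_def by (intro exI[of _ v] exI[of _ "csq (length (incident P v))"]) auto

lemma cells_blocks: "cells nv P = concat (map (cloud P) [0..<nv] @
   map (\<lambda>_. [(nv, 0, 1, 0)]) [0..<csq (length (clouds nv P)) * csq (length (clouds nv P)) - length (clouds nv P)])"
  unfolding cells_def clouds_def concat_append by (simp add: o_def)

lemma cells_torus:
  assumes "z < length (cells nv P)"
  defines "cs \<equiv> cells nv P"
  shows "pos cs z \<le> z" "pos cs z < side cs z * side cs z"
    "i < side cs z * side cs z \<Longrightarrow> z - pos cs z + i < length cs"
    "i < side cs z * side cs z \<Longrightarrow> pos cs (z - pos cs z + i) = i"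
    "i < side cs z * side cs z \<Longrightarrow> side cs (z - pos cs z + i) = side cs z"
    "i < side cs z * side cs z \<Longrightarrow> vtx cs (z - pos cs z + i) = vtx cs z"
proof -
  obtain v p r h where c: "cs ! z = (v, p, r, h)" by (metis prod_cases4)
  define bs where "bs = map (cloud P) [0..<nv] @
   map (\<lambda>_. [(nv, 0, 1, 0)]) [0..<csq (length (clouds nv P)) * csq (length (clouds nv P)) - length (clouds nv P)]"
  have cb: "cs = concat bs" unfolding cs_def bs_def by (rule cells_blocks)
  have tb: "torus_block b" if "b \<in> set bs" for b
  proof -
    have "torus_block [(nv, 0, 1, 0)]"
      unfolding torus_block_def by (intro exI[of _ nv] exI[of _ 1]) auto
    thus ?thesis using that by (auto simp: torus_block_cloud bs_def)
  qed
  have at: "cell_at cs z = (v, p, r, h)" using assms(1) c by (simp add: cell_at_def cs_def)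
  have *: "p \<le> z \<and> p < r * r \<and> z - p + r * r \<le> length cs \<and>
    (\<forall>i'<r * r. \<exists>h'. cs ! (z - p + i') = (v, i', r, h'))"
    by (rule concat_torus_blocks[of bs z v p r h, OF tb, folded cb, OF _ _ c]) (use assms(1) in \<open>simp_all add: cs_def\<close>)
  hence at': "\<exists>h'. cell_at cs (z - p + i) = (v, i, r, h')" if "i < r * r" for i
    using that by (auto simp: cell_at_def nth_or_def)
  show "pos cs z \<le> z" "pos cs z < side cs z * side cs z"
    using * by (simp_all add: pos_def side_def at)
  assume i: "i < side cs z * side cs z"
  hence i: "i < r * r" by (simp add: side_def at)
  obtain h' where "cell_at cs (z - p + i) = (v, i, r, h')" using at'[OF i] by blast
  thus "z - pos cs z + i < length cs" "pos cs (z - pos cs z + i) = i" "side cs (z - pos cs z + i) = side cs z"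
    "vtx cs (z - pos cs z + i) = vtx cs z"
    using * i by (auto simp: pos_def side_def vtx_def at)
qed

definition half_keys :: "nat \<Rightarrow> (nat \<times> nat) list \<Rightarrow> (nat \<times> nat) list" where
  "half_keys nv P = concat (map (\<lambda>v. map (\<lambda>j. (v, Suc j)) (incident P v)) [0..<nv])"

text \<open>Removing the padding leaves the ends of edges in a known order. The number of ends and
  the uniqueness of each can then be read off from \<open>half_keys\<close>.\<close>

lemma half_keys_cells:
  "map (\<lambda>c. (fst c, snd (snd (snd c)))) (filter (\<lambda>c. snd (snd (snd c)) \<noteq> 0) (cells nv P)) = half_keys nv P"
proof -
  have cl: "map (\<lambda>c. (fst c, snd (snd (snd c)))) (filter (\<lambda>c. snd (snd (snd c)) \<noteq> 0) (cloud P v))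
    = map (\<lambda>j. (v, Suc j)) (incident P v)" for v
  proof -
    define I where "I = incident P v"
    define r where "r = csq (length I)"
    have up: "[0..<r * r] = [0..<length I] @ [length I..<r * r]"
      using csq_ge[of "length I"] upt_add_eq_append[of 0 "length I" "r * r - length I"] by (simp add: r_def)
    have "map (\<lambda>c. (fst c, snd (snd (snd c)))) (filter (\<lambda>c. snd (snd (snd c)) \<noteq> 0) (cloud P v))
      = map (\<lambda>i. (v, Suc (nth_or 0 I i))) [0..<length I]"
      unfolding cloud_def I_def[symmetric] r_def[symmetric] up
      by (simp add: filter_map o_def)
    also have "\<dots> = map (\<lambda>j. (v, Suc j)) (map ((!) I) [0..<length I])" by simp
    finally show ?thesis unfolding map_nth I_def .
  qed
  show ?thesis
    unfolding cells_def clouds_def half_keys_def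
    by (simp add: filter_concat map_concat o_def cl[unfolded neq0_conv] filter_map)
qed

lemma distinct_map_filter_nth:
  assumes "distinct (map f (filter Q xs))" "i < j" "j < length xs" "Q (xs ! i)" "Q (xs ! j)"
  shows "f (xs ! i) \<noteq> f (xs ! j)"
proof -
  have xs: "xs = take j xs @ xs ! j # drop (Suc j) xs" using assms(3) by (rule id_take_nth_drop)
  have "distinct (map f (filter Q (take j xs @ xs ! j # drop (Suc j) xs)))"
    using assms(1) xs by simp
  hence "f (xs ! j) \<notin> f ` set (filter Q (take j xs))"
    using assms(5) by auto
  moreover have "xs ! i \<in> set (filter Q (take j xs))"
    using assms by (auto simp: in_set_conv_nth intro!: exI[of _ i])
  ultimately show ?thesis by (metis image_eqI)
qed

lemma L2_set_sum_le: "finite A \<Longrightarrow> L2_set (\<lambda>z. \<Sum>a\<in>A. f a z) B \<le> (\<Sum>a\<in>A. L2_set (f a) B)"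
proof (induction A rule: finite_induct)
  case (insert a A)
  thus ?case using L2_set_triangle_ineq[of "f a" "\<lambda>z. \<Sum>a\<in>A. f a z" B] by simp
qed (simp add: L2_set_def)

lemma plurality_value_exists: "\<exists>t. \<forall>x. card {i. i < (m::nat) \<and> \<sigma> i = x} \<le> card {i. i < m \<and> \<sigma> i = t}"
proof (cases "m = 0")
  case False
  let ?f = "\<lambda>x. card {i. i < m \<and> \<sigma> i = x}"
  have fin: "finite (\<sigma> ` {..<m})" "\<sigma> ` {..<m} \<noteq> {}" using False by auto
  have "Max (?f ` \<sigma> ` {..<m}) \<in> ?f ` \<sigma> ` {..<m}" using fin by (intro Max_in) auto
  then obtain t where t: "Max (?f ` \<sigma> ` {..<m}) = ?f t" by auto
  have "?f x \<le> ?f t" for x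
  proof (cases "x \<in> \<sigma> ` {..<m}")
    case True
    thus ?thesis using fin unfolding t[symmetric] by (intro Max_ge) auto
  next
    case False
    hence "{i. i < m \<and> \<sigma> i = x} = {}" by auto
    thus ?thesis by (simp only: card.empty)
  qed
  thus ?thesis by blast
qed auto

section \<open>Expansion and soundness of the graph built from a list of edges\<close>

locale edge_list =
  fixes nv :: nat and P :: "(nat \<times> nat) list"
  assumes ends: "j < length P \<Longrightarrow> fst (P ! j) < snd (P ! j)" "j < length P \<Longrightarrow> snd (P ! j) < nv"
begin

abbreviation "cs \<equiv> cells nv P"
abbreviation "n \<equiv> length cs"

lemma set_incident: "set (incident P v) = {j. j < length P \<and> (v = fst (P ! j) \<or> v = snd (P ! j))}"
  unfolding incident_def by auto

lemma set_half_keys: "set (half_keys nv P) = {(v, Suc j) |v j. j < length P \<and> (v = fst (P ! j) \<or> v = snd (P ! j))}"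
proof -
  have "v < nv" if "j < length P" "v = fst (P ! j) \<or> v = snd (P ! j)" for v j
    using ends[OF that(1)] that(2) by auto
  moreover have "set (half_keys nv P) = (\<Union>v<nv. (\<lambda>j. (v, Suc j)) ` {j. j < length P \<and> (v = fst (P ! j) \<or> v = snd (P ! j))})"
    by (simp add: half_keys_def set_incident atLeast0LessThan)
  ultimately show ?thesis by (simp only:) blast
qed

lemma distinct_half_keys: "distinct (half_keys nv P)"
proof -
  have "distinct (concat (map (\<lambda>v. map (\<lambda>j. (v, Suc j)) (incident P v)) vs))" if "distinct vs" for vs
    using that
    by (induction vs) (auto simp: distinct_map inj_on_def incident_def)
  thus ?thesis unfolding half_keys_def by simp
qed

lemma length_half_keys: "length (half_keys nv P) = 2 * length P"
proof -
  have "set (half_keys nv P) = (\<lambda>p. ((if snd p then fst (P ! fst p) else snd (P ! fst p)), Suc (fst p))) ` ({..<length P} \<times> UNIV)"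
    unfolding set_half_keys by (force simp: image_iff)
  moreover have "inj_on (\<lambda>p. ((if snd p then fst (P ! fst p) else snd (P ! fst p)), Suc (fst p))) ({..<length P} \<times> UNIV)"
    using ends(1) by (fastforce simp: inj_on_def split: if_splits)
  ultimately have "card (set (half_keys nv P)) = card ({..<length P} \<times> (UNIV :: bool set))"
    by (simp add: card_image)
  thus ?thesis using distinct_card[OF distinct_half_keys] by (simp add: card_cartesian_product)
qed

lemma length_clouds_le: "length (clouds nv P) \<le> 8 * length P"
proof -
  have "length (cloud P v) \<le> 4 * length (incident P v)" for v
    using csq_le by (simp add: cloud_def)
  hence "sum_list (map (\<lambda>v. length (cloud P v)) [0..<nv]) \<le> sum_list (map (\<lambda>v. 4 * length (incident P v)) [0..<nv])"
    by (intro sum_list_mono) auto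
  also have "\<dots> = 4 * length (half_keys nv P)"
    by (simp add: half_keys_def length_concat o_def sum_list_const_mult)
  finally show ?thesis
    using length_half_keys by (simp add: clouds_def length_concat o_def)
qed

text \<open>Two ends per edge, and twice a factor of at most 4 for rounding up to a square: once for
  each vertex and once for all points.\<close>

lemma n_le: "n \<le> 32 * length P"
  using length_clouds_le csq_le[of "length (clouds nv P)"] unfolding length_cells by simp

lemma n_ge: "2 * length P \<le> n"
proof -
  have "length (half_keys nv P) \<le> n"
    unfolding half_keys_cells[symmetric] by simp
  thus ?thesis by (simp add: length_half_keys)
qed

lemma half_key_mem:
  assumes "z < n" "half cs z \<noteq> 0"
  shows "(vtx cs z, half cs z) \<in> set (half_keys nv P)"
proof -
  have "cs ! z \<in> set (filter (\<lambda>c. snd (snd (snd c)) \<noteq> 0) cs)"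
    using assms by (auto simp: half_def cell_at_def)
  thus ?thesis unfolding half_keys_cells[symmetric] using assms(1)
    by (force simp: vtx_def half_def cell_at_def)
qed

lemma half_key_ex:
  assumes "j < length P" "v = fst (P ! j) \<or> v = snd (P ! j)"
  obtains z where "z < n" "vtx cs z = v" "half cs z = Suc j"
proof -
  have "(v, Suc j) \<in> set (half_keys nv P)" using assms set_half_keys by auto
  then obtain c where "c \<in> set cs" "fst c = v" "snd (snd (snd c)) = Suc j"
    unfolding half_keys_cells[symmetric] by auto
  then obtain z where "z < n" "cs ! z = c" by (auto simp: in_set_conv_nth)
  thus ?thesis using that[of z] \<open>fst c = v\<close> \<open>snd (snd (snd c)) = Suc j\<close>
    by (simp add: vtx_def half_def cell_at_def)
qed

lemma half_unique:
  assumes "z < n" "y < n" "vtx cs z = vtx cs y" "half cs z = half cs y" "half cs z \<noteq> 0"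
  shows "z = y"
proof -
  note d = distinct_map_filter_nth[of "\<lambda>c. (fst c, snd (snd (snd c)))" "\<lambda>c. snd (snd (snd c)) \<noteq> 0" cs,
      unfolded half_keys_cells, OF distinct_half_keys]
  have "\<not> z < y" "\<not> y < z"
    using d[of z y] d[of y z] assms by (auto simp: vtx_def half_def cell_at_def)
  thus ?thesis by simp
qed

lemma half_edge:
  assumes "z < n" "half cs z = Suc j"
  shows "j < length P" "vtx cs z = fst (P ! j) \<or> vtx cs z = snd (P ! j)"
  using half_key_mem[of z] assms set_half_keys by auto

text \<open>An edge has exactly two ends, at different vertices, so the filter in
  \<open>partner\<close> leaves a single candidate.\<close>

lemma partner_props:
  assumes z: "z < n" and h: "half cs z = Suc j"
  shows "partner cs z < n" "half cs (partner cs z) = Suc j" "vtx cs (partner cs z) \<noteq> vtx cs z"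
    "partner cs (partner cs z) = z"
proof -
  have ex: "\<exists>y. partner cs z = y \<and> y < n \<and> half cs y = Suc j \<and> vtx cs y \<noteq> vtx cs z
       \<and> (\<forall>x<n. half cs x = Suc j \<longrightarrow> x = z \<or> x = y)" if z: "z < n" "half cs z = Suc j" for z
  proof -
    have j: "j < length P" "vtx cs z = fst (P ! j) \<or> vtx cs z = snd (P ! j)" using half_edge[OF z] by auto
    define v where "v = (if vtx cs z = fst (P ! j) then snd (P ! j) else fst (P ! j))"
    have v: "v = fst (P ! j) \<or> v = snd (P ! j)" "v \<noteq> vtx cs z"
      using j ends(1)[OF j(1)] by (auto simp: v_def)
    obtain y where y: "y < n" "vtx cs y = v" "half cs y = Suc j" using half_key_ex[OF j(1) v(1)] .
    have uniq: "x = z \<or> x = y" if x: "x < n" "half cs x = Suc j" for x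
    proof -
      have "vtx cs x = vtx cs z \<or> vtx cs x = v" using half_edge(2)[OF x] j(2) by (auto simp: v_def)
      thus ?thesis using half_unique[of x z] half_unique[of x y] x y z by auto
    qed
    have "filter (\<lambda>x. x \<noteq> z \<and> half cs x = half cs z) [0..<n] = filter (\<lambda>x. x = y) [0..<n]"
      using uniq y v(2) z by (intro filter_cong refl) auto
    also have "\<dots> = [y]"
    proof -
      have "[0..<n] = [0..<y] @ y # [Suc y..<n]"
        using y(1) upt_add_eq_append[of 0 y "n - y"] upt_conv_Cons[of y n] by simp
      thus ?thesis by (simp add: filter_empty_conv)
    qed
    finally have "partner cs z = y" using z by (simp add: partner_def)
    thus ?thesis using y v uniq by auto
  qed
  from ex[OF z h] obtain y where y: "partner cs z = y" "y < n" "half cs y = Suc j" "vtx cs y \<noteq> vtx cs z"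
    by blast
  from ex[OF y(2,3)] z h y have "partner cs y = z" by metis
  thus "partner cs z < n" "half cs (partner cs z) = Suc j" "vtx cs (partner cs z) \<noteq> vtx cs z"
    "partner cs (partner cs z) = z" using y by auto
qed

lemma partner_less: "z < n \<Longrightarrow> partner cs z < n"
  using partner_props(1)[of z "half cs z - 1"] by (cases "half cs z") (auto simp: partner_def)

lemma partner_partner: "z < n \<Longrightarrow> partner cs (partner cs z) = z"
  using partner_props(4)[of z "half cs z - 1"] by (cases "half cs z") (auto simp: partner_def)

lemma cloud_step_less:
  assumes "z < n"
  shows "z - pos cs z + gg_step (side cs z) g (pos cs z) < n"
  using cells_torus(2,3)[OF assms] gg_step_less[of "pos cs z" "side cs z" g] by auto

sublocale labelled_graph n 17 "step cs" label_inv
proof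
  fix l z :: nat
  assume l: "l < 17"
  show "label_inv l < 17" by (rule label_inv_less[OF l])
  show "label_inv (label_inv l) = l" by (rule label_inv_inv[OF l])
  assume z: "z < n"
  have n2: "n = csq n * csq n" by (rule csq_length_cells)
  show "step cs l z < n"
    using z partner_less cloud_step_less gg_step_less[of z "csq n" "l - 9"] n2 unfolding step_def by auto
  show "step cs (label_inv l) (step cs l z) = z"
  proof -
    consider "l = 0" | "1 \<le> l" "l \<le> 8" | "9 \<le> l" "l < 17" using l by linarith
    thus ?thesis
    proof cases
      case 1
      thus ?thesis using partner_partner[OF z] by (simp add: step_def label_inv_def)
    next
      case 2
      define g where "g = l - 1"
      have g: "g < 8" "l = Suc g" using 2 by (auto simp: g_def)
      define y where "y = z - pos cs z + gg_step (side cs z) g (pos cs z)"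
      note c = cells_torus[OF z]
      have b: "gg_step (side cs z) g (pos cs z) < side cs z * side cs z" by (rule gg_step_less[OF c(2)])
      have y: "step cs l z = y" using g by (simp add: step_def y_def)
      have py: "pos cs y = gg_step (side cs z) g (pos cs z)" "side cs y = side cs z"
        using c(4,5)[OF b] by (auto simp: y_def)
      have "step cs (label_inv l) y = y - pos cs y + gg_step (side cs y) (gg_inv g) (pos cs y)"
        using g gg_inv_less[OF g(1)] by (simp add: step_def label_inv_def)
      also have "\<dots> = z - pos cs z + pos cs z"
        unfolding py gg_step_inv[OF c(2) g(1)] by (simp add: y_def)
      finally show ?thesis using c(1) y by simp
    next
      case 3
      define g where "g = l - 9"
      have g: "g < 8" "l = 9 + g" using 3 by (auto simp: g_def)
      show ?thesis using gg_step_inv[of z "csq n" g] g z n2 by (simp add: step_def label_inv_def)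
    qed
  qed
qed

lemma L2_step: "l < 17 \<Longrightarrow> L2_set (\<lambda>z. h (step cs l z)) {..<n} = L2_set h {..<n}"
  unfolding L2_set_def using sum_st[of l "\<lambda>z. (h z)\<^sup>2"] by simp

text \<open>The nine labels of input edges and vertex tori are permutations and contribute norm at
  most 1 each; the eight global labels together contribute \<open>73 / 10\<close>. The ratio is
  \<open>(9 + 73 / 10) / 17\<close>.\<close>

sublocale expanding_graph n 17 "step cs" label_inv "163 / 170"
proof
  show "0 \<le> (163 / 170 :: real)" "(163 / 170 :: real) < 1" by auto
  fix h :: "nat \<Rightarrow> real"
  assume h: "(\<Sum>z<n. h z) = 0"
  define R where "R = csq n"
  have nR: "n = R * R" unfolding R_def by (rule csq_length_cells)
  have split: "(\<Sum>l<17. f l) = (\<Sum>l<9. f l) + (\<Sum>g<8. f (g + 9))" for f :: "nat \<Rightarrow> real"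
    by (simp add: eval_nat_numeral add.assoc)
  have eq: "(\<Sum>l<17. h (step cs l z)) = (\<Sum>l<9. h (step cs l z)) + gg_sum R h z" for z
    unfolding split by (simp add: gg_sum_def step_def R_def)
  have "L2_set (\<lambda>z. \<Sum>l<17. h (step cs l z)) {..<n}
      \<le> L2_set (\<lambda>z. \<Sum>l<9. h (step cs l z)) {..<n} + L2_set (gg_sum R h) {..<n}"
    unfolding eq by (rule L2_set_triangle_ineq)
  also have "L2_set (\<lambda>z. \<Sum>l<9. h (step cs l z)) {..<n} \<le> (\<Sum>l<9. L2_set (\<lambda>z. h (step cs l z)) {..<n})"
    by (rule L2_set_sum_le) simp
  also have "\<dots> = 9 * L2_set h {..<n}" by (simp add: L2_step)
  also have "L2_set (gg_sum R h) {..<n} \<le> 73 / 10 * L2_set h {..<n}"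
  proof -
    have "(\<Sum>i<R * R. h i) = 0" using h nR by simp
    from gg_sum_contraction[OF this] have "sqrt (\<Sum>i<R * R. (gg_sum R h i)\<^sup>2) \<le> sqrt ((73 / 10)\<^sup>2 * (\<Sum>i<R * R. (h i)\<^sup>2))"
      by simp
    thus ?thesis by (simp add: L2_set_def nR real_sqrt_mult)
  qed
  finally show "L2_set (\<lambda>z. \<Sum>l<17. h (step cs l z)) {..<n} \<le> 163 / 170 * real 17 * L2_set h {..<n}"
    by simp
qed

text \<open>Allows \<open>gg_plurality\<close>, which speaks of indices below \<open>r * r\<close>,
  to be applied to the torus of one vertex after a translation.\<close>

lemma vertex_torus:
  assumes v: "v < nv"
  obtains b r where "\<And>z. z < n \<and> vtx cs z = v \<longleftrightarrow> b \<le> z \<and> z < b + r * r"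
    "\<And>i. i < r * r \<Longrightarrow> pos cs (b + i) = i \<and> side cs (b + i) = r"
proof -
  define A where "A = concat (map (cloud P) [0..<v])"
  define r where "r = csq (length (incident P v))"
  have "[0..<nv] = [0..<v] @ v # [Suc v..<nv]"
    using v upt_add_eq_append[of 0 v "nv - v"] upt_conv_Cons[of v nv] by simp
  then obtain B where B: "cs = A @ cloud P v @ B" "\<forall>c\<in>set B. fst c \<noteq> v"
  proof -
    assume u: "[0..<nv] = [0..<v] @ v # [Suc v..<nv]"
    let ?k = "csq (length (clouds nv P)) * csq (length (clouds nv P)) - length (clouds nv P)"
    have "cs = A @ cloud P v @ (concat (map (cloud P) [Suc v..<nv]) @ map (\<lambda>_. (nv, 0, 1, 0)) [0..<?k])"
      unfolding cells_def A_def by (subst (1) clouds_def) (simp add: u)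
    moreover have "\<forall>c\<in>set (concat (map (cloud P) [Suc v..<nv]) @ map (\<lambda>_. (nv, 0, 1, 0)) [0..<?k]). fst c \<noteq> v"
      using v by (auto simp: cloud_def)
    ultimately show ?thesis by (rule that)
  qed
  have A: "\<forall>c\<in>set A. fst c \<noteq> v" by (auto simp: A_def cloud_def)
  have len: "length (cloud P v) = r * r" by (simp add: cloud_def r_def)
  have cl: "i < r * r \<Longrightarrow> \<exists>h. cell_at cs (length A + i) = (v, i, r, h)" for i
    unfolding B(1) cell_at_def by (auto simp: nth_or_def nth_append len) (auto simp: cloud_def r_def)
  show ?thesis
  proof (rule that[of "length A" r])
    fix i assume "i < r * r"
    thus "pos cs (length A + i) = i \<and> side cs (length A + i) = r"
      using cl[of i] by (auto simp: pos_def side_def)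
  next
    fix z
    show "z < n \<and> vtx cs z = v \<longleftrightarrow> length A \<le> z \<and> z < length A + r * r"
    proof
      assume z: "z < n \<and> vtx cs z = v"
      hence f: "fst (cs ! z) = v" by (auto simp: vtx_def cell_at_def)
      have "\<not> z < length A" using f A B(1) by (auto simp: nth_append)
      moreover have "\<not> z \<ge> length A + r * r"
      proof
        assume ge: "z \<ge> length A + r * r"
        hence "cs ! z = B ! (z - length A - r * r)" "z - length A - r * r < length B"
          using z len unfolding B(1) by (auto simp: nth_append)
        thus False using f B(2) by (metis nth_mem)
      qed
      ultimately show "length A \<le> z \<and> z < length A + r * r" by simp
    next
      assume z: "length A \<le> z \<and> z < length A + r * r"
      moreover have "length A + r * r \<le> n" unfolding B(1) using len by simp
      moreover from z have "z - length A < r * r" by linarith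
      ultimately show "z < n \<and> vtx cs z = v"
        using cl[of "z - length A"] by (auto simp: vtx_def)
    qed
  qed
qed

text \<open>Each vertex takes the plurality value of its torus; the expansion bounds of all tori are
  then added. Filler cells have no vertex below \<open>nv\<close> and are left out on the left
  side.\<close>

lemma vertex_values_exist:
  fixes \<sigma> :: "nat \<Rightarrow> 'a"
  shows "\<exists>\<tau>. 7 / 20 * real (card {z. z < n \<and> vtx cs z < nv \<and> \<sigma> z \<noteq> \<tau> (vtx cs z)})
    \<le> (\<Sum>z<n. \<Sum>g<8. of_bool (\<sigma> z \<noteq> \<sigma> (step cs (Suc g) z)))"
proof -
  define S where "S v = {z. z < n \<and> vtx cs z = v}" for v
  define q where "q z = (\<Sum>g<8. of_bool (\<sigma> z \<noteq> \<sigma> (step cs (Suc g) z)) :: real)" for z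
  have q0: "q z \<ge> 0" for z by (simp add: q_def sum_nonneg)
  have "\<exists>t. 7 / 20 * real (card {z \<in> S v. \<sigma> z \<noteq> t}) \<le> (\<Sum>z\<in>S v. q z)" if v: "v < nv" for v
  proof -
    obtain b r where S: "\<And>z. z < n \<and> vtx cs z = v \<longleftrightarrow> b \<le> z \<and> z < b + r * r"
      and br: "\<And>i. i < r * r \<Longrightarrow> pos cs (b + i) = i \<and> side cs (b + i) = r"
      using vertex_torus[OF v] by blast
    define \<sigma>' where "\<sigma>' i = \<sigma> (b + i)" for i
    obtain t where t: "\<And>x. card {i. i < r * r \<and> \<sigma>' i = x} \<le> card {i. i < r * r \<and> \<sigma>' i = t}"
      using plurality_value_exists[of "r * r" \<sigma>'] by blast
    have Sb: "S v = (\<lambda>i. b + i) ` {..<r * r}"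
    proof -
      have "x \<in> (\<lambda>i. b + i) ` {..<r * r}" if "b \<le> x" "x < b + r * r" for x
        using that by (intro image_eqI[of _ _ "x - b"]) auto
      thus ?thesis unfolding S_def S by auto
    qed
    have "{z \<in> S v. \<sigma> z \<noteq> t} = (\<lambda>i. b + i) ` {i. i < r * r \<and> \<sigma>' i \<noteq> t}"
      unfolding Sb \<sigma>'_def by auto
    hence c: "card {z \<in> S v. \<sigma> z \<noteq> t} = card {i. i < r * r \<and> \<sigma>' i \<noteq> t}"
      by (simp add: card_image)
    have "7 / 20 * real (card {z \<in> S v. \<sigma> z \<noteq> t}) \<le> (\<Sum>i<r * r. \<Sum>g<8. of_bool (\<sigma>' i \<noteq> \<sigma>' (gg_step r g i)))"
      unfolding c by (rule gg_plurality[OF t])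
    also have "\<dots> = (\<Sum>i<r * r. q (b + i))"
      unfolding q_def
    proof (intro sum.cong refl)
      fix i g assume "i \<in> {..<r * r}" "g \<in> {..<8::nat}"
      thus "(of_bool (\<sigma>' i \<noteq> \<sigma>' (gg_step r g i)) :: real) = of_bool (\<sigma> (b + i) \<noteq> \<sigma> (step cs (Suc g) (b + i)))"
        using br[of i] by (simp add: step_def \<sigma>'_def)
    qed
    also have "\<dots> = (\<Sum>z\<in>S v. q z)" unfolding Sb by (simp add: sum.reindex)
    finally show ?thesis by blast
  qed
  then obtain \<tau> where \<tau>: "\<And>v. v < nv \<Longrightarrow> 7 / 20 * real (card {z \<in> S v. \<sigma> z \<noteq> \<tau> v}) \<le> (\<Sum>z\<in>S v. q z)"
    by metis
  have "{z. z < n \<and> vtx cs z < nv \<and> \<sigma> z \<noteq> \<tau> (vtx cs z)} = (\<Union>v<nv. {z \<in> S v. \<sigma> z \<noteq> \<tau> v})"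
    by (auto simp: S_def)
  hence "card {z. z < n \<and> vtx cs z < nv \<and> \<sigma> z \<noteq> \<tau> (vtx cs z)} = (\<Sum>v<nv. card {z \<in> S v. \<sigma> z \<noteq> \<tau> v})"
    by (simp only:) (intro card_UN_disjoint, auto simp: S_def)
  hence "7 / 20 * real (card {z. z < n \<and> vtx cs z < nv \<and> \<sigma> z \<noteq> \<tau> (vtx cs z)})
      = (\<Sum>v<nv. 7 / 20 * real (card {z \<in> S v. \<sigma> z \<noteq> \<tau> v}))"
    by (simp add: sum_distrib_left)
  also have "\<dots> \<le> (\<Sum>v<nv. \<Sum>z\<in>S v. q z)" using \<tau> by (intro sum_mono) auto
  also have "\<dots> = (\<Sum>z\<in>(\<Union>v<nv. S v). q z)"
    by (intro sum.UNION_disjoint[symmetric]) (auto simp: S_def)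
  also have "\<dots> \<le> (\<Sum>z<n. q z)" by (intro sum_mono2 q0) (auto simp: S_def)
  finally show ?thesis unfolding q_def by blast
qed

text \<open>The test along label \<open>0\<close> is an input constraint, along a label of a cloud equality, and along a
  label of the global torus void. \<open>Rin j x y\<close> checks edge \<open>j\<close> with the values of its ends.\<close>

definition edge_test :: "(nat \<Rightarrow> 'a \<Rightarrow> 'a \<Rightarrow> bool) \<Rightarrow> nat \<Rightarrow> nat \<Rightarrow> 'a \<Rightarrow> 'a \<Rightarrow> bool" where
  "edge_test Rin l z x y \<longleftrightarrow>
     (if l = 0 then half cs z = 0 \<or>
        (if vtx cs z = fst (P ! (half cs z - 1)) then Rin (half cs z - 1) x y else Rin (half cs z - 1) y x)
      else l \<le> 8 \<longrightarrow> x = y)"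

text \<open>An input edge violated by \<open>\<tau>\<close> either has an end whose point disagrees
  with \<open>\<tau>\<close>, or is violated already at label 0. Disagreeing points are paid for by
  unequal neighbours inside the tori, at the rate \<open>7 / 20\<close>.\<close>

lemma degree_reduction:
  fixes \<sigma> :: "nat \<Rightarrow> 'a" and Rin :: "nat \<Rightarrow> 'a \<Rightarrow> 'a \<Rightarrow> bool"
  defines "F \<equiv> {(z, l). z < n \<and> l < 17 \<and> \<not> edge_test Rin l z (\<sigma> z) (\<sigma> (step cs l z))}"
  shows "\<exists>\<tau>. 7 / 20 * real (card {j. j < length P \<and> \<not> Rin j (\<tau> (fst (P ! j))) (\<tau> (snd (P ! j)))}) \<le> real (card F)"
proof -
  obtain \<tau> where \<tau>: "7 / 20 * real (card {z. z < n \<and> vtx cs z < nv \<and> \<sigma> z \<noteq> \<tau> (vtx cs z)})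
    \<le> (\<Sum>z<n. \<Sum>g<8. of_bool (\<sigma> z \<noteq> \<sigma> (step cs (Suc g) z)))"
    using vertex_values_exist by blast
  define D where "D = {z. z < n \<and> vtx cs z < nv \<and> \<sigma> z \<noteq> \<tau> (vtx cs z)}"
  define V where "V = {z. z < n \<and> \<not> edge_test Rin 0 z (\<sigma> z) (\<sigma> (step cs 0 z))}"
  define E where "E = {(z, g). z < n \<and> g < 8 \<and> \<sigma> z \<noteq> \<sigma> (step cs (Suc g) z)}"
  define Bad where "Bad = {j. j < length P \<and> \<not> Rin j (\<tau> (fst (P ! j))) (\<tau> (snd (P ! j)))}"
  have finE: "finite E"
    by (rule finite_subset[of _ "{..<n} \<times> {..<8}"]) (auto simp: E_def)
  have finF: "finite F"
    by (rule finite_subset[of _ "{..<n} \<times> {..<17}"]) (auto simp: F_def)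
  have cE: "(\<Sum>z<n. \<Sum>g<8. of_bool (\<sigma> z \<noteq> \<sigma> (step cs (Suc g) z))) = real (card E)"
  proof -
    have "(\<Sum>z<n. \<Sum>g<8. of_bool (\<sigma> z \<noteq> \<sigma> (step cs (Suc g) z)) :: real) = (\<Sum>p\<in>{..<n} \<times> {..<8}. of_bool (p \<in> E))"
      unfolding sum.cartesian_product by (intro sum.cong) (auto simp: E_def)
    also have "\<dots> = real (card (({..<n} \<times> {..<8}) \<inter> E))"
      by (simp add: of_bool_def sum.If_cases)
    also have "({..<n} \<times> {..<8}) \<inter> E = E" by (auto simp: E_def)
    finally show ?thesis .
  qed
  have "\<exists>z. z \<in> V \<union> D \<and> half cs z = Suc j" if j: "j \<in> Bad" for j
  proof -
    have jl: "j < length P" using j by (simp add: Bad_def)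
    obtain z where z: "z < n" "vtx cs z = fst (P ! j)" "half cs z = Suc j" using half_key_ex[OF jl] by blast
    define y where "y = partner cs z"
    note p = partner_props[OF z(1,3), folded y_def]
    have y: "vtx cs y = snd (P ! j)" using half_edge(2)[OF p(1,2)] p(3) z(2) by auto
    have nvs: "vtx cs z < nv" "vtx cs y < nv" using ends[OF jl] z y by auto
    show ?thesis
    proof (cases "z \<in> D \<or> y \<in> D")
      case True
      thus ?thesis using z p by auto
    next
      case False
      hence "\<sigma> z = \<tau> (fst (P ! j))" "\<sigma> y = \<tau> (snd (P ! j))"
        using nvs z p y by (auto simp: D_def)
      moreover have "step cs 0 z = y" by (simp add: step_def y_def)
      ultimately have "z \<in> V" using j z by (simp add: V_def Bad_def edge_test_def)
      thus ?thesis using z by auto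
    qed
  qed
  then obtain \<zeta> where \<zeta>: "\<And>j. j \<in> Bad \<Longrightarrow> \<zeta> j \<in> V \<union> D \<and> half cs (\<zeta> j) = Suc j" by metis
  \<comment> \<open>The point chosen for an edge carries the index of that edge, so different bad
    edges are charged to different points.\<close>
  have "inj_on \<zeta> Bad" by (rule inj_onI) (metis \<zeta> nat.inject)
  moreover have "\<zeta> ` Bad \<subseteq> V \<union> D" using \<zeta> by auto
  moreover have finVD: "finite (V \<union> D)" by (auto simp: V_def D_def)
  ultimately have "card Bad \<le> card (V \<union> D)" by (metis card_inj_on_le)
  also have "\<dots> \<le> card V + card D" by (rule card_Un_le)
  finally have "7 / 20 * real (card Bad) \<le> real (card V) + 7 / 20 * real (card D)" by simp
  also have "\<dots> \<le> real (card V) + real (card E)" using \<tau> unfolding D_def cE by simp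
  also have "\<dots> = real (card ((\<lambda>z. (z, 0::nat)) ` V \<union> (\<lambda>(z, g). (z, Suc g)) ` E))"
  proof -
    have "card ((\<lambda>(z, g). (z, Suc g)) ` E) = card E" by (rule card_image) (auto simp: inj_on_def)
    moreover have "card ((\<lambda>z. (z, 0::nat)) ` V) = card V" by (rule card_image) (auto simp: inj_on_def)
    moreover have "finite V" by (simp add: V_def)
    ultimately show ?thesis using finE by (subst card_Un_disjoint) auto
  qed
  also have "\<dots> \<le> real (card F)"
    using finF by (intro of_nat_mono card_mono) (auto simp: V_def E_def F_def edge_test_def)
  finally show ?thesis unfolding Bad_def by blast
qed

end

section \<open>Polynomials of conjunctions\<close>

lemma sum_keys_superset:
  assumes "finite S" "Poly_Mapping.keys p \<subseteq> S" "\<And>x. f x 0 = 0"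
  shows "(\<Sum>x\<in>Poly_Mapping.keys p. f x (Poly_Mapping.lookup p x)) = (\<Sum>x\<in>S. f x (Poly_Mapping.lookup p x))"
  using assms by (intro sum.mono_neutral_left) (auto simp: in_keys_iff)

text \<open>Summands that vanish at coefficient 0 may be summed over any larger support, in
  particular over a common one. Evaluation, degree and renaming are all sums of this form.\<close>

lemma sum_keys_add:
  fixes f :: "'x \<Rightarrow> 'c::monoid_add \<Rightarrow> 'b::comm_monoid_add"
  assumes "\<And>x. f x 0 = 0" "\<And>x a b. f x (a + b) = f x a + f x b"
  shows "(\<Sum>x\<in>Poly_Mapping.keys (p + q). f x (Poly_Mapping.lookup (p + q) x))
    = (\<Sum>x\<in>Poly_Mapping.keys p. f x (Poly_Mapping.lookup p x)) + (\<Sum>x\<in>Poly_Mapping.keys q. f x (Poly_Mapping.lookup q x))"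
proof -
  let ?S = "Poly_Mapping.keys p \<union> Poly_Mapping.keys q"
  note s = sum_keys_superset[of ?S _ f, OF _ _ assms(1)]
  have "(\<Sum>x\<in>Poly_Mapping.keys (p + q). f x (Poly_Mapping.lookup (p + q) x)) = (\<Sum>x\<in>?S. f x (Poly_Mapping.lookup (p + q) x))"
    using keys_add[of p q] by (intro s) auto
  also have "\<dots> = (\<Sum>x\<in>?S. f x (Poly_Mapping.lookup p x)) + (\<Sum>x\<in>?S. f x (Poly_Mapping.lookup q x))"
    by (simp add: lookup_add assms(2) sum.distrib)
  finally show ?thesis using s[of p] s[of q] by simp
qed

definition eval_monom :: "(var \<times> nat \<Rightarrow>\<^sub>0 nat) \<Rightarrow> (var \<Rightarrow> bit list) \<Rightarrow> bit" where
  "eval_monom mon a = (\<Prod>(v, i)\<in>Poly_Mapping.keys mon. (a v ! i) ^ Poly_Mapping.lookup mon (v, i))"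

lemma eval_poly_monom: "eval_poly p a = (\<Sum>mon\<in>Poly_Mapping.keys p. Poly_Mapping.lookup p mon * eval_monom mon a)"
  by (simp add: eval_poly_def eval_monom_def)

lemma eval_poly_0 [simp]: "eval_poly 0 a = 0"
  by (simp add: eval_poly_def)

lemma eval_poly_add: "eval_poly (p + q) a = eval_poly p a + eval_poly q a"
  unfolding eval_poly_monom by (rule sum_keys_add) (rule mult_zero_left, rule distrib_right)

lemma eval_poly_sum: "eval_poly (\<Sum>x\<in>S. f x) a = (\<Sum>x\<in>S. eval_poly (f x) a)"
  by (induction S rule: infinite_finite_induct) (auto simp: eval_poly_add)

lemma eval_poly_single: "eval_poly (Poly_Mapping.single mon c) a = c * eval_monom mon a"
  by (cases "c = 0") (simp_all add: eval_poly_monom)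

lemma eval_monom_superset:
  assumes "finite S" "Poly_Mapping.keys mon \<subseteq> S"
  shows "eval_monom mon a = (\<Prod>x\<in>S. (a (fst x) ! snd x) ^ Poly_Mapping.lookup mon x)"
  unfolding eval_monom_def split_def prod.collapse using assms
  by (intro prod.mono_neutral_left) (auto simp: in_keys_iff)

lemma eval_monom_add: "eval_monom (m + m') a = eval_monom m a * eval_monom m' a"
proof -
  let ?S = "Poly_Mapping.keys m \<union> Poly_Mapping.keys m'"
  have "eval_monom (m + m') a = (\<Prod>x\<in>?S. (a (fst x) ! snd x) ^ Poly_Mapping.lookup (m + m') x)"
    using keys_add[of m m'] by (intro eval_monom_superset) auto
  also have "\<dots> = eval_monom m a * eval_monom m' a"
  proof -
    have "eval_monom m a = (\<Prod>x\<in>?S. (a (fst x) ! snd x) ^ Poly_Mapping.lookup m x)"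
      "eval_monom m' a = (\<Prod>x\<in>?S. (a (fst x) ! snd x) ^ Poly_Mapping.lookup m' x)"
      by (rule eval_monom_superset; simp)+
    thus ?thesis by (simp only: lookup_add power_add prod.distrib)
  qed
  finally show ?thesis .
qed

lemma eval_monom_0 [simp]: "eval_monom 0 a = 1"
  by (simp add: eval_monom_def)

lemma eval_monom_single: "eval_monom (Poly_Mapping.single x e) a = (a (fst x) ! snd x) ^ e"
  by (cases "e = 0") (simp_all add: eval_monom_def split_def)

lemma eval_monom_sum: "finite S \<Longrightarrow> eval_monom (\<Sum>x\<in>S. f x) a = (\<Prod>x\<in>S. eval_monom (f x) a)"
  by (induction S rule: finite_induct) (auto simp: eval_monom_add)

definition monom_degree :: "('x \<Rightarrow>\<^sub>0 nat) \<Rightarrow> nat" where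
  "monom_degree mon = (\<Sum>x\<in>Poly_Mapping.keys mon. Poly_Mapping.lookup mon x)"

lemma monom_degree_add: "monom_degree (m + m') = monom_degree m + monom_degree m'"
  unfolding monom_degree_def by (rule sum_keys_add) simp_all

lemma monom_degree_0 [simp]: "monom_degree 0 = 0"
  by (simp add: monom_degree_def)

lemma monom_degree_single [simp]: "monom_degree (Poly_Mapping.single x e) = e"
  by (cases "e = 0") (simp_all add: monom_degree_def)

lemma monom_degree_sum: "finite S \<Longrightarrow> monom_degree (\<Sum>x\<in>S. f x) = (\<Sum>x\<in>S. monom_degree (f x))"
  by (induction S rule: finite_induct) (auto simp: monom_degree_add)

text \<open>The renaming need not be injective, so indeterminates may merge; adding up
  \<open>single\<close> terms adds their exponents.\<close>

definition rename_monom :: "('x \<Rightarrow> 'y) \<Rightarrow> ('x \<Rightarrow>\<^sub>0 nat) \<Rightarrow> ('y \<Rightarrow>\<^sub>0 nat)" where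
  "rename_monom \<rho> mon = (\<Sum>x\<in>Poly_Mapping.keys mon. Poly_Mapping.single (\<rho> x) (Poly_Mapping.lookup mon x))"

definition rename_poly :: "(var \<times> nat \<Rightarrow> var \<times> nat) \<Rightarrow> bit_poly \<Rightarrow> bit_poly" where
  "rename_poly \<rho> p = (\<Sum>mon\<in>Poly_Mapping.keys p. Poly_Mapping.single (rename_monom \<rho> mon) (Poly_Mapping.lookup p mon))"

lemma rename_poly_add: "rename_poly \<rho> (p + q) = rename_poly \<rho> p + rename_poly \<rho> q"
  unfolding rename_poly_def by (rule sum_keys_add) (rule single_zero, rule single_add)

text \<open>With additivity this says that renaming commutes with shifts by constants, which is why
  close inputs give close outputs.\<close>

lemma rename_poly_const [simp]: "rename_poly \<rho> (const_poly b) = const_poly b"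
  by (cases "b = 0") (simp_all add: rename_poly_def const_poly_def rename_monom_def)

lemma monom_degree_rename [simp]: "monom_degree (rename_monom \<rho> mon) = monom_degree mon"
  by (simp only: rename_monom_def monom_degree_sum[OF finite_keys] monom_degree_single) (simp only: monom_degree_def)

lemma keys_sum_single: "Poly_Mapping.keys (\<Sum>x\<in>S. Poly_Mapping.single (f x) (g x)) \<subseteq> f ` S"
proof (induction S rule: infinite_finite_induct)
  case (insert x S)
  thus ?case using keys_add[of "Poly_Mapping.single (f x) (g x)" "\<Sum>x\<in>S. Poly_Mapping.single (f x) (g x)"]
    by (auto split: if_splits)
qed auto

lemma degree_le_rename: "degree_le d p \<Longrightarrow> degree_le d (rename_poly \<rho> p)"
  using keys_sum_single[of "rename_monom \<rho>" "Poly_Mapping.lookup p" "Poly_Mapping.keys p"]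
  unfolding degree_le_def monom_degree_def[symmetric] rename_poly_def
  by (metis (no_types, lifting) image_iff monom_degree_rename subsetD)

lemma indets_rename: "indets (rename_poly \<rho> p) \<subseteq> \<rho> ` indets p"
proof
  fix y assume "y \<in> indets (rename_poly \<rho> p)"
  then obtain mon where "mon \<in> Poly_Mapping.keys (rename_poly \<rho> p)" "y \<in> Poly_Mapping.keys mon"
    by (auto simp: indets_def)
  then obtain mon' where "mon' \<in> Poly_Mapping.keys p" "y \<in> Poly_Mapping.keys (rename_monom \<rho> mon')"
    using keys_sum_single[of "rename_monom \<rho>" "Poly_Mapping.lookup p" "Poly_Mapping.keys p"]
    unfolding rename_poly_def by blast
  moreover from this obtain x where "x \<in> Poly_Mapping.keys mon'" "y = \<rho> x"
    using keys_sum_single[of \<rho> "Poly_Mapping.lookup mon'" "Poly_Mapping.keys mon'"]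
    unfolding rename_monom_def by blast
  ultimately show "y \<in> \<rho> ` indets p" by (auto simp: indets_def)
qed

lemma eval_rename:
  assumes "\<And>x. x \<in> indets p \<Longrightarrow> a (fst (\<rho> x)) ! snd (\<rho> x) = b (fst x) ! snd x"
  shows "eval_poly (rename_poly \<rho> p) a = eval_poly p b"
proof -
  have "eval_poly (rename_poly \<rho> p) a = (\<Sum>mon\<in>Poly_Mapping.keys p. Poly_Mapping.lookup p mon * eval_monom (rename_monom \<rho> mon) a)"
    unfolding rename_poly_def by (simp add: eval_poly_sum eval_poly_single)
  also have "\<dots> = eval_poly p b"
    unfolding eval_poly_monom
  proof (intro sum.cong refl arg_cong2[where f = "(*)"])
    fix mon assume mon: "mon \<in> Poly_Mapping.keys p"
    have "eval_monom (rename_monom \<rho> mon) a = (\<Prod>x\<in>Poly_Mapping.keys mon. (a (fst (\<rho> x)) ! snd (\<rho> x)) ^ Poly_Mapping.lookup mon x)"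
      unfolding rename_monom_def by (simp add: eval_monom_sum eval_monom_single)
    also have "\<dots> = (\<Prod>x\<in>Poly_Mapping.keys mon. (b (fst x) ! snd x) ^ Poly_Mapping.lookup mon x)"
    proof (rule prod.cong[OF refl])
      fix x assume "x \<in> Poly_Mapping.keys mon"
      hence "x \<in> indets p" using mon by (auto simp: indets_def)
      thus "(a (fst (\<rho> x)) ! snd (\<rho> x)) ^ Poly_Mapping.lookup mon x = (b (fst x) ! snd x) ^ Poly_Mapping.lookup mon x"
        by (simp only: assms)
    qed
    finally show "eval_monom (rename_monom \<rho> mon) a = eval_monom mon b"
      by (simp add: eval_monom_def split_def)
  qed
  finally show ?thesis .
qed

definition bit_var :: "var \<times> nat \<Rightarrow> bit_poly" where
  "bit_var x = Poly_Mapping.single (Poly_Mapping.single x 1) 1"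

lemma eval_bit_var: "eval_poly (bit_var x) a = a (fst x) ! snd x"
  by (simp add: bit_var_def eval_poly_single eval_monom_single)

lemma bit_vars_props: "degree_le 2 (bit_var x + bit_var y)" "indets (bit_var x + bit_var y) \<subseteq> {x, y}"
proof -
  have k: "mon = Poly_Mapping.single x 1 \<or> mon = Poly_Mapping.single y 1"
    if "mon \<in> Poly_Mapping.keys (bit_var x + bit_var y)" for mon
    using that keys_add[of "bit_var x" "bit_var y"] by (auto simp: bit_var_def split: if_splits)
  show "degree_le 2 (bit_var x + bit_var y)"
    unfolding degree_le_def monom_degree_def[symmetric] using k by fastforce
  show "indets (bit_var x + bit_var y) \<subseteq> {x, y}"
    unfolding indets_def using k by fastforce
qed

text \<open>An input conjunct inherits the polynomials of its constraint, renamed to the bits of the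
  slots. An equality gives \<open>k\<close> linear polynomials, since two bits are equal exactly
  when their sum over the two-element field vanishes.\<close>

fun conjunct_polys :: "nat \<Rightarrow> (nat \<Rightarrow> bit_poly list) \<Rightarrow> conjunct \<Rightarrow> bit_poly list" where
  "conjunct_polys k Q (Input j \<pi>) = map (rename_poly (\<lambda>(v, i). (fst (\<pi> v), snd (\<pi> v) + i))) (Q j)"
| "conjunct_polys k Q (Equal p q) = map (\<lambda>i. bit_var (fst p, snd p + i) + bit_var (fst q, snd q + i)) [0..<k]"

text \<open>Equality conjuncts are the same for both close inputs, so their polynomials are shifted
  by 0.\<close>

fun conjunct_shifts :: "nat \<Rightarrow> (nat \<Rightarrow> bit list) \<Rightarrow> conjunct \<Rightarrow> bit list" where
  "conjunct_shifts k B (Input j \<pi>) = B j"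
| "conjunct_shifts k B (Equal p q) = replicate k 0"

lemma bit_add_eq_0: "(x::bit) + y = 0 \<longleftrightarrow> x = y"
  by (cases x; cases y) auto

lemma take_drop_eq_iff:
  assumes "i + k \<le> length x" "j + k \<le> length y"
  shows "take k (drop i x) = take k (drop j y) \<longleftrightarrow> (\<forall>t<k. x ! (i + t) = y ! (j + t))"
  using assms by (auto simp: list_eq_iff_nth_eq)

lemma conjunct_polys_correct:
  assumes Q: "\<And>j. j < length (constraints A) \<Longrightarrow> associated k (constraints A ! j) (Q j)"
    and x: "valid_conjunct k s A U x"
  shows "p \<in> set (conjunct_polys k Q x) \<Longrightarrow> degree_le 2 p \<and> indets p \<subseteq> U \<times> {..<s}"
    and "a \<in> U \<rightarrow>\<^sub>E words s \<Longrightarrow> holds k A a x \<longleftrightarrow> (\<forall>p\<in>set (conjunct_polys k Q x). eval_poly p a = 0)"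
proof -
  have "(\<forall>p\<in>set (conjunct_polys k Q x). degree_le 2 p \<and> indets p \<subseteq> U \<times> {..<s})
    \<and> (\<forall>a\<in>U \<rightarrow>\<^sub>E words s. holds k A a x \<longleftrightarrow> (\<forall>p\<in>set (conjunct_polys k Q x). eval_poly p a = 0))"
  proof (cases x)
    case (Input j \<pi>)
    define S where "S = scope (constraints A ! j)"
    have j: "j < length (constraints A)" and \<pi>: "\<And>v. v \<in> S \<Longrightarrow> fst (\<pi> v) \<in> U \<and> snd (\<pi> v) + k \<le> s"
      using x Input by (auto simp: S_def slots_def image_subset_iff split_def)
    have as: "\<And>p. p \<in> set (Q j) \<Longrightarrow> degree_le 2 p \<and> indets p \<subseteq> S \<times> {..<k}"
      "\<And>b. b \<in> S \<rightarrow>\<^sub>E words k \<Longrightarrow> pred (constraints A ! j) b \<longleftrightarrow> (\<forall>p\<in>set (Q j). eval_poly p b = 0)"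
      using Q[OF j] by (auto simp: associated_def S_def)
    define \<rho> where "\<rho> = (\<lambda>(v, i). (fst (\<pi> v), snd (\<pi> v) + i))"
    have "indets (rename_poly \<rho> p) \<subseteq> U \<times> {..<s}" if "p \<in> set (Q j)" for p
    proof -
      have "\<rho> ` (S \<times> {..<k}) \<subseteq> U \<times> {..<s}" using \<pi> by (fastforce simp: \<rho>_def)
      thus ?thesis using indets_rename[of \<rho> p] as(1)[OF that] by blast
    qed
    moreover have "holds k A a x \<longleftrightarrow> (\<forall>p\<in>set (Q j). eval_poly (rename_poly \<rho> p) a = 0)"
      if a: "a \<in> U \<rightarrow>\<^sub>E words s" for a
    proof -
      define b where "b = (\<lambda>v\<in>S. slot_value k a (\<pi> v))"
      have sv: "slot_value k a (\<pi> v) = take k (drop (snd (\<pi> v)) (a (fst (\<pi> v))))" for v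
        by (cases "\<pi> v") simp
      have len: "length (a (fst (\<pi> v))) = s" if "v \<in> S" for v
        using a \<pi>[OF that] by (auto simp: words_def PiE_def Pi_def)
      have "b \<in> S \<rightarrow>\<^sub>E words k" using len \<pi> by (force simp: b_def sv words_def)
      moreover have "eval_poly (rename_poly \<rho> p) a = eval_poly p b" if "p \<in> set (Q j)" for p
      proof (rule eval_rename)
        fix y assume "y \<in> indets p"
        hence y: "fst y \<in> S" "snd y < k" using as(1)[OF that] by auto
        have "snd (\<pi> (fst y)) + k \<le> s" using \<pi>[OF y(1)] by simp
        thus "a (fst (\<rho> y)) ! snd (\<rho> y) = b (fst y) ! snd y"
          using y len[OF y(1)] by (simp add: \<rho>_def split_def b_def sv)
      qed
      ultimately show ?thesis using as(2)[of b] by (simp add: Input b_def S_def)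
    qed
    ultimately show ?thesis using as(1) degree_le_rename unfolding Input by (auto simp: \<rho>_def[symmetric])
  next
    case (Equal p q)
    have pq: "fst p \<in> U" "snd p + k \<le> s" "fst q \<in> U" "snd q + k \<le> s"
      using x Equal by (auto simp: slots_def)
    have "indets (bit_var (fst p, snd p + i) + bit_var (fst q, snd q + i)) \<subseteq> U \<times> {..<s}" if "i < k" for i
      using bit_vars_props(2)[of "(fst p, snd p + i)" "(fst q, snd q + i)"] pq that by auto
    moreover have "holds k A a x \<longleftrightarrow> (\<forall>i<k. eval_poly (bit_var (fst p, snd p + i) + bit_var (fst q, snd q + i)) a = 0)"
      if a: "a \<in> U \<rightarrow>\<^sub>E words s" for a
    proof -
      have "length (a (fst p)) = s" "length (a (fst q)) = s" using a pq by (auto simp: words_def PiE_def Pi_def)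
      hence "take k (drop (snd p) (a (fst p))) = take k (drop (snd q) (a (fst q)))
         \<longleftrightarrow> (\<forall>i<k. a (fst p) ! (snd p + i) = a (fst q) ! (snd q + i))"
        using pq by (intro take_drop_eq_iff) auto
      moreover have "slot_value k a p = take k (drop (snd p) (a (fst p)))" "slot_value k a q = take k (drop (snd q) (a (fst q)))"
        by (cases p; simp) (cases q; simp)
      ultimately show ?thesis
        by (simp only: Equal holds.simps eval_poly_add eval_bit_var bit_add_eq_0 fst_conv snd_conv)
    qed
    ultimately show ?thesis using bit_vars_props(1) unfolding Equal by auto
  qed
  thus "p \<in> set (conjunct_polys k Q x) \<Longrightarrow> degree_le 2 p \<and> indets p \<subseteq> U \<times> {..<s}"
    and "a \<in> U \<rightarrow>\<^sub>E words s \<Longrightarrow> holds k A a x \<longleftrightarrow> (\<forall>p\<in>set (conjunct_polys k Q x). eval_poly p a = 0)"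
    by blast+
qed

section \<open>Instances specified by lists of conjunctions\<close>

definition conj_constraint :: "nat \<Rightarrow> nat \<Rightarrow> bit list csp \<Rightarrow> var set \<times> conjunct list \<Rightarrow> bit list constraint" where
  "conj_constraint k s A c = \<lparr>scope = fst c, pred = (\<lambda>a. a \<in> fst c \<rightarrow>\<^sub>E words s \<and> (\<forall>x\<in>set (snd c). holds k A a x))\<rparr>"

definition conj_csp :: "nat \<Rightarrow> nat \<Rightarrow> nat \<times> (var set \<times> conjunct list) list \<Rightarrow> bit list csp \<Rightarrow> bit list csp" where
  "conj_csp k s G A = \<lparr>num_vars = fst G, alphabet = words s, constraints = map (conj_constraint k s A) (snd G)\<rparr>"

lemma conj_csp_simps [simp]:
  "num_vars (conj_csp k s G A) = fst G" "alphabet (conj_csp k s G A) = words s"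
  "constraints (conj_csp k s G A) = map (conj_constraint k s A) (snd G)"
  "scope (conj_constraint k s A c) = fst c"
  by (simp_all add: conj_csp_def conj_constraint_def)

lemma associated_conj_constraint:
  assumes Q: "\<And>j. j < length (constraints A) \<Longrightarrow> associated k (constraints A ! j) (Q j)"
    and x: "\<And>x. x \<in> set (snd c) \<Longrightarrow> valid_conjunct k s A (fst c) x"
  shows "associated s (conj_constraint k s A c) (concat (map (conjunct_polys k Q) (snd c)))"
  unfolding associated_def
  using conjunct_polys_correct[OF Q x] by (auto simp: conj_constraint_def)

lemma finite_words: "finite (words k)" and words_nonempty: "words k \<noteq> {}"
proof -
  have "words k = {xs. set xs \<subseteq> {0, 1} \<and> length xs = k}"
    unfolding words_def using bit.exhaust by auto
  thus "finite (words k)" by (simp add: finite_lists_length_eq)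
  have "replicate k 0 \<in> words k" by (simp add: words_def)
  thus "words k \<noteq> {}" by blast
qed

definition valid_spec :: "nat \<Rightarrow> nat \<Rightarrow> nat \<Rightarrow> bit list csp \<Rightarrow> nat \<times> (var set \<times> conjunct list) list \<Rightarrow> bool" where
  "valid_spec l k s A G \<longleftrightarrow> (\<forall>c\<in>set (snd G). fst c \<subseteq> {..<fst G} \<and> card (fst c) = 2 \<and> length (snd c) \<le> l \<and>
     (\<forall>x\<in>set (snd c). valid_conjunct k s A (fst c) x))"

lemma length_conjunct_polys:
  assumes "\<And>j. j < length (constraints A) \<Longrightarrow> length (Q j) \<le> m" "valid_conjunct k s A U x"
  shows "length (conjunct_polys k Q x) \<le> max m k"
  using assms by (cases x) (auto simp: le_max_iff_disj)

lemma length_concat_le: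
  assumes "\<And>x. x \<in> set xs \<Longrightarrow> length (f x) \<le> B"
  shows "length (concat (map f xs)) \<le> length xs * B"
  using assms by (induction xs) force+

text \<open>An input conjunct contributes at most \<open>m\<close> polynomials and an equality
  exactly \<open>k\<close>, hence the factor \<open>max m k\<close> for each conjunct.\<close>

lemma conj_csp_restricted:
  assumes A: "A \<in> restricted_graphs m k" and G: "valid_spec l k s A G" and M: "l * max m k \<le> M"
  shows "conj_csp k s G A \<in> restricted_graphs M s"
proof -
  have "\<forall>j<length (constraints A). \<exists>ps. length ps \<le> m \<and> associated k (constraints A ! j) ps"
    using A by (auto simp: restricted_graphs_def restricted_def)
  then obtain Q where Q: "\<And>j. j < length (constraints A) \<Longrightarrow> length (Q j) \<le> m"
    "\<And>j. j < length (constraints A) \<Longrightarrow> associated k (constraints A ! j) (Q j)"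
    by metis
  have "restricted M s (conj_constraint k s A c)" if "c \<in> set (snd G)" for c
  proof -
    have c: "length (snd c) \<le> l" "\<And>x. x \<in> set (snd c) \<Longrightarrow> valid_conjunct k s A (fst c) x"
      using G that by (auto simp: valid_spec_def)
    have "length (concat (map (conjunct_polys k Q) (snd c))) \<le> length (snd c) * max m k"
      using length_conjunct_polys[OF Q(1) c(2)] by (intro length_concat_le) auto
    also have "\<dots> \<le> l * max m k" using c(1) by simp
    finally show ?thesis
      using associated_conj_constraint[OF Q(2) c(2)] M unfolding restricted_def by (meson order_trans)
  qed
  moreover have "constraint_graph (conj_csp k s G A)"
    using G finite_words words_nonempty
    by (auto simp: constraint_graph_def wf_csp_def vars_def valid_spec_def conj_constraint_def)
  ultimately show ?thesis by (auto simp: restricted_graphs_def)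
qed

lemma factor_graph_conj_csp: "factor_graph (conj_csp k s G A) = factor_graph (conj_csp k s G B)"
  by (auto simp: factor_graph_def)

lemma map2_concat:
  assumes "\<And>x. x \<in> set xs \<Longrightarrow> length (f x) = length (g x)"
  shows "map2 h (concat (map f xs)) (concat (map g xs)) = concat (map (\<lambda>x. map2 h (f x) (g x)) xs)"
  using assms by (induction xs) auto

text \<open>The family for \<open>A\<close> must be the one that witnesses closeness. Concatenated
  over the conjuncts, its shifts give a family for the constraint built from \<open>B\<close>, as
  both instances use the same specification \<open>G\<close>.\<close>

lemma conj_csp_close:
  assumes AB: "close m k A B" and G: "valid_spec l k s A G" "valid_spec l k s B G" and M: "l * max m k \<le> M"
  shows "close M s (conj_csp k s G A) (conj_csp k s G B)"
proof -
  have A: "A \<in> restricted_graphs m k" and B: "B \<in> restricted_graphs m k" and len: "length (constraints A) = length (constraints B)"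
    using AB by (auto simp: close_def factor_graph_def)
  have "\<forall>j<length (constraints A). \<exists>ps bs. length ps \<le> m \<and> length bs = length ps \<and>
        associated k (constraints A ! j) ps \<and>
        associated k (constraints B ! j) (map2 (\<lambda>p b. p + const_poly b) ps bs)"
    using AB by (simp add: close_def)
  then obtain Q b where Q: "\<And>j. j < length (constraints A) \<Longrightarrow> length (Q j) \<le> m \<and> length (b j) = length (Q j) \<and>
        associated k (constraints A ! j) (Q j) \<and> associated k (constraints B ! j) (map2 (\<lambda>p b. p + const_poly b) (Q j) (b j))"
    by metis
  define Q' where "Q' j = map2 (\<lambda>p b. p + const_poly b) (Q j) (b j)" for j
  have "\<exists>ps bs. length ps \<le> M \<and> length bs = length ps \<and> associated s (conj_constraint k s A c) ps \<and>
     associated s (conj_constraint k s B c) (map2 (\<lambda>p b. p + const_poly b) ps bs)" if "c \<in> set (snd G)" for c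
  proof -
    have c: "length (snd c) \<le> l" "\<And>x. x \<in> set (snd c) \<Longrightarrow> valid_conjunct k s A (fst c) x"
      "\<And>x. x \<in> set (snd c) \<Longrightarrow> valid_conjunct k s B (fst c) x"
      using G that by (auto simp: valid_spec_def)
    let ?ps = "concat (map (conjunct_polys k Q) (snd c))"
    let ?bs = "concat (map (conjunct_shifts k b) (snd c))"
    have lenx: "length (conjunct_polys k Q x) = length (conjunct_shifts k b x)" if "x \<in> set (snd c)" for x
      using c(2)[OF that] Q by (cases x) auto
    have shift: "map2 (\<lambda>p b. p + const_poly b) (conjunct_polys k Q x) (conjunct_shifts k b x) = conjunct_polys k Q' x" for x
    proof (cases x)
      case (Input j \<pi>)
      show ?thesis unfolding Input
        by (rule nth_equalityI) (auto simp: Q'_def rename_poly_add)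
    next
      case (Equal p q)
      have "const_poly 0 = 0" by (simp add: const_poly_def)
      thus ?thesis unfolding Equal by (intro nth_equalityI) auto
    qed
    have "length ?ps \<le> length (snd c) * max m k"
      using Q by (intro length_concat_le length_conjunct_polys[OF _ c(2)]) auto
    also have "\<dots> \<le> l * max m k" using c(1) by simp
    finally have "length ?ps \<le> M" using M by simp
    moreover have "length ?bs = length ?ps"
      using lenx by (simp add: length_concat o_def cong: map_cong)
    moreover have "associated s (conj_constraint k s A c) ?ps"
      using Q c(2) by (intro associated_conj_constraint) auto
    moreover have "associated s (conj_constraint k s B c) (map2 (\<lambda>p b. p + const_poly b) ?ps ?bs)"
    proof -
      have "map2 (\<lambda>p b. p + const_poly b) ?ps ?bs = concat (map (conjunct_polys k Q') (snd c))"
        using lenx by (simp only: map2_concat shift)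
      moreover have "associated s (conj_constraint k s B c) (concat (map (conjunct_polys k Q') (snd c)))"
        using Q c(3) len unfolding Q'_def by (intro associated_conj_constraint) auto
      ultimately show ?thesis by simp
    qed
    ultimately show ?thesis by blast
  qed
  moreover have "snd G ! j \<in> set (snd G)" if "j < length (snd G)" for j using that by simp
  ultimately show ?thesis
    unfolding close_def
    using conj_csp_restricted[OF A G(1) M] conj_csp_restricted[OF B G(2) M] factor_graph_conj_csp[of k s G A B]
    by auto
qed

lemma conj_csp_forms_conjunctions:
  assumes "\<And>A. A \<in> \<A> \<Longrightarrow> valid_spec l k s A (G (factor_graph A))"
  shows "forms_conjunctions l k s \<A> (\<lambda>A. conj_csp k s (G (factor_graph A)) A)"
  unfolding forms_conjunctions_def
  by (rule exI[of _ "\<lambda>g. map snd (snd (G g))"])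
     (use assms in \<open>auto simp: conjunction_of_def valid_spec_def conj_constraint_def\<close>)

section \<open>The walk transformation\<close>

text \<open>Base 18 with digits 1 to 17: without a digit 0, words of different lengths also receive
  different numbers.\<close>

primrec word_index :: "nat list \<Rightarrow> nat" where
  "word_index [] = 0"
| "word_index (l # w) = Suc l + 18 * word_index w"

definition slot_of :: "nat \<Rightarrow> nat \<Rightarrow> nat list \<Rightarrow> slot" where
  "slot_of k a w = (a, k * word_index w)"

definition walk_to :: "cell list \<Rightarrow> nat list \<Rightarrow> nat \<Rightarrow> nat" where
  "walk_to cs w z = fold (step cs) w z"

definition retrace :: "nat list \<Rightarrow> nat list" where
  "retrace w = rev (map label_inv w)"

text \<open>The slot \<open>x\<close> holds the value at the point \<open>z\<close>. The equation
  between truth values makes an end \<open>v\<close> of the edge read \<open>x\<close> exactly when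
  \<open>v\<close> is the vertex of \<open>z\<close>, whichever of the two ends that is.\<close>

definition test_conjuncts :: "cell list \<Rightarrow> (nat \<times> nat) list \<Rightarrow> nat \<Rightarrow> nat \<Rightarrow> slot \<Rightarrow> slot \<Rightarrow> conjunct list" where
  "test_conjuncts cs P l z x y = (if l = 0 then
       (if half cs z = 0 then []
        else [Input (half cs z - 1) (\<lambda>v. if (v = fst (P ! (half cs z - 1))) = (vtx cs z = fst (P ! (half cs z - 1))) then x else y)])
     else if l \<le> 8 then [Equal x y] else [])"

definition walk_conjuncts :: "nat \<Rightarrow> cell list \<Rightarrow> (nat \<times> nat) list \<Rightarrow> nat list \<Rightarrow> nat \<Rightarrow> conjunct list" where
  "walk_conjuncts k cs P u a =
     map (\<lambda>p. Equal (slot_of k a (take p u)) (slot_of k (walk_to cs u a) (retrace (drop p u)))) [0..<Suc (length u)] @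
     concat (map (\<lambda>p. test_conjuncts cs P (u ! p) (walk_to cs (take p u) a)
        (slot_of k a (take p u)) (slot_of k (walk_to cs u a) (retrace (drop (Suc p) u)))) [0..<length u])"

text \<open>A constraint must involve two distinct variables: for a closed walk an arbitrary other one is added.\<close>

definition second_var :: "nat \<Rightarrow> nat \<Rightarrow> nat" where
  "second_var a b = (if a = b then if a = 0 then 1 else 0 else b)"

text \<open>Repetitions are kept: a prefix occurs once for each of its extensions to
  \<open>2 * t - 1\<close> labels. All lengths thus have equal weight, as in the sum of
  \<open>amplification\<close>.\<close>

definition templates :: "nat \<Rightarrow> nat list list" where
  "templates t = concat (map (\<lambda>w. map (\<lambda>l. take l w) [1..<2 * t]) (List.n_lists (2 * t - 1) [0..<17]))"

text \<open>Only incidences are used, so that everything built from this list depends on the factor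
  graph alone.\<close>

definition edge_ends :: "factor_graph \<Rightarrow> (nat \<times> nat) list" where
  "edge_ends G = map (\<lambda>j. (Min {v. (v, j) \<in> snd (snd G)}, Max {v. (v, j) \<in> snd (snd G)})) [0..<fst (snd G)]"

definition walk_spec :: "nat \<Rightarrow> nat \<Rightarrow> factor_graph \<Rightarrow> nat \<times> (var set \<times> conjunct list) list" where
  "walk_spec k t G = (let P = edge_ends G; cs = cells (fst G) P in
     (length cs, concat (map (\<lambda>u. map (\<lambda>a. ({a, second_var a (walk_to cs u a)}, walk_conjuncts k cs P u a)) [0..<length cs]) (templates t))))"

lemma set_templates: "u \<in> set (templates t) \<Longrightarrow> 1 \<le> length u \<and> length u < 2 * t \<and> set u \<subseteq> {..<17}"
  by (fastforce simp: templates_def set_n_lists dest: in_set_takeD)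

lemma word_index_less: "set w \<subseteq> {..<17} \<Longrightarrow> word_index w + 1 \<le> 18 ^ length w"
  by (induction w) auto

lemma word_index_inj:
  assumes "set v \<subseteq> {..<17}" "set w \<subseteq> {..<17}" "word_index v = word_index w"
  shows "v = w"
  using assms
proof (induction v arbitrary: w)
  case Nil
  thus ?case by (cases w) auto
next
  case (Cons l v)
  then obtain l' w' where w: "w = l' # w'" by (cases w) auto
  have e: "Suc l + 18 * word_index v = Suc l' + 18 * word_index w'" using Cons.prems w by simp
  have l: "Suc l < 18" "Suc l' < 18" using Cons.prems w by auto
  have "Suc l = (Suc l + 18 * word_index v) mod 18" using l by simp
  also have "\<dots> = Suc l'" unfolding e using l by simp
  finally show ?case using Cons e w by auto
qed

lemma slot_fits:
  assumes "set w \<subseteq> {..<17}" "length w \<le> 2 * t"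
  shows "k * word_index w + k \<le> k * 18 ^ (2 * t)"
proof -
  have "word_index w + 1 \<le> 18 ^ length w" by (rule word_index_less[OF assms(1)])
  also have "\<dots> \<le> 18 ^ (2 * t)" using assms(2) by (intro power_increasing) auto
  finally have "k * (word_index w + 1) \<le> k * 18 ^ (2 * t)" by (rule mult_left_mono) simp
  thus ?thesis by simp
qed

lemma retrace_props: "set w \<subseteq> {..<17} \<Longrightarrow> set (retrace w) \<subseteq> {..<17}" "length (retrace w) = length w"
  by (auto simp: retrace_def label_inv_less)

section \<open>Correctness of the transformation of one input graph\<close>

lemma UNSAT_le:
  assumes "finite (alphabet P)" "a \<in> vars P \<rightarrow>\<^sub>E alphabet P"
  shows "UNSAT P \<le> unsat_fraction P a"
  unfolding UNSAT_def using assms by (intro Min_le) (auto simp: vars_def intro!: finite_PiE)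

lemma UNSAT_attained:
  assumes "finite (alphabet P)" "alphabet P \<noteq> {}"
  obtains a where "a \<in> vars P \<rightarrow>\<^sub>E alphabet P" "UNSAT P = unsat_fraction P a"
proof -
  have "unsat_fraction P ` (vars P \<rightarrow>\<^sub>E alphabet P) \<noteq> {}"
    using assms(2) by (auto simp: PiE_eq_empty_iff)
  moreover have "finite (unsat_fraction P ` (vars P \<rightarrow>\<^sub>E alphabet P))"
    using assms(1) by (auto simp: vars_def intro!: finite_PiE)
  ultimately have "UNSAT P \<in> unsat_fraction P ` (vars P \<rightarrow>\<^sub>E alphabet P)"
    unfolding UNSAT_def by (rule Min_in[rotated])
  thus ?thesis using that by auto
qed

lemma unsat_fraction_nonneg: "unsat_fraction P a \<ge> 0"
  by (simp add: unsat_fraction_def)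

lemma UNSAT_nonneg: "finite (alphabet P) \<Longrightarrow> alphabet P \<noteq> {} \<Longrightarrow> UNSAT P \<ge> 0"
  by (metis UNSAT_attained unsat_fraction_nonneg)

lemma unsat_fraction_filter:
  "unsat_fraction P a = real (length (filter (\<lambda>c. \<not> pred c (restrict a (scope c))) (constraints P))) / real (length (constraints P))"
  unfolding unsat_fraction_def length_filter_conv_card ..

locale input_graph =
  fixes k m t :: nat and A :: "bit list csp"
  assumes A: "A \<in> restricted_graphs m k" and t: "t > 0"
begin

definition ee :: "(nat \<times> nat) list" where
  "ee = edge_ends (factor_graph A)"

lemma constraint_props:
  assumes "j < length (constraints A)"
  shows "scope (constraints A ! j) \<subseteq> {..<num_vars A}" "card (scope (constraints A ! j)) = 2"
    "pred (constraints A ! j) b \<Longrightarrow> b \<in> scope (constraints A ! j) \<rightarrow>\<^sub>E words k"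
proof -
  have "constraint_graph A" "alphabet A = words k" using A by (auto simp: restricted_graphs_def)
  thus "scope (constraints A ! j) \<subseteq> {..<num_vars A}" "card (scope (constraints A ! j)) = 2"
    "pred (constraints A ! j) b \<Longrightarrow> b \<in> scope (constraints A ! j) \<rightarrow>\<^sub>E words k"
    using nth_mem[OF assms] unfolding constraint_graph_def wf_csp_def vars_def by metis+
qed

lemma length_ee [simp]: "length ee = length (constraints A)"
  by (simp add: ee_def edge_ends_def factor_graph_def)

lemma ee_nth:
  assumes "j < length (constraints A)"
  shows "ee ! j = (Min (scope (constraints A ! j)), Max (scope (constraints A ! j)))"
  using assms by (simp add: ee_def edge_ends_def factor_graph_def)

lemma ee_props:
  assumes j: "j < length (constraints A)"
  shows "fst (ee ! j) < snd (ee ! j)" "snd (ee ! j) < num_vars A" "scope (constraints A ! j) = {fst (ee ! j), snd (ee ! j)}"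
proof -
  obtain x y where xy: "scope (constraints A ! j) = {x, y}" "x \<noteq> y"
    using constraint_props(2)[OF j] by (meson card_2_iff)
  thus "fst (ee ! j) < snd (ee ! j)" "scope (constraints A ! j) = {fst (ee ! j), snd (ee ! j)}"
    by (auto simp: ee_nth[OF j] min_def max_def)
  show "snd (ee ! j) < num_vars A"
    using constraint_props(1)[OF j] xy by (auto simp: ee_nth[OF j] max_def)
qed

sublocale edge_list "num_vars A" ee
  using ee_props by unfold_locales auto

abbreviation "N \<equiv> length (constraints A)"
abbreviation "s \<equiv> k * 18 ^ (2 * t)"
abbreviation "TA \<equiv> conj_csp k s (walk_spec k t (factor_graph A)) A"

lemma walk_to_eq: "walk_to cs = walk"
  by (simp add: fun_eq_iff walk_to_def walk_def)

lemma retrace_eq: "retrace = rv"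
  by (simp add: fun_eq_iff retrace_def rv_def)

lemma spec_eq: "walk_spec k t (factor_graph A) = (n, concat (map (\<lambda>u. map (\<lambda>a. ({a, second_var a (walk u a)}, walk_conjuncts k cs ee u a)) [0..<n]) (templates t)))"
proof -
  have "fst (factor_graph A) = num_vars A" by (simp add: factor_graph_def)
  thus ?thesis by (simp only: walk_spec_def ee_def[symmetric] walk_to_eq Let_def)
qed

lemma walk_template_less: "u \<in> set (templates t) \<Longrightarrow> a < n \<Longrightarrow> walk (take p u) a < n"
  using walk_less[of "take p u" "length (take p u)" a] set_templates[of u t]
  by (auto simp: label_words_def dest: in_set_takeD)

lemma template_end_less: "u \<in> set (templates t) \<Longrightarrow> a < n \<Longrightarrow> walk u a < n"
  using walk_template_less[of u a "length u"] by simp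

lemma two_cells: "a < n \<Longrightarrow> 2 \<le> n"
  using n_le n_ge by (cases N) auto

lemma second_var_props:
  assumes "a < n" "b < n"
  shows "second_var a b < n" "card {a, second_var a b} = 2" "b \<in> {a, second_var a b}"
  using assms two_cells[of a] by (auto simp: second_var_def)

lemma valid_test_conjuncts:
  assumes "z < n" "{x, y} \<subseteq> slots k s U" "c \<in> set (test_conjuncts cs ee l z x y)"
  shows "valid_conjunct k s A U c"
  using assms half_edge(1)[of z "half cs z - 1"] by (auto simp: test_conjuncts_def split: if_splits)

lemma length_test_conjuncts: "length (test_conjuncts cs P l z x y) \<le> 1"
  by (simp add: test_conjuncts_def)

lemma slot_of_in_slots:
  assumes "a \<in> U" "set w \<subseteq> {..<17}" "length w < 2 * t"
  shows "slot_of k a w \<in> slots k s U"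
  using slot_fits[of w t k] assms by (auto simp: slot_of_def slots_def)

lemma set_walk_conjuncts: "set (walk_conjuncts k cs ee u a) =
    (\<lambda>p. Equal (slot_of k a (take p u)) (slot_of k (walk u a) (rv (drop p u)))) ` {..length u} \<union>
    (\<Union>p\<in>{..<length u}. set (test_conjuncts cs ee (u ! p) (walk (take p u) a)
        (slot_of k a (take p u)) (slot_of k (walk u a) (rv (drop (Suc p) u)))))"
  by (simp add: walk_conjuncts_def walk_to_eq retrace_eq atLeast0LessThan lessThan_Suc_atMost del: upt_Suc)

lemma valid_walk_spec: "valid_spec (4 * t) k s A (walk_spec k t (factor_graph A))"
  unfolding valid_spec_def spec_eq
proof (rule ballI)
  fix c assume "c \<in> set (snd (n, concat (map (\<lambda>u. map (\<lambda>a. ({a, second_var a (walk u a)}, walk_conjuncts k cs ee u a)) [0..<n]) (templates t))))"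
  then obtain u a where u: "u \<in> set (templates t)" and a: "a < n"
    and c: "c = ({a, second_var a (walk u a)}, walk_conjuncts k cs ee u a)" by auto
  note ut = set_templates[OF u]
  note b = template_end_less[OF u a]
  note sv = second_var_props[OF a b]
  let ?U = "{a, second_var a (walk u a)}"
  have sl: "slot_of k a (take p u) \<in> slots k s ?U" "slot_of k (walk u a) (rv (drop p u)) \<in> slots k s ?U" for p
  proof -
    show "slot_of k a (take p u) \<in> slots k s ?U"
      using ut by (intro slot_of_in_slots) (auto dest: in_set_takeD)
    show "slot_of k (walk u a) (rv (drop p u)) \<in> slots k s ?U"
      unfolding retrace_eq[symmetric] using ut sv(3) retrace_props[of "drop p u"]
      by (intro slot_of_in_slots) (auto dest: in_set_dropD)
  qed
  \<comment> \<open>There is one comparison for each of the \<open>length u + 1\<close> points and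
    at most one test for each step; with \<open>length u < 2 * t\<close> the total is below
    \<open>4 * t\<close>.\<close>
  have "length (walk_conjuncts k cs ee u a) \<le> Suc (length u) + length u * 1"
  proof -
    have "length (concat (map (\<lambda>p. test_conjuncts cs ee (u ! p) (walk_to cs (take p u) a)
        (slot_of k a (take p u)) (slot_of k (walk_to cs u a) (retrace (drop (Suc p) u)))) [0..<length u])) \<le> length [0..<length u] * 1"
      by (intro length_concat_le length_test_conjuncts)
    thus ?thesis by (simp add: walk_conjuncts_def)
  qed
  hence len: "length (walk_conjuncts k cs ee u a) \<le> 4 * t" using ut by simp
  moreover have "valid_conjunct k s A ?U x" if "x \<in> set (walk_conjuncts k cs ee u a)" for x
  proof -
    consider p where "x = Equal (slot_of k a (take p u)) (slot_of k (walk u a) (rv (drop p u)))"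
      | p where "x \<in> set (test_conjuncts cs ee (u ! p) (walk (take p u) a) (slot_of k a (take p u)) (slot_of k (walk u a) (rv (drop (Suc p) u))))"
      using \<open>x \<in> set (walk_conjuncts k cs ee u a)\<close> unfolding set_walk_conjuncts by blast
    thus ?thesis
    proof cases
      case 1
      thus ?thesis using sl by simp
    next
      case 2
      thus ?thesis using sl by (intro valid_test_conjuncts[OF walk_template_less[OF u a] _ 2]) auto
    qed
  qed
  ultimately show "fst c \<subseteq> {..<fst (n, concat (map (\<lambda>u. map (\<lambda>a. ({a, second_var a (walk u a)}, walk_conjuncts k cs ee u a)) [0..<n]) (templates t)))} \<and>
       card (fst c) = 2 \<and> length (snd c) \<le> 4 * t \<and> (\<forall>x\<in>set (snd c). valid_conjunct k s A (fst c) x)"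
    using sv a by (simp add: c)
qed

definition opinion :: "(var \<Rightarrow> bit list) \<Rightarrow> nat \<Rightarrow> nat list \<Rightarrow> bit list" where
  "opinion w a \<mu> = slot_value k w (slot_of k a \<mu>)"

definition edge_ok :: "nat \<Rightarrow> bit list \<Rightarrow> bit list \<Rightarrow> bool" where
  "edge_ok j x y = pred (constraints A ! j) (\<lambda>v\<in>scope (constraints A ! j). if v = fst (ee ! j) then x else y)"

lemma test_conjuncts_hold:
  assumes "z < n"
  shows "(\<forall>c\<in>set (test_conjuncts cs ee l z p q). holds k A w c) \<longleftrightarrow> edge_test edge_ok l z (slot_value k w p) (slot_value k w q)"
proof (cases "l = 0 \<and> half cs z \<noteq> 0")
  case True
  define j where "j = half cs z - 1"
  have h: "half cs z = Suc j" using True by (simp add: j_def)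
  show ?thesis
  proof (cases "vtx cs z = fst (ee ! j)")
    case v: True
    have "(\<lambda>v\<in>scope (constraints A ! j). slot_value k w (if v = fst (ee ! j) then p else q))
       = (\<lambda>v\<in>scope (constraints A ! j). if v = fst (ee ! j) then slot_value k w p else slot_value k w q)"
      by (auto simp: restrict_def)
    thus ?thesis using True v by (simp add: test_conjuncts_def edge_test_def edge_ok_def h)
  next
    case v: False
    have "(\<lambda>v\<in>scope (constraints A ! j). slot_value k w (if v \<noteq> fst (ee ! j) then p else q))
       = (\<lambda>v\<in>scope (constraints A ! j). if v = fst (ee ! j) then slot_value k w q else slot_value k w p)"
      by (auto simp: restrict_def)
    thus ?thesis using True v by (simp add: test_conjuncts_def edge_test_def edge_ok_def h)
  qed
next
  case False
  thus ?thesis by (auto simp: test_conjuncts_def edge_test_def)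
qed

lemma walk_conjuncts_hold:
  assumes u: "u \<in> set (templates t)" and a: "a < n"
  shows "(\<forall>c\<in>set (walk_conjuncts k cs ee u a). holds k A w c) \<longleftrightarrow> \<not> reject (opinion w) (edge_test edge_ok) u a"
proof -
  have "(\<forall>c\<in>set (walk_conjuncts k cs ee u a). holds k A w c) \<longleftrightarrow>
    (\<forall>p\<le>length u. opinion w a (take p u) = opinion w (walk u a) (rv (drop p u))) \<and>
    (\<forall>p<length u. \<forall>c\<in>set (test_conjuncts cs ee (u ! p) (walk (take p u) a)
        (slot_of k a (take p u)) (slot_of k (walk u a) (rv (drop (Suc p) u)))). holds k A w c)"
    unfolding set_walk_conjuncts opinion_def ball_Un ball_UN by auto
  thus ?thesis
    unfolding reject_def using test_conjuncts_hold[OF walk_template_less[OF u a]] by (simp add: opinion_def)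
qed

lemma holds_restrict:
  assumes "valid_conjunct k s A U c"
  shows "holds k A (restrict w U) c \<longleftrightarrow> holds k A w c"
proof -
  have sv: "slot_value k (restrict w U) p = slot_value k w p" if "p \<in> slots k s U" for p
    using that by (cases p) (auto simp: slots_def)
  show ?thesis
  proof (cases c)
    case (Input j \<pi>)
    have "(\<lambda>v\<in>scope (constraints A ! j). slot_value k (restrict w U) (\<pi> v)) = (\<lambda>v\<in>scope (constraints A ! j). slot_value k w (\<pi> v))"
    proof (rule restrict_ext)
      fix v assume "v \<in> scope (constraints A ! j)"
      hence "\<pi> v \<in> slots k s U" using assms Input by auto
      thus "slot_value k (restrict w U) (\<pi> v) = slot_value k w (\<pi> v)" by (rule sv)
    qed
    thus ?thesis by (simp add: Input)
  qed (use assms sv in auto)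
qed

lemma length_TA: "length (constraints TA) = n * (17 ^ (2 * t - 1) * (2 * t - 1))"
proof -
  have "length (templates t) = 17 ^ (2 * t - 1) * (2 * t - 1)"
    by (simp add: templates_def length_concat o_def sum_list_triv length_n_lists)
  thus ?thesis by (simp add: spec_eq length_concat o_def sum_list_triv)
qed

text \<open>Every pair of a template and a start gives one constraint, so the list of constraints
  reproduces the sum in \<open>amplification\<close> term by term.\<close>

lemma unsat_count:
  assumes w: "w \<in> {..<n} \<rightarrow>\<^sub>E words s"
  shows "real (length (filter (\<lambda>c. \<not> pred c (restrict w (scope c))) (constraints TA)))
    = (\<Sum>a<n. \<Sum>v\<in>label_words 17 (2 * t - 1). \<Sum>l\<in>{1..2 * t - 1}. of_bool (reject (opinion w) (edge_test edge_ok) (take l v) a))"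
proof -
  let ?c = "\<lambda>u a. conj_constraint k s A ({a, second_var a (walk u a)}, walk_conjuncts k cs ee u a)"
  let ?rej = "\<lambda>u a. reject (opinion w) (edge_test edge_ok) u a"
  have rej: "pred (?c u a) (restrict w (scope (?c u a))) \<longleftrightarrow> \<not> ?rej u a" if u: "u \<in> set (templates t)" and a: "a < n" for u a
  proof -
    let ?U = "{a, second_var a (walk u a)}"
    have U: "?U \<subseteq> {..<n}" using second_var_props[OF a template_end_less[OF u a]] a by auto
    have "(?U, walk_conjuncts k cs ee u a) \<in> set (snd (walk_spec k t (factor_graph A)))"
      using u a unfolding spec_eq by (auto intro!: bexI[of _ u] image_eqI[of _ _ a])
    hence val: "\<And>c. c \<in> set (walk_conjuncts k cs ee u a) \<Longrightarrow> valid_conjunct k s A ?U c"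
      using valid_walk_spec by (fastforce simp: valid_spec_def)
    have "restrict w ?U \<in> ?U \<rightarrow>\<^sub>E words s" using w U by auto
    hence "pred (?c u a) (restrict w (scope (?c u a))) \<longleftrightarrow> (\<forall>c\<in>set (walk_conjuncts k cs ee u a). holds k A (restrict w ?U) c)"
      by (simp add: conj_constraint_def)
    also have "\<dots> \<longleftrightarrow> (\<forall>c\<in>set (walk_conjuncts k cs ee u a). holds k A w c)"
      using holds_restrict[OF val] by blast
    also have "\<dots> \<longleftrightarrow> \<not> ?rej u a" by (rule walk_conjuncts_hold[OF u a])
    finally show ?thesis .
  qed
  have lf: "real (length (filter Q xs)) = sum_list (map (\<lambda>x. of_bool (Q x)) xs)" for Q and xs :: "'z list"
    by (induction xs) auto
  have lm: "sum_list (map f (concat xss)) = sum_list (map (\<lambda>xs. sum_list (map f xs)) xss)" for f :: "'y \<Rightarrow> real" and xss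
    by (induction xss) auto
  have "real (length (filter (\<lambda>c. \<not> pred c (restrict w (scope c))) (constraints TA)))
    = sum_list (map (\<lambda>u. sum_list (map (\<lambda>a. of_bool (\<not> pred (?c u a) (restrict w (scope (?c u a))))) [0..<n])) (templates t))"
    unfolding lf by (simp add: spec_eq lm o_def)
  also have "\<dots> = sum_list (map (\<lambda>u. sum_list (map (\<lambda>a. of_bool (?rej u a)) [0..<n])) (templates t))"
    using rej by (intro arg_cong[where f = sum_list] map_cong refl) auto
  also have "\<dots> = sum_list (map (\<lambda>u. \<Sum>a<n. of_bool (?rej u a)) (templates t))"
    by (simp add: sum_list_distinct_conv_sum_set atLeast0LessThan del: sum_of_bool_eq)
  also have "\<dots> = sum_list (map (\<lambda>v. \<Sum>l\<in>{1..2 * t - 1}. \<Sum>a<n. of_bool (?rej (take l v) a)) (List.n_lists (2 * t - 1) [0..<17]))"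
  proof -
    have "{1..<2 * t} = {1..2 * t - 1}" using t by auto
    thus ?thesis
      unfolding templates_def lm by (simp add: o_def sum_list_distinct_conv_sum_set del: sum_of_bool_eq)
  qed
  also have "\<dots> = (\<Sum>v\<in>label_words 17 (2 * t - 1). \<Sum>l\<in>{1..2 * t - 1}. \<Sum>a<n. of_bool (?rej (take l v) a))"
  proof -
    have "set (List.n_lists (2 * t - 1) [0..<17]) = label_words 17 (2 * t - 1)"
      by (auto simp: set_n_lists label_words_def)
    thus ?thesis
      by (subst sum_list_distinct_conv_sum_set) (auto simp: distinct_n_lists)
  qed
  also have "\<dots> = (\<Sum>v\<in>label_words 17 (2 * t - 1). \<Sum>a<n. \<Sum>l\<in>{1..2 * t - 1}. of_bool (?rej (take l v) a))"
    by (rule sum.cong[OF refl], rule sum.swap)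
  also have "\<dots> = (\<Sum>a<n. \<Sum>v\<in>label_words 17 (2 * t - 1). \<Sum>l\<in>{1..2 * t - 1}. of_bool (?rej (take l v) a))"
    by (rule sum.swap)
  finally show ?thesis .
qed

text \<open>The values of \<open>\<tau>\<close> need not be words of length \<open>k\<close>.
  Well-formed constraints are false on other values, so replacing these by the zero word violates no
  further edge.\<close>

lemma bad_edges_ge:
  assumes N: "N > 0"
  shows "UNSAT A \<le> real (card {j. j < length ee \<and> \<not> edge_ok j (\<tau> (fst (ee ! j))) (\<tau> (snd (ee ! j)))}) / real N"
proof -
  have alph: "alphabet A = words k" using A by (simp add: restricted_graphs_def)
  define \<tau>' where "\<tau>' = (\<lambda>v\<in>{..<num_vars A}. if \<tau> v \<in> words k then \<tau> v else replicate k 0)"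
  have \<tau>': "\<tau>' \<in> vars A \<rightarrow>\<^sub>E alphabet A" by (auto simp: \<tau>'_def alph vars_def words_def)
  have "{j. j < N \<and> \<not> pred (constraints A ! j) (restrict \<tau>' (scope (constraints A ! j)))}
     \<subseteq> {j. j < length ee \<and> \<not> edge_ok j (\<tau> (fst (ee ! j))) (\<tau> (snd (ee ! j)))}"
  proof safe
    fix j assume j: "j < N" and sat: "\<not> pred (constraints A ! j) (restrict \<tau>' (scope (constraints A ! j)))"
      and ok: "edge_ok j (\<tau> (fst (ee ! j))) (\<tau> (snd (ee ! j)))"
    define S where "S = scope (constraints A ! j)"
    define b where "b = (\<lambda>v\<in>S. if v = fst (ee ! j) then \<tau> (fst (ee ! j)) else \<tau> (snd (ee ! j)))"
    have S: "S = {fst (ee ! j), snd (ee ! j)}" using ee_props(3)[OF j] by (simp add: S_def)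
    have b: "b v = \<tau> v" if "v \<in> S" for v using that by (auto simp: b_def S)
    have p: "pred (constraints A ! j) b" using ok by (simp add: edge_ok_def b_def S_def)
    from constraint_props(3)[OF j this] have "b \<in> S \<rightarrow>\<^sub>E words k" by (simp add: S_def)
    hence "\<tau> v \<in> words k" if "v \<in> S" for v using b[OF that] that by (metis PiE_mem)
    moreover have "v < num_vars A" if "v \<in> S" for v using constraint_props(1)[OF j] that by (auto simp: S_def)
    ultimately have "restrict \<tau>' S = b" by (intro ext) (auto simp: \<tau>'_def b b_def S)
    thus False using sat p by (simp add: S_def)
  qed simp
  hence "card {j. j < N \<and> \<not> pred (constraints A ! j) (restrict \<tau>' (scope (constraints A ! j)))}
     \<le> card {j. j < length ee \<and> \<not> edge_ok j (\<tau> (fst (ee ! j))) (\<tau> (snd (ee ! j)))}"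
    by (intro card_mono) auto
  hence "unsat_fraction A \<tau>' \<le> real (card {j. j < length ee \<and> \<not> edge_ok j (\<tau> (fst (ee ! j))) (\<tau> (snd (ee ! j)))}) / real N"
    unfolding unsat_fraction_def by (intro divide_right_mono) auto
  moreover have "UNSAT A \<le> unsat_fraction A \<tau>'"
    using \<tau>' finite_words by (intro UNSAT_le) (auto simp: alph)
  ultimately show ?thesis by simp
qed

text \<open>The plurality opinions of an optimal assignment yield \<open>F\<close>;
  \<open>degree_reduction\<close> bounds its density from below and \<open>amplification\<close>
  converts it into rejections. The cap 1 on \<open>t * \<epsilon>\<close> becomes the cap
  \<open>1 / real t\<close> on \<open>UNSAT A\<close>.\<close>

lemma soundness:
  "UNSAT TA \<ge> 7 / 10880 / (128 * (3 + 340 / 7)) * real t * min (UNSAT A) (1 / real t)"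
proof (cases "N = 0")
  case True
  hence "UNSAT A = 0"
    using UNSAT_attained[of A] A finite_words words_nonempty
    by (auto simp: restricted_graphs_def unsat_fraction_def)
  moreover have "UNSAT TA \<ge> 0"
    using UNSAT_nonneg[of TA] finite_words words_nonempty by simp
  ultimately show ?thesis by simp
next
  case False
  hence N: "N > 0" by simp
  have "2 * N \<le> n" using n_ge by simp
  hence n: "n > 0" using N by linarith
  obtain w where w: "w \<in> vars TA \<rightarrow>\<^sub>E alphabet TA" and Uw: "UNSAT TA = unsat_fraction TA w"
    using UNSAT_attained[of TA] finite_words words_nonempty by (metis conj_csp_simps(2))
  have w: "w \<in> {..<n} \<rightarrow>\<^sub>E words s" using w by (simp add: vars_def spec_eq)
  define L where "L = 2 * t - 1"
  obtain \<sigma> where plur: "\<And>u x. popularity t (opinion w) u x \<le> popularity t (opinion w) u (\<sigma> u)"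
    using plurality_opinion_exists[of t "opinion w"] by blast
  define F where "F = {(u, l). u < n \<and> l < 17 \<and> \<not> edge_test edge_ok l u (\<sigma> u) (\<sigma> (step cs l u))}"
  obtain \<tau> where \<tau>: "7 / 20 * real (card {j. j < length ee \<and> \<not> edge_ok j (\<tau> (fst (ee ! j))) (\<tau> (snd (ee ! j)))}) \<le> real (card F)"
    using degree_reduction[of edge_ok \<sigma>] unfolding F_def by blast
  define \<epsilon> where "\<epsilon> = real (card F) / (real n * real 17)"
  \<comment> \<open>The denominator is \<open>10880 = 20 * 32 * 17\<close>: the rate
    \<open>7 / 20\<close>, at most 32 points per input edge, and 17 labels.\<close>
  have eps: "7 / 10880 * UNSAT A \<le> \<epsilon>"
  proof -
    have "real N * UNSAT A \<le> real (card {j. j < length ee \<and> \<not> edge_ok j (\<tau> (fst (ee ! j))) (\<tau> (snd (ee ! j)))})"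
      using bad_edges_ge[OF N, of \<tau>] N by (simp add: field_simps)
    hence 1: "7 / 20 * (real N * UNSAT A) \<le> real (card F)" using \<tau> by linarith
    have "alphabet A = words k" using A by (simp add: restricted_graphs_def)
    hence U0: "UNSAT A \<ge> 0" using UNSAT_nonneg[of A] finite_words words_nonempty by simp
    have "n \<le> 32 * N" using n_le by simp
    hence "real n \<le> real (32 * N)" by (rule of_nat_mono)
    hence "real n \<le> 32 * real N" by simp
    hence "7 / 10880 * UNSAT A * (real n * 17) \<le> 7 / 10880 * UNSAT A * (32 * real N * 17)"
      using U0 by (intro mult_left_mono mult_right_mono) auto
    also have "\<dots> = 7 / 20 * (real N * UNSAT A)" by simp
    also note 1
    finally show ?thesis using n unfolding \<epsilon>_def by (subst pos_le_divide_eq) auto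
  qed
  have tot: "real (length (constraints TA)) = real n * real 17 ^ L * real L"
    unfolding length_TA L_def by simp
  have L0: "L > 0" using t by (simp add: L_def)
  have pos: "real n * real 17 ^ L * real L > 0" using n L0 by simp
  have "real n * real 17 ^ L * real L * (min (real t * \<epsilon>) 1 / (128 * (3 + 2 / (1 - 163 / 170))))
    \<le> (\<Sum>a<n. \<Sum>v\<in>label_words 17 L. \<Sum>l\<in>{1..L}. of_bool (reject (opinion w) (edge_test edge_ok) (take l v) a))"
    unfolding L_def \<epsilon>_def using t n plur F_def
    by (intro amplification[where op = "opinion w" and R = "edge_test edge_ok" and \<sigma> = \<sigma>]) simp_all
  also have "\<dots> = real (length (filter (\<lambda>c. \<not> pred c (restrict w (scope c))) (constraints TA)))"
    unfolding L_def by (rule unsat_count[OF w, symmetric])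
  also have "\<dots> = UNSAT TA * (real n * real 17 ^ L * real L)"
  proof -
    have "x = x / y * y" if "y > 0" for x y :: real using that by simp
    from this[OF pos] show ?thesis unfolding Uw unsat_fraction_filter tot .
  qed
  finally have "(real n * real 17 ^ L * real L) * (min (real t * \<epsilon>) 1 / (128 * (3 + 2 / (1 - 163 / 170))))
     \<le> (real n * real 17 ^ L * real L) * UNSAT TA" by (simp add: mult_ac)
  hence "min (real t * \<epsilon>) 1 / (128 * (3 + 2 / (1 - 163 / 170))) \<le> UNSAT TA"
    by (rule mult_left_le_imp_le[OF _ pos])
  hence main: "min (real t * \<epsilon>) 1 / (128 * (3 + 340 / 7)) \<le> UNSAT TA" by simp
  have "7 / 10880 * real t * min (UNSAT A) (1 / real t) \<le> min (real t * \<epsilon>) 1"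
  proof (rule min.boundedI)
    have "7 / 10880 * real t * min (UNSAT A) (1 / real t) \<le> 7 / 10880 * real t * UNSAT A"
      by (intro mult_left_mono) auto
    also have "\<dots> = real t * (7 / 10880 * UNSAT A)" by simp
    also have "\<dots> \<le> real t * \<epsilon>" by (intro mult_left_mono eps) auto
    finally show "7 / 10880 * real t * min (UNSAT A) (1 / real t) \<le> real t * \<epsilon>" .
    have "7 / 10880 * real t * min (UNSAT A) (1 / real t) \<le> 7 / 10880 * real t * (1 / real t)"
      by (intro mult_left_mono) auto
    also have "\<dots> \<le> 1" using t by simp
    finally show "7 / 10880 * real t * min (UNSAT A) (1 / real t) \<le> 1" .
  qed
  hence "7 / 10880 * real t * min (UNSAT A) (1 / real t) / (128 * (3 + 340 / 7)) \<le> min (real t * \<epsilon>) 1 / (128 * (3 + 340 / 7))"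
    by (rule divide_right_mono) simp
  also note main
  finally show ?thesis by simp
qed

text \<open>In the honest assignment the opinion of a point along a word is the satisfying value of
  the vertex at which the word ends. Opinions about the same point agree, and moves inside a torus
  preserve the vertex.\<close>

lemma completeness:
  assumes "UNSAT A = 0"
  shows "UNSAT TA = 0"
proof -
  have alph: "alphabet A = words k" using A by (simp add: restricted_graphs_def)
  obtain \<tau> where \<tau>: "\<tau> \<in> vars A \<rightarrow>\<^sub>E alphabet A" "unsat_fraction A \<tau> = 0"
    using UNSAT_attained[of A] assms finite_words words_nonempty by (metis alph)
  have sat: "pred (constraints A ! j) (restrict \<tau> (scope (constraints A ! j)))" if j: "j < N" for j
  proof -
    have "card {j. j < N \<and> \<not> pred (constraints A ! j) (restrict \<tau> (scope (constraints A ! j)))} = 0"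
      using \<tau>(2) j unfolding unsat_fraction_def by auto
    moreover have "finite {j. j < N \<and> \<not> pred (constraints A ! j) (restrict \<tau> (scope (constraints A ! j)))}" by simp
    ultimately have "{j. j < N \<and> \<not> pred (constraints A ! j) (restrict \<tau> (scope (constraints A ! j)))} = {}"
      using card_0_eq by blast
    thus ?thesis using j by blast
  qed
  \<comment> \<open>The default value serves the filler points, whose vertex is
    \<open>num_vars A\<close>.\<close>
  define val where "val v = (if v < num_vars A then \<tau> v else replicate k 0)" for v
  have val: "length (val v) = k" for v
    using \<tau>(1) by (auto simp: val_def alph words_def vars_def)
  define W where "W = {\<mu>. set \<mu> \<subseteq> {..<17::nat}}"
  define dec where "dec = inv_into W word_index"
  have dec: "dec (word_index \<mu>) = \<mu>" if "\<mu> \<in> W" for \<mu>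
    unfolding dec_def using that word_index_inj by (intro inv_into_f_f) (auto simp: inj_on_def W_def)
  \<comment> \<open>Bit \<open>q\<close> of a value is bit \<open>q mod k\<close> of the slot with
    number \<open>q div k\<close>; \<open>dec\<close> recovers the word of that slot.\<close>
  define w where "w = (\<lambda>z\<in>{..<n}. map (\<lambda>q. val (vtx cs (walk (dec (q div k)) z)) ! (q mod k)) [0..<s])"
  have w: "w \<in> {..<n} \<rightarrow>\<^sub>E words s" by (auto simp: w_def words_def)
  have op: "opinion w a \<mu> = val (vtx cs (walk \<mu> a))" if "a < n" "\<mu> \<in> W" "length \<mu> \<le> 2 * t" for a \<mu>
  proof (rule nth_equalityI)
    have fits: "k * word_index \<mu> + k \<le> s" using that by (intro slot_fits) (auto simp: W_def)
    have o: "opinion w a \<mu> = take k (drop (k * word_index \<mu>) (w a))" by (simp add: opinion_def slot_of_def)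
    have wa: "length (w a) = s" using that by (simp add: w_def)
    have le: "k * word_index \<mu> \<le> length (w a)" using fits wa by linarith
    show "length (opinion w a \<mu>) = length (val (vtx cs (walk \<mu> a)))" using fits by (simp add: o wa val)
    fix i assume "i < length (opinion w a \<mu>)"
    hence i: "i < k" by (simp add: o)
    hence q: "(k * word_index \<mu> + i) div k = word_index \<mu>" "(k * word_index \<mu> + i) mod k = i" by auto
    have "opinion w a \<mu> ! i = w a ! (k * word_index \<mu> + i)" using i nth_drop[of "k * word_index \<mu>" "w a" i, OF le] by (simp add: o)
    also have "\<dots> = val (vtx cs (walk \<mu> a)) ! i" using that(1) i fits by (simp add: w_def q dec[OF that(2)])
    finally show "opinion w a \<mu> ! i = val (vtx cs (walk \<mu> a)) ! i" .
  qed
  have tests: "edge_test edge_ok l z (val (vtx cs z)) (val (vtx cs (step cs l z)))" if z: "z < n" for l z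
  proof -
    consider "l = 0" "half cs z = 0" | "l = 0" "half cs z \<noteq> 0" | "1 \<le> l" "l \<le> 8" | "l > 8" by linarith
    thus ?thesis
    proof cases
      case 2
      define j where "j = half cs z - 1"
      have h: "half cs z = Suc j" using 2 by (simp add: j_def)
      have j: "j < N" using half_edge(1)[OF z h] by simp
      have st: "step cs 0 z = partner cs z" using 2 by (simp add: step_def)
      note p = partner_props[OF z h]
      have ok: "edge_ok j (val (fst (ee ! j))) (val (snd (ee ! j)))"
      proof -
        have "(\<lambda>v\<in>scope (constraints A ! j). if v = fst (ee ! j) then val (fst (ee ! j)) else val (snd (ee ! j)))
           = restrict \<tau> (scope (constraints A ! j))"
          using ee_props[OF j] by (intro ext) (auto simp: val_def)
        thus ?thesis unfolding edge_ok_def using sat[OF j] by simp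
      qed
      show ?thesis
        using half_edge(2)[OF z h] half_edge(2)[OF p(1,2)] p(3) ok 2 ee_props(1)[OF j]
        by (auto simp: edge_test_def st h)
    next
      case 3
      have "vtx cs (step cs l z) = vtx cs z"
        using 3 cells_torus(6)[OF z gg_step_less[OF cells_torus(2)[OF z]]] by (simp add: step_def)
      thus ?thesis using 3 by (simp add: edge_test_def)
    qed (auto simp: edge_test_def)
  qed
  have norej: "\<not> reject (opinion w) (edge_test edge_ok) (take l v) a"
    if v: "v \<in> label_words 17 (2 * t - 1)" and a: "a < n" for v l a
  proof -
    define u where "u = take l v"
    have u: "set u \<subseteq> {..<17}" "length u \<le> 2 * t" using v by (auto simp: u_def label_words_def dest: in_set_takeD)
    have tk: "take p u \<in> W" "length (take p u) \<le> 2 * t" "take p u \<in> label_words 17 (length (take p u))" for p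
      using u by (auto simp: W_def label_words_def dest: in_set_takeD)
    have dr: "drop p u \<in> label_words 17 (length (drop p u))" for p
      using u by (auto simp: label_words_def dest: in_set_dropD)
    have rd: "rv (drop p u) \<in> W" "length (rv (drop p u)) \<le> 2 * t" for p
      using rv_label_words[OF dr[of p]] u by (auto simp: W_def label_words_def)
    have zp: "walk (take p u) a < n" for p using walk_less[OF tk(3) a] .
    have b: "walk u a < n" using zp[of "length u"] by simp
    have wb: "walk (rv (drop p u)) (walk u a) = walk (take p u) a" for p
    proof -
      have "walk u a = walk (drop p u) (walk (take p u) a)"
        by (metis append_take_drop_id walk_simps(3))
      thus ?thesis using walk_rv[OF dr zp] by simp
    qed
    have stp: "walk (take (Suc p) u) a = step cs (u ! p) (walk (take p u) a)" if "p < length u" for p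
      using that by (simp add: take_Suc_conv_app_nth)
    show ?thesis
      unfolding u_def[symmetric] reject_def
      using op[OF a tk(1,2)] op[OF b rd] wb tests[OF zp] stp by simp
  qed
  have "unsat_fraction TA w = 0"
    unfolding unsat_fraction_filter unsat_count[OF w] using norej by simp
  moreover have "UNSAT TA \<le> unsat_fraction TA w"
    using w finite_words by (intro UNSAT_le) (auto simp: vars_def spec_eq)
  moreover have "UNSAT TA \<ge> 0"
    using UNSAT_nonneg[of TA] finite_words words_nonempty by simp
  ultimately show ?thesis by simp
qed

lemma size_TA: "real (csp_size TA) \<le> 32 * (1 + 17 ^ (2 * t - 1) * real (2 * t - 1)) * real (csp_size A)"
proof -
  define M where "M = 17 ^ (2 * t - 1) * (2 * t - 1)"
  have "csp_size TA = n * (1 + M)"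
    unfolding M_def csp_size_def length_TA by (simp add: vars_def spec_eq)
  also have "\<dots> \<le> 32 * N * (1 + M)"
    using n_le by (intro mult_right_mono) auto
  also have "\<dots> \<le> 32 * csp_size A * (1 + M)"
    by (intro mult_right_mono mult_left_mono) (auto simp: csp_size_def)
  finally have "real (csp_size TA) \<le> real (32 * csp_size A * (1 + M))"
    by (rule of_nat_mono)
  also have "\<dots> = 32 * (1 + real M) * real (csp_size A)" by (simp add: algebra_simps)
  also have "real M = 17 ^ (2 * t - 1) * real (2 * t - 1)" by (simp add: M_def)
  finally show ?thesis .
qed

end

section \<open>Computing the walk transformation\<close>

lemma ptime2: "ptime (\<lambda>p. F (fst p) (snd p)) \<Longrightarrow> ptime f \<Longrightarrow> ptime g \<Longrightarrow> ptime (\<lambda>x. F (f x) (g x))"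
  using ptime_comp[OF ptime_Pair, of f g "\<lambda>p. F (fst p) (snd p)"] by simp

lemma ptime_csq:
  assumes "ptime f"
  shows "ptime (\<lambda>x. csq (f x))"
proof -
  have "ptime csq"
    unfolding csq_def[abs_def] by (intro ptime_intros ptime_filter)
  from ptime_comp[OF assms this] show ?thesis .
qed

lemma ptime_incident:
  assumes "ptime f" "ptime g"
  shows "ptime (\<lambda>x. incident (f x) (g x))"
proof -
  have "ptime (\<lambda>x :: (nat \<times> nat) list \<times> nat. incident (fst x) (snd x))"
    unfolding incident_def by (intro ptime_intros ptime_filter)
  from ptime2[OF this assms] show ?thesis .
qed

lemma ptime_cloud:
  assumes "ptime f" "ptime g"
  shows "ptime (\<lambda>x. cloud (f x) (g x))"
proof -
  have "ptime (\<lambda>x :: (nat \<times> nat) list \<times> nat. cloud (fst x) (snd x))"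
    unfolding cloud_def by (intro ptime_intros ptime_map ptime_csq ptime_incident)
  from ptime2[OF this assms] show ?thesis .
qed

lemma ptime_clouds:
  assumes "ptime f" "ptime g"
  shows "ptime (\<lambda>x. clouds (f x) (g x))"
proof -
  have "ptime (\<lambda>x :: nat \<times> (nat \<times> nat) list. clouds (fst x) (snd x))"
    unfolding clouds_def by (intro ptime_intros ptime_map ptime_cloud)
  from ptime2[OF this assms] show ?thesis .
qed

lemma ptime_cells:
  assumes "ptime f" "ptime g"
  shows "ptime (\<lambda>x. cells (f x) (g x))"
proof -
  have "ptime (\<lambda>x :: nat \<times> (nat \<times> nat) list. cells (fst x) (snd x))"
    unfolding cells_def by (intro ptime_intros ptime_map ptime_clouds ptime_csq)
  from ptime2[OF this assms] show ?thesis .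
qed

lemma ptime_cell_at: "ptime f \<Longrightarrow> ptime g \<Longrightarrow> ptime (\<lambda>x. cell_at (f x) (g x))"
  unfolding cell_at_def by (intro ptime_intros)

lemma ptime_cell_parts:
  assumes "ptime f" "ptime g"
  shows "ptime (\<lambda>x. vtx (f x) (g x))" "ptime (\<lambda>x. pos (f x) (g x))"
    "ptime (\<lambda>x. side (f x) (g x))" "ptime (\<lambda>x. half (f x) (g x))"
  unfolding vtx_def pos_def side_def half_def by (intro ptime_intros ptime_cell_at assms)+

lemma ptime_gg_step: "ptime r \<Longrightarrow> ptime i \<Longrightarrow> ptime (\<lambda>x. gg_step (r x) g (i x))"
  unfolding gg_step.simps Let_def by (intro ptime_intros)

lemma ptime_partner:
  assumes "ptime f" "ptime g"
  shows "ptime (\<lambda>x. partner (f x) (g x))"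
proof -
  have "ptime (\<lambda>x :: cell list \<times> nat. partner (fst x) (snd x))"
    unfolding partner_def by (intro ptime_intros ptime_filter ptime_cell_parts)
  from ptime2[OF this assms] show ?thesis .
qed

lemma ptime_step: "ptime f \<Longrightarrow> ptime g \<Longrightarrow> ptime (\<lambda>x. step (f x) l (g x))"
  unfolding step_def by (intro ptime_intros ptime_partner ptime_cell_parts ptime_gg_step ptime_csq)

text \<open>The word is fixed, so the program is a composition with one part per label, and no bound
  on a loop is needed.\<close>

lemma ptime_walk_to:
  assumes "ptime f"
  shows "ptime g \<Longrightarrow> ptime (\<lambda>x. walk_to (f x) w (g x))"
proof (induction w arbitrary: g)
  case (Cons l w)
  from Cons.IH[OF ptime_step[OF assms Cons.prems, of l]] show ?case by (simp add: walk_to_def)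
qed (simp add: walk_to_def)

section \<open>Instances as data, and the program on them\<close>

type_synonym raw_csp = "nat \<times> (nat list \<times> bool list) list"

text \<open>Predicates are not data. The raw form contains just what \<open>encode_csp\<close>
  writes down and has the same tree, so programs can be built on it with the closure lemmas.\<close>

definition raw_of :: "nat \<Rightarrow> bit list csp \<Rightarrow> raw_csp" where
  "raw_of k A = (num_vars A, map (\<lambda>c. (sorted_list_of_set (scope c), truth_table k c)) (constraints A))"

lemma encode_list_map: "encode_list (\<lambda>x. enc (f x)) xs = enc (map f xs)"
  by (induction xs) auto

lemma enc_raw_of: "enc (raw_of k A) = encode_csp k A"
proof -
  have "encode_list encode_nat ns = enc ns" for ns
    using encode_list_map[of "\<lambda>n. n" ns] by (simp add: enc_nat_def)
  moreover have "encode_list encode_bool bs = enc bs" for bs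
    using encode_list_map[of "\<lambda>b. b" bs] by (simp add: enc_bool_def)
  ultimately have "encode_constraint k = (\<lambda>c. enc (sorted_list_of_set (scope c), truth_table k c))"
    by (simp add: fun_eq_iff encode_constraint_def)
  hence "encode_list (encode_constraint k) (constraints A) = enc (map (\<lambda>c. (sorted_list_of_set (scope c), truth_table k c)) (constraints A))"
    by (simp only: encode_list_map)
  thus ?thesis by (simp add: encode_csp_def raw_of_def enc_nat_def)
qed

definition raw_ends :: "raw_csp \<Rightarrow> (nat \<times> nat) list" where
  "raw_ends x = map (\<lambda>c. (nth_or 0 (fst c) 0, nth_or 0 (fst c) 1)) (snd x)"

text \<open>The row of a truth table that belongs to two given values. The values are parameters of
  the program, so this number is a constant in it.\<close>

definition pair_row :: "nat \<Rightarrow> bit list \<Rightarrow> bit list \<Rightarrow> nat" where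
  "pair_row k y y' = length (takeWhile (\<lambda>ws. ws \<noteq> [y, y']) (List.n_lists 2 (List.n_lists k [0, 1])))"

type_synonym walk_env = "raw_csp \<times> (nat \<times> nat) list \<times> cell list"

definition raw_test :: "nat \<Rightarrow> walk_env \<Rightarrow> nat \<Rightarrow> nat \<Rightarrow> bit list \<Rightarrow> bit list \<Rightarrow> bool" where
  "raw_test k e l z y y' = (case e of (x, P, cs) \<Rightarrow>
     if l = 0 then half cs z = 0 \<or>
       nth_or False (snd (nth_or ([], []) (snd x) (half cs z - 1)))
         (if vtx cs z = fst (nth_or (0, 0) P (half cs z - 1)) then pair_row k y y' else pair_row k y' y)
     else l \<le> 8 \<longrightarrow> y = y')"

definition read_slot :: "nat \<Rightarrow> bit list \<Rightarrow> nat list \<Rightarrow> bit list" where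
  "read_slot k x \<mu> = take k (drop (k * word_index \<mu>) x)"

definition raw_accept :: "nat \<Rightarrow> nat list \<Rightarrow> walk_env \<Rightarrow> nat \<Rightarrow> bit list \<Rightarrow> bit list \<Rightarrow> bool" where
  "raw_accept k u e a xa xb \<longleftrightarrow>
     (\<forall>p\<in>set [0..<Suc (length u)]. read_slot k xa (take p u) = read_slot k xb (retrace (drop p u))) \<and>
     (\<forall>p\<in>set [0..<length u]. raw_test k e (u ! p) (walk_to (snd (snd e)) (take p u) a)
        (read_slot k xa (take p u)) (read_slot k xb (retrace (drop (Suc p) u))))"

text \<open>A row lists the value of the smaller variable first. The cases on the order keep the
  values passed to \<open>raw_accept\<close> constant, so that only comparisons of indices are left
  to the program; \<open>a = b\<close> occurs for closed walks.\<close>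

definition raw_row :: "nat \<Rightarrow> nat list \<Rightarrow> walk_env \<Rightarrow> nat \<Rightarrow> nat \<Rightarrow> nat \<Rightarrow> bit list list \<Rightarrow> bool" where
  "raw_row k u e a b lo ws =
     (if a = lo then (if b = lo then raw_accept k u e a (ws ! 0) (ws ! 0) else raw_accept k u e a (ws ! 0) (ws ! 1))
      else if b = lo then raw_accept k u e a (ws ! 1) (ws ! 0) else raw_accept k u e a (ws ! 1) (ws ! 1))"

definition raw_constraint :: "nat \<Rightarrow> nat \<Rightarrow> nat list \<Rightarrow> walk_env \<Rightarrow> nat \<Rightarrow> nat list \<times> bool list" where
  "raw_constraint k s u e a = (let b = walk_to (snd (snd e)) u a; c = second_var a b; lo = (if a < c then a else c);
      hi = (if a < c then c else a) in
     ([lo, hi], map (raw_row k u e a b lo) (List.n_lists 2 (List.n_lists s [0, 1]))))"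

definition raw_transform :: "nat \<Rightarrow> nat \<Rightarrow> nat \<Rightarrow> raw_csp \<Rightarrow> raw_csp" where
  "raw_transform k s t x = (let P = raw_ends x; cs = cells (fst x) P in
     (length cs, concat (map (\<lambda>u. map (raw_constraint k s u (x, P, cs)) [0..<length cs]) (templates t))))"

lemma ptime_raw_ends: "ptime raw_ends"
  unfolding raw_ends_def[abs_def] by (intro ptime_intros ptime_map)

lemma ptime_raw_test:
  assumes "ptime e" "ptime z"
  shows "ptime (\<lambda>x. raw_test k (e x) l (z x) y y')"
proof (cases "l = 0")
  case True
  show ?thesis
    unfolding raw_test_def split_def by (simp only: True simp_thms if_True) (intro ptime_intros ptime_cell_parts assms)
next
  case False
  have "raw_test k (e x) l (z x) y y' = (l \<le> 8 \<longrightarrow> y = y')" for x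
    using False by (simp add: raw_test_def split_def)
  thus ?thesis by (simp only: ptime_const)
qed

lemma ptime_raw_accept:
  assumes "ptime e" "ptime a"
  shows "ptime (\<lambda>x. raw_accept k u (e x) (a x) xa xb)"
  unfolding raw_accept_def
  by (intro ptime_conj ptime_const ptime_ball_const ptime_raw_test ptime_walk_to ptime_snd assms)

lemma ptime_raw_constraint:
  assumes "ptime e" "ptime a"
  shows "ptime (\<lambda>x. raw_constraint k s u (e x) (a x))"
proof -
  have row: "ptime (\<lambda>x. raw_row k u (e x) (a x) (b x) (lo x) ws)" if "ptime b" "ptime lo" for b lo ws
    unfolding raw_row_def by (intro ptime_intros ptime_raw_accept assms that)
  show ?thesis
    unfolding raw_constraint_def Let_def second_var_def
    by (intro ptime_intros ptime_map_const row ptime_walk_to assms)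
qed

lemma ptime_raw_transform: "ptime (raw_transform k s t)"
proof -
  have cs: "ptime (\<lambda>x :: raw_csp. cells (fst x) (raw_ends x))"
    by (intro ptime_cells ptime_fst ptime_id ptime_raw_ends)
  have "ptime (\<lambda>x. (length (cells (fst x) (raw_ends x)),
     concat (map (\<lambda>u. map (raw_constraint k s u (x, raw_ends x, cells (fst x) (raw_ends x))) [0..<length (cells (fst x) (raw_ends x))]) (templates t))))"
  proof (intro ptime_intros cs ptime_map_const ptime_map)
    fix u
    show "ptime (\<lambda>p. raw_constraint k s u (fst p, raw_ends (fst p), cells (fst (fst p)) (raw_ends (fst p))) (snd p))"
      by (intro ptime_raw_constraint ptime_intros ptime_comp[OF ptime_fst[OF ptime_id] ptime_raw_ends]
          ptime_comp[OF ptime_fst[OF ptime_id] cs])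
  qed
  thus ?thesis by (simp add: raw_transform_def[abs_def] Let_def)
qed

section \<open>Agreement of the program with the transformation\<close>

context input_graph
begin

lemma pair_row_nth:
  assumes "y \<in> words k" "y' \<in> words k"
  shows "pair_row k y y' < length (List.n_lists 2 (List.n_lists k [0, 1 :: bit]))"
    "List.n_lists 2 (List.n_lists k [0, 1]) ! pair_row k y y' = [y, y']"
proof -
  let ?L = "List.n_lists 2 (List.n_lists k [0, 1 :: bit])"
  have "x = 0 \<or> x = 1" for x :: bit by (cases x) auto
  hence "set y \<subseteq> {0, 1}" "set y' \<subseteq> {0, 1}" by auto
  hence "[y, y'] \<in> set ?L" using assms by (auto simp: set_n_lists words_def)
  hence "takeWhile (\<lambda>ws. ws \<noteq> [y, y']) ?L \<noteq> ?L" by (auto simp: takeWhile_eq_all_conv)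
  hence "length (takeWhile (\<lambda>ws. ws \<noteq> [y, y']) ?L) \<noteq> length ?L"
    by (metis order_refl take_all takeWhile_eq_take)
  hence "pair_row k y y' < length ?L"
    unfolding pair_row_def using length_takeWhile_le[of "\<lambda>ws. ws \<noteq> [y, y']" ?L] by linarith
  thus "pair_row k y y' < length ?L" "?L ! pair_row k y y' = [y, y']"
    using nth_length_takeWhile[of "\<lambda>ws. ws \<noteq> [y, y']" ?L] by (auto simp: pair_row_def)
qed

lemma sorted_scope:
  assumes "(x::nat) < y"
  shows "sorted_list_of_set {x, y} = [x, y]"
  using assms by (intro sorted_list_of_set_unique[THEN iffD1]) auto

lemma truth_table_nth:
  assumes j: "j < N" and y: "y \<in> words k" "y' \<in> words k"
  shows "nth_or False (truth_table k (constraints A ! j)) (pair_row k y y') = edge_ok j y y'"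
proof -
  let ?c = "constraints A ! j"
  note e = ee_props[OF j]
  have so: "sorted_list_of_set (scope ?c) = [fst (ee ! j), snd (ee ! j)]"
    unfolding e(3) by (rule sorted_scope[OF e(1)])
  have two: "length [fst (ee ! j), snd (ee ! j)] = 2" by simp
  have "nth_or False (truth_table k ?c) (pair_row k y y')
     = pred ?c (\<lambda>v\<in>scope ?c. the (map_of (zip [fst (ee ! j), snd (ee ! j)] [y, y']) v))"
    unfolding truth_table_def Let_def so two using pair_row_nth[OF y] by simp
  also have "(\<lambda>v\<in>scope ?c. the (map_of (zip [fst (ee ! j), snd (ee ! j)] [y, y']) v))
     = (\<lambda>v\<in>scope ?c. if v = fst (ee ! j) then y else y')"
    using e by (intro restrict_ext) auto
  finally show ?thesis unfolding edge_ok_def .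
qed

abbreviation "env \<equiv> (raw_of k A, ee, cs)"

lemma raw_ends_eq: "raw_ends (raw_of k A) = ee"
proof (rule nth_equalityI)
  fix j assume "j < length (raw_ends (raw_of k A))"
  hence j: "j < N" by (simp add: raw_ends_def raw_of_def)
  note e = ee_props[OF j]
  have "sorted_list_of_set (scope (constraints A ! j)) = [fst (ee ! j), snd (ee ! j)]"
    unfolding e(3) by (rule sorted_scope[OF e(1)])
  thus "raw_ends (raw_of k A) ! j = ee ! j" using j by (simp add: raw_ends_def raw_of_def)
qed (simp add: raw_ends_def raw_of_def)

lemma raw_test_eq:
  assumes z: "z < n" and y: "y \<in> words k" "y' \<in> words k"
  shows "raw_test k env l z y y' \<longleftrightarrow> edge_test edge_ok l z y y'"
proof (cases "half cs z")
  case (Suc j)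
  have j: "j < N" using half_edge(1)[OF z Suc] by simp
  show ?thesis
    using truth_table_nth[OF j y] truth_table_nth[OF j y(2,1)] j Suc
    by (simp add: raw_test_def edge_test_def raw_of_def)
qed (simp add: raw_test_def edge_test_def)

lemma raw_accept_eq:
  assumes u: "u \<in> set (templates t)" and a: "a < n" and x: "w a \<in> words s" "w (walk u a) \<in> words s"
  shows "raw_accept k u env a (w a) (w (walk u a)) \<longleftrightarrow> \<not> reject (opinion w) (edge_test edge_ok) u a"
proof -
  note ut = set_templates[OF u]
  have o: "read_slot k (w v) \<mu> = opinion w v \<mu>" for v \<mu>
    by (simp add: read_slot_def opinion_def slot_of_def)
  have wd: "opinion w v \<mu> \<in> words k" if "w v \<in> words s" "set \<mu> \<subseteq> {..<17}" "length \<mu> \<le> 2 * t" for v \<mu>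
    using slot_fits[OF that(2,3), of k] that(1) by (simp add: opinion_def slot_of_def words_def)
  have 1: "opinion w a (take p u) \<in> words k" for p
    using ut by (intro wd x) (auto dest: in_set_takeD)
  have 2: "opinion w (walk u a) (rv (drop p u)) \<in> words k" for p
    unfolding retrace_eq[symmetric] using ut retrace_props[of "drop p u"]
    by (intro wd x) (auto dest: in_set_dropD)
  have t: "raw_test k env (u ! p) (walk (take p u) a) (opinion w a (take p u)) (opinion w (walk u a) (rv (drop (Suc p) u)))
     \<longleftrightarrow> edge_test edge_ok (u ! p) (walk (take p u) a) (opinion w a (take p u)) (opinion w (walk u a) (rv (drop (Suc p) u)))" for p
    by (rule raw_test_eq[OF walk_template_less[OF u a] 1 2])
  show ?thesis
    unfolding raw_accept_def reject_def o snd_conv walk_to_eq retrace_eq t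
    by (auto simp: less_Suc_eq_le simp del: upt_Suc)
qed

lemma raw_constraint_eq:
  assumes u: "u \<in> set (templates t)" and a: "a < n"
  defines "c \<equiv> conj_constraint k s A ({a, second_var a (walk u a)}, walk_conjuncts k cs ee u a)"
  shows "raw_constraint k s u env a = (sorted_list_of_set (scope c), truth_table s c)"
proof -
  define b where "b = walk u a"
  define v where "v = second_var a b"
  define lo where "lo = (if a < v then a else v)"
  define hi where "hi = (if a < v then v else a)"
  have b: "b < n" unfolding b_def by (rule template_end_less[OF u a])
  note sv = second_var_props[OF a b, folded v_def]
  have av: "a \<noteq> v" using sv(2) by auto
  have lh: "lo < hi" "{a, v} = {lo, hi}" using av by (auto simp: lo_def hi_def)
  have sc: "scope c = {lo, hi}" using lh by (simp add: c_def v_def b_def)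
  have so: "sorted_list_of_set (scope c) = [lo, hi]" unfolding sc by (rule sorted_scope[OF lh(1)])
  have row: "raw_row k u env a b lo ws \<longleftrightarrow> pred c (\<lambda>v\<in>scope c. the (map_of (zip [lo, hi] ws) v))"
    if ws: "ws \<in> set (List.n_lists 2 (List.n_lists s [0, 1]))" for ws
  proof -
    obtain x1 x2 where w12: "ws = [x1, x2]" "x1 \<in> words s" "x2 \<in> words s"
      using ws by (auto simp: set_n_lists words_def length_Suc_conv numeral_2_eq_2)
    define w where "w = (\<lambda>v\<in>scope c. the (map_of (zip [lo, hi] ws) v))"
    have wv: "w lo = x1" "w hi = x2" using lh by (auto simp: w_def sc w12)
    have ws': "w \<in> scope c \<rightarrow>\<^sub>E words s"
      using w12 lh by (auto simp: w_def sc)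
    have ab: "a \<in> {lo, hi}" "b \<in> {lo, hi}" using lh sv(3) by auto
    have "raw_row k u env a b lo ws \<longleftrightarrow> raw_accept k u env a (w a) (w b)"
      using ab lh wv w12 by (auto simp: raw_row_def)
    also have "\<dots> \<longleftrightarrow> \<not> reject (opinion w) (edge_test edge_ok) u a"
      unfolding b_def using ab wv w12 by (intro raw_accept_eq[OF u a]) (auto simp: b_def)
    also have "\<dots> \<longleftrightarrow> (\<forall>x\<in>set (walk_conjuncts k cs ee u a). holds k A w x)"
      by (rule walk_conjuncts_hold[OF u a, symmetric])
    also have "\<dots> \<longleftrightarrow> pred c w"
      using ws' by (simp add: c_def conj_constraint_def)
    finally show ?thesis unfolding w_def .
  qed
  have "truth_table s c = map (raw_row k u env a b lo) (List.n_lists 2 (List.n_lists s [0, 1]))"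
    unfolding truth_table_def so Let_def using row by (simp add: numeral_2_eq_2)
  thus ?thesis
    unfolding so raw_constraint_def Let_def snd_conv walk_to_eq b_def[symmetric] v_def[symmetric] lo_def[symmetric] hi_def[symmetric]
    by simp
qed

lemma raw_transform_eq: "raw_transform k s t (raw_of k A) = raw_of s TA"
proof -
  have nv: "fst (raw_of k A) = num_vars A" by (simp add: raw_of_def)
  have "map (raw_constraint k s u env) [0..<n] = map (\<lambda>a. let c = conj_constraint k s A ({a, second_var a (walk u a)}, walk_conjuncts k cs ee u a)
      in (sorted_list_of_set (scope c), truth_table s c)) [0..<n]" if "u \<in> set (templates t)" for u
    using raw_constraint_eq[OF that] unfolding Let_def by (intro map_cong refl) auto
  hence eq: "map (\<lambda>u. map (raw_constraint k s u env) [0..<n]) (templates t) = map (\<lambda>u. map (\<lambda>a. let c = conj_constraint k s A ({a, second_var a (walk u a)}, walk_conjuncts k cs ee u a)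
      in (sorted_list_of_set (scope c), truth_table s c)) [0..<n]) (templates t)"
    by (rule map_cong[OF refl])
  have "raw_transform k s t (raw_of k A) = (n, concat (map (\<lambda>u. map (raw_constraint k s u env) [0..<n]) (templates t)))"
    unfolding raw_transform_def raw_ends_eq nv Let_def ..
  also have "\<dots> = (n, concat (map (\<lambda>u. map (\<lambda>a. let c = conj_constraint k s A ({a, second_var a (walk u a)}, walk_conjuncts k cs ee u a)
      in (sorted_list_of_set (scope c), truth_table s c)) [0..<n]) (templates t)))"
    by (simp only: eq)
  also have "\<dots> = raw_of s TA"
    unfolding raw_of_def conj_csp_simps spec_eq by (simp add: map_concat o_def Let_def)
  finally show ?thesis .
qed

end

lemma walk_transform_explicit:
  assumes "t > 0"
  shows "explicit k (k * 18 ^ (2 * t)) (restricted_graphs m k) (\<lambda>A. conj_csp k (k * 18 ^ (2 * t)) (walk_spec k t (factor_graph A)) A)"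
proof -
  let ?s = "k * 18 ^ (2 * t)"
  obtain p g where g: "poly_bounded g" "\<And>x. \<exists>n\<le>g x. run p (enc x) n (enc (raw_transform k ?s t x))"
    using ptime_raw_transform unfolding ptime_def by blast
  obtain c e where ce: "\<And>x. g x \<le> c * esize x ^ e" using g(1) unfolding poly_bounded_def by blast
  show ?thesis
    unfolding explicit_def polytime_computable_def
  proof (rule exI[of _ p], rule exI[of _ c], rule exI[of _ e], rule ballI)
    fix A assume "A \<in> restricted_graphs m k"
    then interpret input_graph k m t A using assms by unfold_locales
    obtain n where "n \<le> g (raw_of k A)" "run p (enc (raw_of k A)) n (enc (raw_transform k ?s t (raw_of k A)))"
      using g(2) by blast
    thus "\<exists>n\<le>c * tree_size (encode_csp k A) ^ e. run p (encode_csp k A) n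
       (encode_csp ?s (conj_csp k ?s (walk_spec k t (factor_graph A)) A))"
      using ce[of "raw_of k A"] unfolding raw_transform_eq enc_raw_of esize_def by (meson order_trans)
  qed
qed

section \<open>The reduction\<close>

text \<open>Since \<open>\<delta>\<close> is nonnegative, the bound for
  \<open>\<epsilon> = UNSAT A\<close> implies the bounds for all smaller
  \<open>\<epsilon>\<close>.\<close>

lemma fgprI:
  assumes "\<And>A. A \<in> \<A> \<Longrightarrow> T A \<in> \<B>"
    and "\<And>A B. A \<in> \<A> \<Longrightarrow> B \<in> \<A> \<Longrightarrow> factor_graph A = factor_graph B \<Longrightarrow> factor_graph (T A) = factor_graph (T B)"
    and "\<xi> > 0" "\<delta> \<ge> 0"
    and "\<And>A. A \<in> \<A> \<Longrightarrow> UNSAT A = 0 \<Longrightarrow> UNSAT (T A) = 0"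
    and "\<And>A. A \<in> \<A> \<Longrightarrow> \<delta> * min (UNSAT A) \<xi> \<le> UNSAT (T A)"
    and "\<And>A. A \<in> \<A> \<Longrightarrow> real (csp_size (T A)) \<le> d * real (csp_size A)"
  shows "fgpr \<delta> d \<A> \<B> T"
proof -
  have "\<delta> * min \<epsilon> \<xi> \<le> UNSAT (T A)" if "A \<in> \<A>" "\<epsilon> \<le> UNSAT A" for A \<epsilon>
  proof -
    have "\<delta> * min \<epsilon> \<xi> \<le> \<delta> * min (UNSAT A) \<xi>"
      using that(2) assms(4) by (intro mult_left_mono) auto
    thus ?thesis using assms(6)[OF that(1)] by simp
  qed
  thus ?thesis using assms(1,2,3,5,7) unfolding fgpr_def by blast
qed

lemma UNSAT_no_constraints:
  assumes "constraints P = []" "finite (alphabet P)" "alphabet P \<noteq> {}"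
  shows "UNSAT P = 0"
proof -
  obtain a where "UNSAT P = unsat_fraction P a" using UNSAT_attained[OF assms(2,3)] .
  thus ?thesis using assms(1) by (simp add: unsat_fraction_def)
qed

text \<open>With no polynomial available every constraint is an empty conjunction, and any
  assignment satisfies it.\<close>

lemma UNSAT_0_restricted:
  assumes "A \<in> restricted_graphs 0 k"
  shows "UNSAT A = 0"
proof -
  have alph: "alphabet A = words k" using assms by (simp add: restricted_graphs_def)
  obtain \<tau> where \<tau>: "\<tau> \<in> vars A \<rightarrow>\<^sub>E words k" "UNSAT A = unsat_fraction A \<tau>"
    using UNSAT_attained[of A] finite_words words_nonempty by (metis alph)
  have "pred c (restrict \<tau> (scope c))" if c: "c \<in> set (constraints A)" for c
  proof -
    have "scope c \<subseteq> vars A" "restricted 0 k c"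
      using assms c by (auto simp: restricted_graphs_def constraint_graph_def wf_csp_def)
    moreover from this(1) have "restrict \<tau> (scope c) \<in> scope c \<rightarrow>\<^sub>E words k" using \<tau>(1) by auto
    ultimately show ?thesis by (auto simp: restricted_def associated_def)
  qed
  thus ?thesis using \<tau>(2) by (simp add: unsat_fraction_def)
qed

lemma polytime_const: "polytime_computable f g \<A> (\<lambda>_. c)"
  unfolding polytime_computable_def
  by (rule exI[of _ "const_prog (g c)"], rule exI[of _ "tree_size (g c)"], rule exI[of _ 1])
     (use run_const_prog in auto)

text \<open>Serves the cases \<open>m = 0\<close> and \<open>t = 0\<close>. There the bound
  \<open>K k * (m * t)\<close> is 0, which leaves no polynomials for equality checks, while
  soundness is trivial because \<open>\<delta> * UNSAT A\<close> vanishes.\<close>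

lemma empty_transform:
  fixes k m s M l :: nat
  assumes \<delta>: "\<delta> \<ge> 0" and triv: "\<And>A. A \<in> restricted_graphs m k \<Longrightarrow> \<delta> * UNSAT A = 0" and d: "d \<ge> 0"
  defines "T \<equiv> conj_csp k s (0, [])"
  shows "fgpr \<delta> d (restricted_graphs m k) (restricted_graphs M s) T \<and> explicit k s (restricted_graphs m k) T \<and>
    forms_conjunctions l k s (restricted_graphs m k) T \<and> (\<forall>A B. close m k A B \<longrightarrow> close M s (T A) (T B))"
proof (intro conjI allI impI)
  have val: "valid_spec j k s A (0, [])" for j A by (simp add: valid_spec_def)
  have U: "UNSAT (T A) = 0" for A
    using finite_words words_nonempty by (intro UNSAT_no_constraints) (auto simp: T_def)
  show "fgpr \<delta> d (restricted_graphs m k) (restricted_graphs M s) T"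
  proof (rule fgprI[of _ _ _ 1])
    fix A :: "bit list csp" assume A: "A \<in> restricted_graphs m k"
    show "T A \<in> restricted_graphs M s" unfolding T_def by (rule conj_csp_restricted[OF A val[of 0]]) simp
    have "\<delta> * min (UNSAT A) 1 \<le> \<delta> * UNSAT A" using \<delta> by (intro mult_left_mono) auto
    thus "\<delta> * min (UNSAT A) 1 \<le> UNSAT (T A)" using triv[OF A] by (simp add: U)
    show "real (csp_size (T A)) \<le> d * real (csp_size A)"
      using d by (simp add: csp_size_def T_def vars_def)
  qed (use \<delta> U factor_graph_conj_csp in \<open>auto simp: T_def\<close>)
  have "T = (\<lambda>_. T undefined)" by (auto simp: T_def conj_csp_def)
  thus "explicit k s (restricted_graphs m k) T" unfolding explicit_def by (metis polytime_const)
  show "forms_conjunctions l k s (restricted_graphs m k) T"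
    unfolding T_def by (rule conj_csp_forms_conjunctions[where G = "\<lambda>_. (0, [])"]) (rule val)
  show "close M s (T A) (T B)" if "close m k A B" for A B
    unfolding T_def by (rule conj_csp_close[OF that val[of 0] val[of 0]]) simp
qed

lemma walk_transform:
  fixes k m t :: nat
  assumes m: "m > 0" and t: "t > 0"
  defines "s \<equiv> k * 18 ^ (2 * t)" and "M \<equiv> 4 * (k + 1) * (m * t)"
  defines "T \<equiv> \<lambda>A. conj_csp k s (walk_spec k t (factor_graph A)) A"
  shows "fgpr (7 / 10880 / (128 * (3 + 340 / 7)) * real t) (32 * (1 + 17 ^ (2 * t - 1) * real (2 * t - 1)))
      (restricted_graphs m k) (restricted_graphs M s) T \<and> explicit k s (restricted_graphs m k) T \<and>
    forms_conjunctions (4 * t) k s (restricted_graphs m k) T \<and> (\<forall>A B. close m k A B \<longrightarrow> close M s (T A) (T B))"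
proof (intro conjI allI impI)
  have graph: "input_graph k m t A" if "A \<in> restricted_graphs m k" for A
    using that t by unfold_locales
  note defs = T_def s_def
  have val: "valid_spec (4 * t) k s A (walk_spec k t (factor_graph A))" if "A \<in> restricted_graphs m k" for A
    unfolding s_def by (rule input_graph.valid_walk_spec[OF graph[OF that]])
  \<comment> \<open>For \<open>m > 0\<close> the \<open>k\<close> polynomials of an equality are at
    most \<open>k * m\<close>, so the bound is linear in \<open>m * t\<close> with a factor that
    depends only on \<open>k\<close>.\<close>
  have M: "4 * t * max m k \<le> M"
  proof -
    have "max m k \<le> m * (k + 1)" using m by (cases m) auto
    hence "4 * t * max m k \<le> 4 * t * (m * (k + 1))" by (rule mult_left_mono) simp
    also have "\<dots> = M" by (simp only: M_def mult_ac)
    finally show ?thesis .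
  qed
  show "fgpr (7 / 10880 / (128 * (3 + 340 / 7)) * real t) (32 * (1 + 17 ^ (2 * t - 1) * real (2 * t - 1)))
      (restricted_graphs m k) (restricted_graphs M s) T"
  proof (rule fgprI[of _ _ _ "1 / real t"])
    fix A assume A: "A \<in> restricted_graphs m k"
    show "T A \<in> restricted_graphs M s" unfolding T_def by (rule conj_csp_restricted[OF A val[OF A] M])
    show "UNSAT A = 0 \<Longrightarrow> UNSAT (T A) = 0" unfolding defs by (rule input_graph.completeness[OF graph[OF A]])
    show "7 / 10880 / (128 * (3 + 340 / 7)) * real t * min (UNSAT A) (1 / real t) \<le> UNSAT (T A)"
      unfolding defs by (rule input_graph.soundness[OF graph[OF A]])
    show "real (csp_size (T A)) \<le> 32 * (1 + 17 ^ (2 * t - 1) * real (2 * t - 1)) * real (csp_size A)"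
      unfolding defs by (rule input_graph.size_TA[OF graph[OF A]])
  next
    fix A B :: "bit list csp" assume "factor_graph A = factor_graph B"
    thus "factor_graph (T A) = factor_graph (T B)"
      unfolding T_def by (simp only: factor_graph_conj_csp[of k s _ A B])
  qed (use t in auto)
  show "explicit k s (restricted_graphs m k) T"
    unfolding defs by (rule walk_transform_explicit[OF t])
  show "forms_conjunctions (4 * t) k s (restricted_graphs m k) T"
    unfolding T_def by (rule conj_csp_forms_conjunctions) (rule val)
  show "close M s (T A) (T B)" if AB: "close m k A B" for A B
  proof -
    have A: "A \<in> restricted_graphs m k" and B: "B \<in> restricted_graphs m k" and fg: "factor_graph A = factor_graph B"
      using AB by (auto simp: close_def)
    have "valid_spec (4 * t) k s B (walk_spec k t (factor_graph A))" using val[OF B] by (simp only: fg)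
    from conj_csp_close[OF AB val[OF A] this M] show ?thesis by (simp only: T_def fg)
  qed
qed

theorem theorem8:
  shows "\<exists>(\<alpha>::real) > 0. \<exists>(\<delta> :: nat \<Rightarrow> real) (c :: nat \<Rightarrow> real) (s :: nat \<Rightarrow> nat \<Rightarrow> nat)
           (K :: nat \<Rightarrow> nat) (C :: nat).
         (\<forall>t. \<delta> t \<ge> \<alpha> * real t) \<and>
         (\<forall>k m t. \<exists>T :: bit list csp \<Rightarrow> bit list csp.
            fgpr (\<delta> t) (c t) (restricted_graphs m k) (restricted_graphs (K k * (m * t)) (s k t)) T \<and>
            explicit k (s k t) (restricted_graphs m k) T \<and>
            forms_conjunctions (C * t) k (s k t) (restricted_graphs m k) T \<and>
            (\<forall>A B. close m k A B \<longrightarrow> close (K k * (m * t)) (s k t) (T A) (T B)))"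
proof -
  define \<alpha> :: real where "\<alpha> = 7 / 10880 / (128 * (3 + 340 / 7))"
  have main: "\<exists>T :: bit list csp \<Rightarrow> bit list csp.
      fgpr (\<alpha> * real t) (32 * (1 + 17 ^ (2 * t - 1) * real (2 * t - 1))) (restricted_graphs m k)
        (restricted_graphs (4 * (k + 1) * (m * t)) (k * 18 ^ (2 * t))) T \<and>
      explicit k (k * 18 ^ (2 * t)) (restricted_graphs m k) T \<and>
      forms_conjunctions (4 * t) k (k * 18 ^ (2 * t)) (restricted_graphs m k) T \<and>
      (\<forall>A B. close m k A B \<longrightarrow> close (4 * (k + 1) * (m * t)) (k * 18 ^ (2 * t)) (T A) (T B))" for k m t
  proof (cases "m > 0 \<and> t > 0")
    case True
    show ?thesis unfolding \<alpha>_def by (rule exI, rule walk_transform[OF True[THEN conjunct1] True[THEN conjunct2]])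
  next
    case False
    have triv: "\<alpha> * real t * UNSAT A = 0" if "A \<in> restricted_graphs m k" for A
      using False UNSAT_0_restricted that by auto
    show ?thesis by (rule exI, rule empty_transform[OF _ triv]) (simp_all add: \<alpha>_def)
  qed
  show ?thesis
  proof (rule exI[of _ \<alpha>], rule conjI, goal_cases)
    case 2
    show ?case
      by (rule exI[of _ "\<lambda>t. \<alpha> * real t"], rule exI[of _ "\<lambda>t. 32 * (1 + 17 ^ (2 * t - 1) * real (2 * t - 1))"],
          rule exI[of _ "\<lambda>k t. k * 18 ^ (2 * t)"], rule exI[of _ "\<lambda>k. 4 * (k + 1)"], rule exI[of _ 4],
          intro conjI allI order_refl main)
  qed (simp add: \<alpha>_def)
qed

end
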